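(* Let $n\ge2$. Then $U_S=B\,C_{U_S}(B)\cong B\otimes_{\mathbb{C}}C_{U_S}(B)$ (as associative algebras), and $Z(U_S)\cong Z(C_{U_S}(B))$.
   Context: Fix an integer $n\ge 2$ and let $J_n=\begin{pmatrix}0&I_n\\-I_n&0\end{pmatrix}$, $\mathfrak{sp}_{2n}=\{A\in\mathfrak{gl}_{2n}(\mathbb{C})\mid A^tJ_n+J_nA=0\}$. With $e_{i,j}$ the matrix units of $\mathfrak{gl}_{2n}$, put $h_i=e_{i,i}-e_{n+i,n+i}$ ($1\le i\le n$), $X_{\epsilon_i-\epsilon_j}=e_{i,j}-e_{n+j,n+i}$ ($i\ne j$), $X_{2\epsilon_1}=2e_{1,n+1}$. $S=\{X_{2\epsilon_1}^{i_1}X_{\epsilon_1-\epsilon_2}^{i_2}\cdots X_{\epsilon_1-\epsilon_n}^{i_n}\mid i_1,\dots,i_n\in\mathbb{Z}_{\ge0}\}$ is an Ore subset of $U(\mathfrak{sp}_{2n})$; $U_S$ is the localization of $U(\mathfrak{sp}_{2n})$ at $S$. $B$ is the subalgebra of $U_S$ generated by $h_1,\dots,h_n,X_{\epsilon_1-\epsilon_2}^{\pm1},\dots,X_{\epsilon_1-\epsilon_n}^{\pm1},X_{2\epsilon_1}^{\pm1}$, and $C_{U_S}(B)=\{u\in U_S\mid[u,B]=0\}$. $Z(R)$ denotes the center of an algebra $R$. *)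

theory Defs
  imports
    "Jordan_Normal_Form.VS_Connect"
    "HOL-Algebra.QuotRing"
    "HOL-Algebra.Subrings"
    "HOL-Algebra.Ideal_Product"
    "HOL-Library.Poly_Mapping"
begin

text \<open>The locale \<open>algebra\<close> of HOL-Algebra is restricted to commutative algebras, hence the
  following one. The record type \<open>module\<close> carries all the operations that are needed.\<close>

locale complex_algebra = Module.module class_ring A + ring A
  for A :: "(complex, 'a) module" (structure) +
  assumes smult_mult_left:
      "\<lbrakk> x \<in> carrier A; y \<in> carrier A \<rbrakk> \<Longrightarrow> (c \<odot> x) \<otimes>\<^bsub>A\<^esub> y = c \<odot> (x \<otimes>\<^bsub>A\<^esub> y)"
    and smult_mult_right:
      "\<lbrakk> x \<in> carrier A; y \<in> carrier A \<rbrakk> \<Longrightarrow> x \<otimes>\<^bsub>A\<^esub> (c \<odot> y) = c \<odot> (x \<otimes>\<^bsub>A\<^esub> y)"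

definition alg_hom :: "(complex, 'a) module \<Rightarrow> (complex, 'b) module \<Rightarrow> ('a \<Rightarrow> 'b) set" where
  "alg_hom A A' =
     {f \<in> Ring.ring_hom A A'. \<forall>c. \<forall>x \<in> carrier A. f (c \<odot>\<^bsub>A\<^esub> x) = c \<odot>\<^bsub>A'\<^esub> f x}"

definition alg_isomorphic :: "(complex, 'a) module \<Rightarrow> (complex, 'b) module \<Rightarrow> bool" where
  "alg_isomorphic A A' \<longleftrightarrow> (\<exists>f \<in> alg_hom A A'. bij_betw f (carrier A) (carrier A'))"

definition complex_subalgebra :: "'a set \<Rightarrow> (complex, 'a) module \<Rightarrow> bool" where
  "complex_subalgebra H A \<longleftrightarrow> subring H A \<and> (\<forall>c. \<forall>x \<in> H. c \<odot>\<^bsub>A\<^esub> x \<in> H)"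

definition generated_subalgebra :: "(complex, 'a) module \<Rightarrow> 'a set \<Rightarrow> 'a set" where
  "generated_subalgebra A X = \<Inter>{H. complex_subalgebra H A \<and> X \<subseteq> H}"

definition centralizer :: "(complex, 'a) module \<Rightarrow> 'a set \<Rightarrow> 'a set" where
  "centralizer A H =
     {u \<in> carrier A. \<forall>b \<in> H. u \<otimes>\<^bsub>A\<^esub> b \<ominus>\<^bsub>A\<^esub> b \<otimes>\<^bsub>A\<^esub> u = \<zero>\<^bsub>A\<^esub>}"

definition center :: "(complex, 'a) module \<Rightarrow> 'a set" where
  "center A = {z \<in> carrier A. \<forall>x \<in> carrier A. z \<otimes>\<^bsub>A\<^esub> x = x \<otimes>\<^bsub>A\<^esub> z}"

abbreviation restrict_alg :: "(complex, 'a) module \<Rightarrow> 'a set \<Rightarrow> (complex, 'a) module" where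
  "restrict_alg A H \<equiv> A\<lparr>carrier := H\<rparr>"

definition quotient_alg :: "(complex, 'a) module \<Rightarrow> 'a set \<Rightarrow> (complex, 'a set) module" where
  "quotient_alg A I =
     \<lparr>carrier = carrier (A Quot I), mult = mult (A Quot I), one = one (A Quot I),
      zero = zero (A Quot I), add = add (A Quot I),
      smult = (\<lambda>c X. \<Union>x \<in> X. I +>\<^bsub>A\<^esub> (c \<odot>\<^bsub>A\<^esub> x))\<rparr>"

text \<open>Elements are the finitely supported functions on the monoid; the basis element belonging to
  \<open>w\<close> is \<open>Poly_Mapping.single w 1\<close>.\<close>

definition monoid_alg :: "('w, 'k) monoid_scheme \<Rightarrow> (complex, 'w \<Rightarrow>\<^sub>0 complex) module" where
  "monoid_alg M =
     \<lparr>carrier = {f. Poly_Mapping.keys f \<subseteq> carrier M},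
      mult = (\<lambda>f g. \<Sum>u \<in> Poly_Mapping.keys f. \<Sum>v \<in> Poly_Mapping.keys g.
                Poly_Mapping.single (u \<otimes>\<^bsub>M\<^esub> v)
                  (Poly_Mapping.lookup f u * Poly_Mapping.lookup g v)),
      one = Poly_Mapping.single \<one>\<^bsub>M\<^esub> 1, zero = 0, add = (+),
      smult = (\<lambda>c. Poly_Mapping.map ((*) c))\<rparr>"

definition free_monoid :: "'a set \<Rightarrow> 'a list monoid" where
  "free_monoid X = \<lparr>carrier = lists X, mult = (@), one = []\<rparr>"

abbreviation free_alg :: "'a set \<Rightarrow> (complex, 'a list \<Rightarrow>\<^sub>0 complex) module" where
  "free_alg X \<equiv> monoid_alg (free_monoid X)"

text \<open>Tensor product over the complex numbers. The linear span of \<open>tensor_relations A A'\<close> is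
  already a two-sided ideal of the monoid algebra of \<open>A \<times>\<times> A'\<close> (multiplying a relation by
  a basis element gives another relation), so that the underlying vector space of the quotient
  is the usual tensor product, with \<open>(a \<otimes> b) (a' \<otimes> b') = a a' \<otimes> b b'\<close>.\<close>

definition tensor_relations ::
    "(complex, 'a) module \<Rightarrow> (complex, 'b) module \<Rightarrow> ('a \<times> 'b \<Rightarrow>\<^sub>0 complex) set" where
  "tensor_relations A A' =
     {Poly_Mapping.single (a \<oplus>\<^bsub>A\<^esub> a', b) 1 - Poly_Mapping.single (a, b) 1
        - Poly_Mapping.single (a', b) 1
      | a a' b. a \<in> carrier A \<and> a' \<in> carrier A \<and> b \<in> carrier A'} \<union>
     {Poly_Mapping.single (a, b \<oplus>\<^bsub>A'\<^esub> b') 1 - Poly_Mapping.single (a, b) 1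
        - Poly_Mapping.single (a, b') 1
      | a b b'. a \<in> carrier A \<and> b \<in> carrier A' \<and> b' \<in> carrier A'} \<union>
     {Poly_Mapping.single (c \<odot>\<^bsub>A\<^esub> a, b) 1 - Poly_Mapping.single (a, b) c
      | c a b. a \<in> carrier A \<and> b \<in> carrier A'} \<union>
     {Poly_Mapping.single (a, c \<odot>\<^bsub>A'\<^esub> b) 1 - Poly_Mapping.single (a, b) c
      | c a b. a \<in> carrier A \<and> b \<in> carrier A'}"

definition tensor_alg ::
    "(complex, 'a) module \<Rightarrow> (complex, 'b) module \<Rightarrow> (complex, ('a \<times> 'b \<Rightarrow>\<^sub>0 complex) set) module"
  where "tensor_alg A A' =
     quotient_alg (monoid_alg (A \<times>\<times> A')) (Idl\<^bsub>monoid_alg (A \<times>\<times> A')\<^esub> (tensor_relations A A'))"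

text \<open>Here \<open>g\<close> is a Lie algebra of square matrices. The tensor algebra of
  \<open>g\<close> is the free algebra on the underlying set of \<open>g\<close> modulo the first two families
  of relations.\<close>

definition enveloping_relations :: "complex mat set \<Rightarrow> (complex mat list \<Rightarrow>\<^sub>0 complex) set" where
  "enveloping_relations g =
     {Poly_Mapping.single [x + y] 1 - Poly_Mapping.single [x] 1 - Poly_Mapping.single [y] 1
      | x y. x \<in> g \<and> y \<in> g} \<union>
     {Poly_Mapping.single [c \<cdot>\<^sub>m x] 1 - Poly_Mapping.single [x] c | c x. x \<in> g} \<union>
     {Poly_Mapping.single [x, y] 1 - Poly_Mapping.single [y, x] 1
        - Poly_Mapping.single [x * y - y * x] 1
      | x y. x \<in> g \<and> y \<in> g}"

definition enveloping_ideal :: "complex mat set \<Rightarrow> (complex mat list \<Rightarrow>\<^sub>0 complex) set" where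
  "enveloping_ideal g = Idl\<^bsub>free_alg g\<^esub> (enveloping_relations g)"

definition enveloping_alg ::
    "complex mat set \<Rightarrow> (complex, (complex mat list \<Rightarrow>\<^sub>0 complex) set) module" where
  "enveloping_alg g = quotient_alg (free_alg g) (enveloping_ideal g)"

definition enveloping_incl ::
    "complex mat set \<Rightarrow> complex mat \<Rightarrow> (complex mat list \<Rightarrow>\<^sub>0 complex) set" where
  "enveloping_incl g x = enveloping_ideal g +>\<^bsub>free_alg g\<^esub> Poly_Mapping.single [x] 1"

text \<open>\<open>Q\<close> with \<open>\<phi>\<close> is a (left) quotient ring of \<open>A\<close> with respect to \<open>S\<close>: elements of \<open>S\<close> become
  invertible, all elements are fractions, and the kernel is the \<open>S\<close>-torsion. For an Ore
  set \<open>S\<close> of regular elements such a pair exists, is unique up to a unique isomorphism,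
  and agrees with the quotient ring formed with right fractions.\<close>

definition ore_localization ::
    "(complex, 'a) module \<Rightarrow> 'a set \<Rightarrow> (complex, 'q) module \<Rightarrow> ('a \<Rightarrow> 'q) \<Rightarrow> bool" where
  "ore_localization A S Q \<phi> \<longleftrightarrow>
     complex_algebra Q \<and> \<phi> \<in> alg_hom A Q \<and>
     (\<forall>s \<in> S. \<phi> s \<in> Units Q) \<and>
     carrier Q = {inv\<^bsub>Q\<^esub> (\<phi> s) \<otimes>\<^bsub>Q\<^esub> \<phi> a | s a. s \<in> S \<and> a \<in> carrier A} \<and>
     (\<forall>a \<in> carrier A. \<phi> a = \<zero>\<^bsub>Q\<^esub> \<longleftrightarrow> (\<exists>s \<in> S. s \<otimes>\<^bsub>A\<^esub> a = \<zero>\<^bsub>A\<^esub>))"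

definition J_mat :: "nat \<Rightarrow> complex mat" where
  "J_mat n = four_block_mat (0\<^sub>m n n) (1\<^sub>m n) (- 1\<^sub>m n) (0\<^sub>m n n)"

definition sp :: "nat \<Rightarrow> complex mat set" where
  "sp n = {A \<in> carrier_mat (2 * n) (2 * n).
             transpose_mat A * J_mat n + J_mat n * A = 0\<^sub>m (2 * n) (2 * n)}"

text \<open>All indices below run from 1 as in the usual matrix notation, whereas
  \<^const>\<open>mat\<close> counts rows and columns from 0.\<close>

definition e_mat :: "nat \<Rightarrow> nat \<Rightarrow> nat \<Rightarrow> complex mat" where
  "e_mat n i j = mat (2 * n) (2 * n) (\<lambda>(r, s). if Suc r = i \<and> Suc s = j then 1 else 0)"

definition h_mat :: "nat \<Rightarrow> nat \<Rightarrow> complex mat" where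
  "h_mat n i = e_mat n i i - e_mat n (n + i) (n + i)"

definition X_mat :: "nat \<Rightarrow> nat \<Rightarrow> nat \<Rightarrow> complex mat" where
  "X_mat n i j = e_mat n i j - e_mat n (n + j) (n + i)"

definition X2_mat :: "nat \<Rightarrow> complex mat" where
  "X2_mat n = 2 \<cdot>\<^sub>m e_mat n 1 (n + 1)"

abbreviation U_sp :: "nat \<Rightarrow> (complex, (complex mat list \<Rightarrow>\<^sub>0 complex) set) module" where
  "U_sp n \<equiv> enveloping_alg (sp n)"

abbreviation U_incl :: "nat \<Rightarrow> complex mat \<Rightarrow> (complex mat list \<Rightarrow>\<^sub>0 complex) set" where
  "U_incl n \<equiv> enveloping_incl (sp n)"

definition S_set :: "nat \<Rightarrow> (complex mat list \<Rightarrow>\<^sub>0 complex) set set" where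
  "S_set n =
     {U_incl n (X2_mat n) [^]\<^bsub>U_sp n\<^esub> i 1 \<otimes>\<^bsub>U_sp n\<^esub>
        foldr (\<lambda>j u. U_incl n (X_mat n 1 j) [^]\<^bsub>U_sp n\<^esub> i j \<otimes>\<^bsub>U_sp n\<^esub> u)
          [2..<Suc n] \<one>\<^bsub>U_sp n\<^esub>
      | i :: nat \<Rightarrow> nat. True}"

definition B_alg ::
    "nat \<Rightarrow> (complex, 'q) module \<Rightarrow> ((complex mat list \<Rightarrow>\<^sub>0 complex) set \<Rightarrow> 'q) \<Rightarrow> 'q set" where
  "B_alg n Q \<phi> = generated_subalgebra Q
     ({\<phi> (U_incl n (h_mat n i)) | i. i \<in> {1..n}} \<union>
      {\<phi> (U_incl n (X_mat n 1 j)) | j. j \<in> {2..n}} \<union>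
      {inv\<^bsub>Q\<^esub> (\<phi> (U_incl n (X_mat n 1 j))) | j. j \<in> {2..n}} \<union>
      {\<phi> (U_incl n (X2_mat n)), inv\<^bsub>Q\<^esub> (\<phi> (U_incl n (X2_mat n)))})"

end

theory Submission
  imports Defs
begin

text \<open>The elements \<open>t 1 = X_{2 \<epsilon>_1}\<close>, \<open>t j = X_{\<epsilon>_1 - \<epsilon>_j}\<close> and suitable combinations
  \<open>d i\<close> of the \<open>h_j\<close> satisfy \<open>[d i, t j] = \<delta>_{ij} t j\<close>, so that \<open>B\<close> is an algebra of differential
  operators on a torus, with \<open>p i = t i^{-1} d i\<close> as partial derivatives. An element that is killed by
  iterated commutators with the \<open>t i\<close> and is a weight vector for the \<open>d i\<close> lies in \<open>B C\<close>: the operator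
  \<open>u \<mapsto> k u + \<Sum>_i [t i, u] p i\<close> lowers the degree \<open>k\<close>, and in degree 0 a product with a monomial in the
  \<open>t i\<close> moves \<open>u\<close> into \<open>C\<close>. Root vectors have degree at most 2 because products of two of the matrices
  \<open>t i\<close> vanish; they generate the enveloping algebra, and the denominators are units of \<open>B\<close>,
  which gives the factorization. The monomials \<open>t^a p^b\<close> are linearly independent over \<open>C\<close>
  (take commutators with the \<open>t i\<close> and then with the \<open>d i\<close>) and span \<open>B\<close>, so the multiplication map
  \<open>B \<otimes> C \<rightarrow> B C\<close> is injective. An element of \<open>C\<close> is central in \<open>B C\<close> iff it is central in \<open>C\<close>.\<close>

text \<open>The weights of the \<open>t i\<close> are 2 eps_1 and eps_1 - eps_j. The
  \<open>d i\<close> form the dual basis of the diagonal matrices: half the sum of all h_k for i =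
  1, and - h_i for i > 1. In spite of the factor 1/2 every root of sp takes integral values on this
  basis. This is what makes the passage into \<open>C\<close> possible: an element of weight w
  commuting with all \<open>t i\<close> is multiplied by the inverse of the Laurent monomial with
  exponent vector w, which requires integral exponents. The degree is the order of a differential
  operator. Lowering it by the Euler operator ends with a division by k; hence degree 0 is treated
  separately, and characteristic zero enters there. The products of two of the \<open>t i\<close>
  vanish as matrices, whereas in the localization they are units. The bound on the degree of a root
  vector is therefore computed inside sp and only then carried over to the algebra.\<close>

context complex_algebra
begin

text \<open>The facts of the locale \<open>module\<close> refer to the operations of
  \<open>class_ring\<close>. This and the following variants use those of type
  \<open>complex\<close>, so that scalars are handled by ordinary arithmetic.\<close>

lemma smult_in_carrier [simp, intro]: "x \<in> carrier A \<Longrightarrow> (c::complex) \<odot> x \<in> carrier A"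
  using smult_closed[of c x] by simp

lemma smult_add_left: "x \<in> carrier A \<Longrightarrow> (a + b) \<odot> x = a \<odot> x \<oplus>\<^bsub>A\<^esub> b \<odot> x"
  using smult_l_distr[of a b x] by simp

lemma smult_add_right: "\<lbrakk>x \<in> carrier A; y \<in> carrier A\<rbrakk> \<Longrightarrow> (a::complex) \<odot> (x \<oplus>\<^bsub>A\<^esub> y) = a \<odot> x \<oplus>\<^bsub>A\<^esub> a \<odot> y"
  using smult_r_distr[of a x y] by simp

lemma smult_smult: "x \<in> carrier A \<Longrightarrow> a \<odot> (b \<odot> x) = (a * b) \<odot> x"
  using smult_assoc1[of a b x] by simp

lemma one_smult [simp]: "x \<in> carrier A \<Longrightarrow> 1 \<odot> x = x"
  using smult_one[of x] by simp

lemma zero_smult [simp]: "x \<in> carrier A \<Longrightarrow> 0 \<odot> x = \<zero>\<^bsub>A\<^esub>"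
  using smult_l_null[of x] by simp

lemma smult_zero [simp]: "(c::complex) \<odot> \<zero>\<^bsub>A\<^esub> = \<zero>\<^bsub>A\<^esub>"
  using smult_r_null[of c] by simp

lemma minus_one_smult: "x \<in> carrier A \<Longrightarrow> (-1) \<odot> x = \<ominus>\<^bsub>A\<^esub> x"
  by (metis add.inv_equality add.inverse_inverse left_minus one_smult smult_add_left smult_in_carrier zero_smult)

lemma smult_eq_zero: "\<lbrakk>x \<in> carrier A; c \<odot> x = \<zero>\<^bsub>A\<^esub>; c \<noteq> 0\<rbrakk> \<Longrightarrow> x = \<zero>\<^bsub>A\<^esub>"
  by (metis left_inverse one_smult smult_smult smult_zero)

lemma smult_minus: "x \<in> carrier A \<Longrightarrow> c \<odot> (\<ominus>\<^bsub>A\<^esub> x) = \<ominus>\<^bsub>A\<^esub> (c \<odot> x)"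
  by (simp add: minus_one_smult[symmetric] smult_smult)

lemma smult_finsum:
  "\<lbrakk>finite I; f \<in> I \<rightarrow> carrier A\<rbrakk> \<Longrightarrow> (c::complex) \<odot> finsum A f I = (\<Oplus>\<^bsub>A\<^esub>i\<in>I. c \<odot> f i)"
  by (induct I rule: finite_induct) (auto simp: Pi_def smult_add_right)

end

section \<open>Commutators and ordered products in noncommutative rings\<close>

definition (in ring) br :: "'a \<Rightarrow> 'a \<Rightarrow> 'a"
  where "br x y = x \<otimes> y \<ominus> y \<otimes> x"

context ring
begin

lemma br_closed [simp, intro]: "\<lbrakk>x \<in> carrier R; y \<in> carrier R\<rbrakk> \<Longrightarrow> br x y \<in> carrier R"
  by (simp add: br_def)

lemma br_eq_zero_iff: "\<lbrakk>x \<in> carrier R; y \<in> carrier R\<rbrakk> \<Longrightarrow> br x y = \<zero> \<longleftrightarrow> x \<otimes> y = y \<otimes> x"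
  by (simp add: br_def r_right_minus_eq)

lemma br_swap: "\<lbrakk>x \<in> carrier R; y \<in> carrier R\<rbrakk> \<Longrightarrow> br y x = \<ominus> br x y"
  unfolding br_def by algebra

lemma br_add_right:
  "\<lbrakk>x \<in> carrier R; y \<in> carrier R; z \<in> carrier R\<rbrakk> \<Longrightarrow> br x (y \<oplus> z) = br x y \<oplus> br x z"
  unfolding br_def by algebra

text \<open>Leibniz rule: \<open>br x\<close> is a derivation. Commutators with monomials are
  reduced to commutators with their factors by it.\<close>

lemma br_mult_right:
  "\<lbrakk>x \<in> carrier R; y \<in> carrier R; z \<in> carrier R\<rbrakk> \<Longrightarrow> br x (y \<otimes> z) = br x y \<otimes> z \<oplus> y \<otimes> br x z"
  unfolding br_def by algebra

lemma mult_eq_br: "\<lbrakk>x \<in> carrier R; y \<in> carrier R\<rbrakk> \<Longrightarrow> x \<otimes> y = y \<otimes> x \<oplus> br x y"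
  unfolding br_def by algebra

lemma br_zero_right [simp]: "x \<in> carrier R \<Longrightarrow> br x \<zero> = \<zero>"
  unfolding br_def by algebra

lemma br_one_right [simp]: "x \<in> carrier R \<Longrightarrow> br x \<one> = \<zero>"
  by (simp add: br_eq_zero_iff)

lemma br_zero_left [simp]: "x \<in> carrier R \<Longrightarrow> br \<zero> x = \<zero>"
  unfolding br_def by algebra

text \<open>In this form the identity says that \<open>br x\<close> is a derivation of the bracket;
  it is the reason why weights add up under commutators.\<close>

lemma br_jacobi:
  assumes "x \<in> carrier R" "y \<in> carrier R" "z \<in> carrier R"
  shows "br x (br y z) = br (br x y) z \<oplus> br y (br x z)"
  using assms(1-3) unfolding br_def by algebra

lemma br_br_commute:
  "\<lbrakk>x \<in> carrier R; y \<in> carrier R; z \<in> carrier R; br x y = \<zero>\<rbrakk> \<Longrightarrow> br x (br y z) = br y (br x z)"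
  using br_jacobi[of x y z] by simp

lemma br_finsum:
  "\<lbrakk>finite I; x \<in> carrier R; f \<in> I \<rightarrow> carrier R\<rbrakk> \<Longrightarrow> br x (finsum R f I) = (\<Oplus>i\<in>I. br x (f i))"
  by (induct I rule: finite_induct) (auto simp: Pi_def br_add_right)

end

context complex_algebra
begin

lemma br_smult_right:
  "\<lbrakk>x \<in> carrier A; y \<in> carrier A\<rbrakk> \<Longrightarrow> br x (c \<odot> y) = c \<odot> br x y"
  by (simp add: br_def minus_eq smult_mult_left smult_mult_right smult_add_right smult_minus)

end

text \<open>The factors need not commute, so the product follows a list. The body has the shape of
  the \<open>foldr\<close> in \<open>S_set\<close>, which can thus be folded into it.\<close>

definition (in ring) cprod :: "('i \<Rightarrow> 'a) \<Rightarrow> 'i list \<Rightarrow> 'a"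
  where "cprod f L = foldr (\<lambda>i u. f i \<otimes> u) L \<one>"

context ring
begin

lemma cprod_Nil [simp]: "cprod f [] = \<one>"
  and cprod_Cons [simp]: "cprod f (i # L) = f i \<otimes> cprod f L"
  by (simp_all add: cprod_def)

lemma cprod_closed [simp]: "(\<And>i. i \<in> set L \<Longrightarrow> f i \<in> carrier R) \<Longrightarrow> cprod f L \<in> carrier R"
  by (induct L) auto

lemma cprod_cong: "(\<And>i. i \<in> set L \<Longrightarrow> f i = g i) \<Longrightarrow> cprod f L = cprod g L"
  by (induct L) auto

lemma cprod_one: "(\<And>i. i \<in> set L \<Longrightarrow> f i = \<one>) \<Longrightarrow> cprod f L = \<one>"
  by (induct L) auto

lemma cprod_Units:
  "(\<And>i. i \<in> set L \<Longrightarrow> f i \<in> Units R) \<Longrightarrow> cprod f L \<in> Units R"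
  by (induct L) auto

lemma cprod_in_subring:
  assumes "subring H R"
  shows "(\<And>i. i \<in> set L \<Longrightarrow> f i \<in> H) \<Longrightarrow> cprod f L \<in> H"
  by (induct L) (auto intro: subringE(3)[OF assms] subringE(6)[OF assms])

lemma commute_mult:
  assumes "x \<in> carrier R" "y \<in> carrier R" "z \<in> carrier R" "x \<otimes> y = y \<otimes> x" "x \<otimes> z = z \<otimes> x"
  shows "x \<otimes> (y \<otimes> z) = (y \<otimes> z) \<otimes> x"
  using assms by (metis m_assoc)

lemma cprod_commute:
  "\<lbrakk>x \<in> carrier R; \<And>i. i \<in> set L \<Longrightarrow> f i \<in> carrier R; \<And>i. i \<in> set L \<Longrightarrow> x \<otimes> f i = f i \<otimes> x\<rbrakk>
    \<Longrightarrow> x \<otimes> cprod f L = cprod f L \<otimes> x"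
proof (induct L)
  case (Cons i L)
  then show ?case unfolding cprod_Cons by (intro commute_mult) auto
qed auto

lemma commute_pow:
  assumes "x \<in> carrier R" "y \<in> carrier R" "x \<otimes> y = y \<otimes> x"
  shows "x \<otimes> y [^] (m::nat) = y [^] m \<otimes> x"
  using assms by (induct m) (auto intro: commute_mult)

lemma commute_inv:
  assumes "x \<in> carrier R" "y \<in> Units R" "x \<otimes> y = y \<otimes> x"
  shows "x \<otimes> inv y = inv y \<otimes> x"
proof -
  have y: "y \<in> carrier R" using assms by auto
  have "inv y \<otimes> (y \<otimes> x) \<otimes> inv y = x \<otimes> inv y"
    using assms(1,2) y by (simp add: m_assoc[symmetric])
  moreover have "inv y \<otimes> (x \<otimes> y) \<otimes> inv y = inv y \<otimes> x"
    using assms(1,2) y by (simp add: m_assoc)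
  ultimately show ?thesis using assms(3) by simp
qed

text \<open>The element \<open>x\<close> moves to the right past the factors before position
  \<open>i\<close>, with which it commutes, and is absorbed there.\<close>

lemma mult_cprod:
  assumes "distinct L" "i \<in> set L" "x \<in> carrier R" "\<And>j. j \<in> set L \<Longrightarrow> f j \<in> carrier R"
    and "\<And>j. j \<in> set L \<Longrightarrow> j \<noteq> i \<Longrightarrow> x \<otimes> f j = f j \<otimes> x"
  shows "x \<otimes> cprod f L = cprod (f(i := x \<otimes> f i)) L"
  using assms
proof (induct L)
  case (Cons j L)
  show ?case
  proof (cases "j = i")
    case True
    then have "cprod (f(i := x \<otimes> f i)) L = cprod f L"
      using Cons by (intro cprod_cong) auto
    then have "cprod (f(i := x \<otimes> f i)) (j # L) = (x \<otimes> f i) \<otimes> cprod f L"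
      using True by (simp only: cprod_Cons fun_upd_same)
    then show ?thesis unfolding \<open>cprod (f(i := x \<otimes> f i)) (j # L) = _\<close>
      using True Cons.prems by (simp add: m_assoc)
  next
    case False
    have "x \<otimes> cprod f (j # L) = f j \<otimes> (x \<otimes> cprod f L)"
      using Cons.prems False by (simp add: m_assoc[symmetric])
    then show ?thesis using False Cons by simp
  qed
qed auto

text \<open>By the Leibniz rule the commutator is a sum over the positions in the list, and only the
  single position of \<open>i\<close> contributes.\<close>

lemma br_cprod:
  assumes "distinct L" "i \<in> set L" "x \<in> carrier R" "\<And>j. j \<in> set L \<Longrightarrow> f j \<in> carrier R"
    and "\<And>j. j \<in> set L \<Longrightarrow> j \<noteq> i \<Longrightarrow> x \<otimes> f j = f j \<otimes> x"
  shows "br x (cprod f L) = cprod (f(i := br x (f i))) L"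
  using assms
proof (induct L)
  case (Cons j L)
  show ?case
  proof (cases "j = i")
    case True
    then have *: "cprod (f(i := br x (f i))) L = cprod f L"
      using Cons by (intro cprod_cong) auto
    have "x \<otimes> cprod f L = cprod f L \<otimes> x"
      using Cons.prems True by (intro cprod_commute) auto
    then have "br x (cprod f L) = \<zero>"
      using Cons.prems by (simp add: br_eq_zero_iff)
    have "cprod (f(i := br x (f i))) (j # L) = br x (f i) \<otimes> cprod f L"
      using True * by (simp only: cprod_Cons fun_upd_same)
    then show ?thesis unfolding \<open>cprod (f(i := br x (f i))) (j # L) = _\<close>
      using \<open>br x (cprod f L) = \<zero>\<close> True Cons.prems by (simp add: br_mult_right)
  next
    case False
    have "br x (f j) = \<zero>"
      using Cons.prems False by (simp add: br_eq_zero_iff)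
    then show ?thesis using False Cons by (simp add: br_mult_right)
  qed
qed auto

text \<open>The derivation \<open>br x\<close> kills \<open>y \<otimes> inv y\<close>, which is
  \<open>\<one>\<close>; solving the Leibniz identity for \<open>br x (inv y)\<close> gives the
  quotient rule.\<close>

lemma br_inv:
  assumes "x \<in> carrier R" "y \<in> Units R"
  shows "br x (inv y) = \<ominus> (inv y \<otimes> br x y \<otimes> inv y)"
proof -
  have "\<zero> = br x (y \<otimes> inv y)" using assms by simp
  also have "\<dots> = br x y \<otimes> inv y \<oplus> y \<otimes> br x (inv y)"
    using assms by (intro br_mult_right) auto
  finally have "inv y \<otimes> \<zero> = inv y \<otimes> (br x y \<otimes> inv y \<oplus> y \<otimes> br x (inv y))" by simp
  also have "\<dots> = inv y \<otimes> (br x y \<otimes> inv y) \<oplus> inv y \<otimes> (y \<otimes> br x (inv y))"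
    using assms by (intro r_distr) auto
  also have "inv y \<otimes> (y \<otimes> br x (inv y)) = br x (inv y)"
    using assms by (simp add: m_assoc[symmetric] Units_closed)
  finally show ?thesis
    using assms by (simp add: m_assoc Units_closed add.inv_equality a_comm)
qed

end

context complex_algebra
begin

lemma cprod_smult:
  assumes "distinct L" "i \<in> set L" "\<And>j. j \<in> set L \<Longrightarrow> f j \<in> carrier A"
  shows "cprod (f(i := c \<odot> f i)) L = c \<odot> cprod f L"
  using assms
proof (induct L)
  case (Cons j L)
  show ?case
  proof (cases "j = i")
    case True
    then have "cprod (f(i := c \<odot> f i)) L = cprod f L"
      using Cons by (intro cprod_cong) auto
    then have "cprod (f(i := c \<odot> f i)) (j # L) = (c \<odot> f i) \<otimes> cprod f L"
      using True by (simp only: cprod_Cons fun_upd_same)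
    then show ?thesis unfolding \<open>cprod (f(i := c \<odot> f i)) (j # L) = _\<close>
      using True Cons.prems by (simp add: smult_mult_left)
  next
    case False
    then show ?thesis using Cons by (simp add: smult_mult_right)
  qed
qed auto

lemma br_eigen_pow:
  assumes "x \<in> carrier A" "y \<in> carrier A" "br x y = c \<odot> y"
  shows "br x (y [^] (m::nat)) = (of_nat m * c) \<odot> y [^] m"
proof (induct m)
  case (Suc m)
  then show ?case using assms
    by (simp add: br_mult_right smult_mult_left smult_mult_right smult_add_left[symmetric] algebra_simps)
qed (use assms in simp)

text \<open>Derivative of a power. For \<open>m = 0\<close> the truncated exponent
  \<open>m - 1\<close> does no harm, as the coefficient is zero.\<close>

lemma br_scalar_pow:
  assumes "x \<in> carrier A" "y \<in> carrier A" "br x y = c \<odot> \<one>"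
  shows "br x (y [^] (m::nat)) = (of_nat m * c) \<odot> y [^] (m - 1)"
proof (induct m)
  case (Suc m)
  have "y [^] (m - 1) \<otimes> y = y [^] m" if "m > 0"
    using that by (metis Suc_diff_1 nat_pow_Suc)
  then show ?case using assms Suc
    by (cases "m = 0")
       (auto simp add: br_mult_right smult_mult_left smult_mult_right smult_add_left[symmetric] algebra_simps)
qed (use assms in simp)

lemma br_eigen_mult:
  assumes "x \<in> carrier A" "y \<in> carrier A" "z \<in> carrier A" "br x y = b \<odot> y" "br x z = c \<odot> z"
  shows "br x (y \<otimes> z) = (b + c) \<odot> (y \<otimes> z)"
  using assms by (simp add: br_mult_right smult_mult_left smult_mult_right smult_add_left)

lemma br_eigen_inv:
  assumes "x \<in> carrier A" "y \<in> Units A" "br x y = b \<odot> y"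
  shows "br x (inv y) = (- b) \<odot> inv y"
  using assms
  by (simp add: br_inv smult_mult_left smult_mult_right minus_one_smult[symmetric] smult_smult Units_closed)

end

subsection \<open>Laurent monomials and Weyl pairs\<close>

declare pow_nat [simp del]

text \<open>The model is the torus with coordinates \<open>t i\<close>, on which \<open>d i\<close>
  is the vector field t_i d/dt_i. The fields \<open>d i\<close>, and not the partial derivatives,
  are parameters because they are what comes from the Lie algebra.\<close>

locale weyl_pairs = complex_algebra A for A :: "(complex, 'a) module" (structure) +
  fixes n :: nat and t d :: "nat \<Rightarrow> 'a"
  assumes t_Units: "i \<in> {1..n} \<Longrightarrow> t i \<in> Units A"
    and d_carrier [simp]: "i \<in> {1..n} \<Longrightarrow> d i \<in> carrier A"
    and br_t_t: "\<lbrakk>i \<in> {1..n}; j \<in> {1..n}\<rbrakk> \<Longrightarrow> br (t i) (t j) = \<zero>"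
    and br_d_d: "\<lbrakk>i \<in> {1..n}; j \<in> {1..n}\<rbrakk> \<Longrightarrow> br (d i) (d j) = \<zero>"
    and br_d_t: "\<lbrakk>i \<in> {1..n}; j \<in> {1..n}\<rbrakk> \<Longrightarrow> br (d i) (t j) = (if i = j then t j else \<zero>)"
begin

definition p :: "nat \<Rightarrow> 'a"
  where "p i = inv t i \<otimes> d i"

lemma t_closed [simp]: "i \<in> {1..n} \<Longrightarrow> t i \<in> carrier A"
  using t_Units by auto

lemma inv_t_closed [simp]: "i \<in> {1..n} \<Longrightarrow> inv t i \<in> carrier A"
  using t_Units by auto

lemma p_closed [simp]: "i \<in> {1..n} \<Longrightarrow> p i \<in> carrier A"
  by (simp add: p_def)

lemma d_eq: "i \<in> {1..n} \<Longrightarrow> d i = t i \<otimes> p i"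
  using t_Units[of i] by (simp add: p_def m_assoc[symmetric])

lemma t_commute: "\<lbrakk>i \<in> {1..n}; j \<in> {1..n}\<rbrakk> \<Longrightarrow> t i \<otimes> t j = t j \<otimes> t i"
  using br_t_t[of i j] by (simp add: br_eq_zero_iff)

lemma br_t_inv_t: "\<lbrakk>i \<in> {1..n}; j \<in> {1..n}\<rbrakk> \<Longrightarrow> br (t i) (inv t j) = \<zero>"
  using t_Units by (simp add: br_inv br_t_t)

lemma d_commute_t: "\<lbrakk>i \<in> {1..n}; j \<in> {1..n}; i \<noteq> j\<rbrakk> \<Longrightarrow> d i \<otimes> t j = t j \<otimes> d i"
  using br_d_t[of i j] by (simp add: br_eq_zero_iff)

lemma br_d_inv_t:
  "\<lbrakk>i \<in> {1..n}; j \<in> {1..n}\<rbrakk> \<Longrightarrow> br (d i) (inv t j) = (if i = j then (- 1) \<odot> inv t j else \<zero>)"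
  using t_Units by (simp add: br_inv br_d_t minus_one_smult)

lemma br_t_d: "\<lbrakk>i \<in> {1..n}; j \<in> {1..n}\<rbrakk> \<Longrightarrow> br (t i) (d j) = (if i = j then (-1) \<odot> t j else \<zero>)"
  using br_swap[of "d j" "t i"] by (auto simp: br_d_t minus_one_smult)

lemma br_t_p:
  "\<lbrakk>i \<in> {1..n}; j \<in> {1..n}\<rbrakk> \<Longrightarrow> br (t i) (p j) = (if i = j then (-1) \<odot> \<one> else \<zero>)"
  using t_Units by (simp add: p_def br_mult_right br_t_inv_t br_t_d smult_mult_right)

lemma br_d_p:
  "\<lbrakk>i \<in> {1..n}; j \<in> {1..n}\<rbrakk> \<Longrightarrow> br (d i) (p j) = (if i = j then (-1) \<odot> p j else \<zero>)"
  by (simp add: p_def br_mult_right br_d_inv_t br_d_d smult_mult_left)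

text \<open>For distinct indices, \<open>p j\<close> commutes with both factors
  \<open>inv t i\<close> and \<open>d i\<close> of \<open>p i\<close>.\<close>

lemma br_p_p: "\<lbrakk>i \<in> {1..n}; j \<in> {1..n}\<rbrakk> \<Longrightarrow> br (p i) (p j) = \<zero>"
proof (cases "i = j")
  case True
  then show "\<lbrakk>i \<in> {1..n}; j \<in> {1..n}\<rbrakk> \<Longrightarrow> br (p i) (p j) = \<zero>"
    by (simp add: br_eq_zero_iff)
next
  case False
  assume ij: "i \<in> {1..n}" "j \<in> {1..n}"
  have "br (p j) (inv t i) = \<zero>" "br (p j) (d i) = \<zero>"
    using False ij br_swap[of "d i" "p j"] br_swap[of "t i" "p j"] t_Units
    by (simp_all add: br_d_p br_t_p br_inv)
  then have "br (p j) (p i) = \<zero>"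
    using ij by (simp add: p_def[of i] br_mult_right)
  then show "br (p i) (p j) = \<zero>"
    using ij by (simp add: br_eq_zero_iff)
qed

definition tp :: "nat \<Rightarrow> int \<Rightarrow> 'a"
  where "tp i k = (if k \<ge> 0 then t i [^] nat k else inv t i [^] nat (- k))"

lemma tp_closed [simp]: "i \<in> {1..n} \<Longrightarrow> tp i k \<in> carrier A"
  by (simp add: tp_def)

lemma tp_Units: "i \<in> {1..n} \<Longrightarrow> tp i k \<in> Units A"
  using t_Units by (simp add: tp_def Units_pow_closed)

lemma tp_zero [simp]: "tp i 0 = \<one>"
  by (simp add: tp_def)

lemma commute_tp:
  assumes "i \<in> {1..n}" "x \<in> carrier A" "x \<otimes> t i = t i \<otimes> x"
  shows "x \<otimes> tp i k = tp i k \<otimes> x"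
  using assms commute_inv[OF assms(2) t_Units] by (simp add: tp_def commute_pow)

lemma t_mult_tp:
  assumes i: "i \<in> {1..n}"
  shows "t i \<otimes> tp i k = tp i (k + 1)"
proof (cases "k \<ge> 0")
  case True
  then have "nat (k + 1) = Suc (nat k)" by simp
  then show ?thesis using True i by (simp add: tp_def commute_pow)
next
  case False
  \<comment> \<open>With k = -(m + 1), the factor \<open>t i\<close> cancels one of the m + 1
    inverses.\<close>
  then obtain m where m: "k = - int (Suc m)"
    by (metis int_cases not_le of_nat_0_le_iff)
  have "inv t i [^] Suc m = inv t i \<otimes> inv t i [^] m"
    using i by (intro nat_pow_Suc2) auto
  moreover have "tp i k = inv t i [^] Suc m"
    by (simp add: m tp_def nat_add_distrib)
  ultimately have "t i \<otimes> tp i k = (t i \<otimes> inv t i) \<otimes> inv t i [^] m"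
    using i by (simp add: m_assoc)
  also have "\<dots> = inv t i [^] m"
    using i t_Units[OF i] by simp
  also have "\<dots> = tp i (k + 1)"
    by (cases m) (simp_all add: m tp_def nat_add_distrib)
  finally show ?thesis .
qed

lemma inv_t_mult_tp:
  assumes i: "i \<in> {1..n}"
  shows "inv t i \<otimes> tp i k = tp i (k - 1)"
  using t_mult_tp[OF i, of "k - 1"] t_Units[OF i] i
  by (metis Units_closed Units_inv_closed Units_l_inv diff_add_cancel l_one m_assoc tp_closed)

lemma br_d_tp: "i \<in> {1..n} \<Longrightarrow> br (d i) (tp i k) = of_int k \<odot> tp i k"
proof -
  assume i: "i \<in> {1..n}"
  have "br (d i) (t i [^] m) = (of_nat m * 1) \<odot> t i [^] m" for m :: nat
    using i by (intro br_eigen_pow) (auto simp: br_d_t)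
  moreover have "br (d i) (inv t i [^] m) = (of_nat m * (-1)) \<odot> (inv t i) [^] m" for m :: nat
    using i by (intro br_eigen_pow) (auto simp: br_d_inv_t)
  ultimately show ?thesis by (simp add: tp_def)
qed

definition tau :: "(nat \<Rightarrow> int) \<Rightarrow> 'a"
  where "tau a = cprod (\<lambda>i. tp i (a i)) [1..<Suc n]"

definition pmon :: "(nat \<Rightarrow> nat) \<Rightarrow> 'a"
  where "pmon b = cprod (\<lambda>i. p i [^] b i) [1..<Suc n]"

text \<open>Normal ordering: the powers of all \<open>t i\<close> stand to the left of the powers of
  all \<open>p i\<close>.\<close>

definition mon :: "(nat \<Rightarrow> int) \<times> (nat \<Rightarrow> nat) \<Rightarrow> 'a"
  where "mon x = tau (fst x) \<otimes> pmon (snd x)"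

lemma tau_closed [simp]: "tau a \<in> carrier A"
  unfolding tau_def by (rule cprod_closed) auto

lemma pmon_closed [simp]: "pmon b \<in> carrier A"
  unfolding pmon_def by (rule cprod_closed) auto

lemma mon_closed [simp]: "mon x \<in> carrier A"
  by (simp add: mon_def)

lemma tau_Units: "tau a \<in> Units A"
  unfolding tau_def by (rule cprod_Units) (auto intro: tp_Units)

lemma tau_zero [simp]: "tau (\<lambda>_. 0) = \<one>"
  by (simp add: tau_def cprod_one)

lemma pmon_zero [simp]: "pmon (\<lambda>_. 0) = \<one>"
  by (simp add: pmon_def cprod_one)

lemma t_commute_tp: "\<lbrakk>i \<in> {1..n}; j \<in> {1..n}\<rbrakk> \<Longrightarrow> t i \<otimes> tp j k = tp j k \<otimes> t i"
  by (intro commute_tp) (auto intro: t_commute)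

lemma inv_t_commute_tp: "\<lbrakk>i \<in> {1..n}; j \<in> {1..n}\<rbrakk> \<Longrightarrow> inv t i \<otimes> tp j k = tp j k \<otimes> inv t i"
  by (metis commute_inv t_Units t_commute_tp tp_closed)

lemma p_commute: "\<lbrakk>i \<in> {1..n}; j \<in> {1..n}\<rbrakk> \<Longrightarrow> p i \<otimes> p j = p j \<otimes> p i"
  using br_p_p[of i j] by (simp add: br_eq_zero_iff)

lemma t_commute_p: "\<lbrakk>i \<in> {1..n}; j \<in> {1..n}; i \<noteq> j\<rbrakk> \<Longrightarrow> t i \<otimes> p j = p j \<otimes> t i"
  using br_t_p[of i j] by (simp add: br_eq_zero_iff)

lemma t_mult_tau:
  assumes i: "i \<in> {1..n}"
  shows "t i \<otimes> tau a = tau (a(i := a i + 1))"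
proof -
  have "t i \<otimes> tau a = cprod ((\<lambda>i. tp i (a i))(i := t i \<otimes> tp i (a i))) [1..<Suc n]"
    unfolding tau_def using i by (intro mult_cprod) (auto intro: t_commute_tp)
  also have "(\<lambda>i. tp i (a i))(i := t i \<otimes> tp i (a i)) = (\<lambda>j. tp j ((a(i := a i + 1)) j))"
    using t_mult_tp[OF i] by auto
  finally show ?thesis by (simp add: tau_def)
qed

lemma inv_t_mult_tau:
  assumes i: "i \<in> {1..n}"
  shows "inv t i \<otimes> tau a = tau (a(i := a i - 1))"
proof -
  have "inv t i \<otimes> tau a = cprod ((\<lambda>i. tp i (a i))(i := inv t i \<otimes> tp i (a i))) [1..<Suc n]"
    unfolding tau_def using i by (intro mult_cprod) (auto intro: inv_t_commute_tp)
  also have "(\<lambda>i. tp i (a i))(i := inv t i \<otimes> tp i (a i)) = (\<lambda>j. tp j ((a(i := a i - 1)) j))"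
    using inv_t_mult_tp[OF i] by auto
  finally show ?thesis by (simp add: tau_def)
qed

lemma br_d_tau:
  assumes i: "i \<in> {1..n}"
  shows "br (d i) (tau a) = of_int (a i) \<odot> tau a"
proof -
  have "br (d i) (tau a) = cprod ((\<lambda>i. tp i (a i))(i := br (d i) (tp i (a i)))) [1..<Suc n]"
    unfolding tau_def
    using i by (intro br_cprod) (auto intro!: commute_tp d_commute_t)
  also have "\<dots> = cprod ((\<lambda>i. tp i (a i))(i := of_int (a i) \<odot> tp i (a i))) [1..<Suc n]"
    using br_d_tp[OF i] by simp
  also have "\<dots> = of_int (a i) \<odot> tau a"
    unfolding tau_def using i by (intro cprod_smult) auto
  finally show ?thesis .
qed

lemma br_t_tau:
  assumes i: "i \<in> {1..n}"
  shows "br (t i) (tau a) = \<zero>"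
proof -
  have "t i \<otimes> tau a = tau a \<otimes> t i"
    unfolding tau_def using i by (intro cprod_commute) (auto intro: t_commute_tp)
  then show ?thesis using i by (simp add: br_eq_zero_iff)
qed

lemma p_mult_pmon:
  assumes i: "i \<in> {1..n}"
  shows "p i \<otimes> pmon b = pmon (b(i := b i + 1))"
proof -
  have "p i \<otimes> pmon b = cprod ((\<lambda>i. p i [^] b i)(i := p i \<otimes> p i [^] b i)) [1..<Suc n]"
    unfolding pmon_def using i by (intro mult_cprod) (auto intro!: commute_pow p_commute)
  also have "(\<lambda>i. p i [^] b i)(i := p i \<otimes> p i [^] b i) = (\<lambda>j. p j [^] (b(i := b i + 1)) j)"
    using i by (auto simp: nat_pow_Suc2[symmetric])
  finally show ?thesis by (simp add: pmon_def)
qed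

text \<open>On monomials in the \<open>p i\<close>, the commutator with \<open>t i\<close> is minus
  the partial derivative with respect to \<open>p i\<close>. For \<open>b i = 0\<close> the
  truncated subtraction is harmless, since the coefficient vanishes.\<close>

lemma br_t_pmon:
  assumes i: "i \<in> {1..n}"
  shows "br (t i) (pmon b) = (- of_nat (b i)) \<odot> pmon (b(i := b i - 1))"
proof -
  let ?g = "\<lambda>j. p j [^] (b(i := b i - 1)) j"
  have "br (t i) (p i [^] b i) = (of_nat (b i) * (-1)) \<odot> p i [^] (b i - 1)"
    using i by (intro br_scalar_pow) (auto simp: br_t_p)
  then have *: "br (t i) (p i [^] b i) = (- of_nat (b i)) \<odot> ?g i" by simp
  have "br (t i) (pmon b) = cprod ((\<lambda>i. p i [^] b i)(i := br (t i) (p i [^] b i))) [1..<Suc n]"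
    unfolding pmon_def using i by (intro br_cprod) (auto intro!: commute_pow t_commute_p)
  also have "\<dots> = cprod (?g(i := (- of_nat (b i)) \<odot> ?g i)) [1..<Suc n]"
    unfolding * by (rule cprod_cong) auto
  also have "\<dots> = (- of_nat (b i)) \<odot> pmon (b(i := b i - 1))"
    unfolding pmon_def using i by (intro cprod_smult) auto
  finally show ?thesis .
qed

lemma br_t_mon:
  assumes "i \<in> {1..n}"
  shows "br (t i) (mon (a, b)) = (- of_nat (b i)) \<odot> mon (a, b(i := b i - 1))"
  using assms by (simp add: mon_def br_mult_right br_t_tau br_t_pmon smult_mult_right)

text \<open>Moving \<open>d i\<close> past \<open>tau a\<close> produces the weight
  \<open>a i\<close>; afterwards \<open>d i\<close>, written as \<open>t i \<otimes> p i\<close>,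
  gives one factor to each half of the normally ordered monomial.\<close>

lemma d_mult_mon:
  assumes i: "i \<in> {1..n}"
  shows "d i \<otimes> mon (a, b) =
    mon (a(i := a i + 1), b(i := b i + 1)) \<oplus> of_int (a i) \<odot> mon (a, b)"
proof -
  have "d i \<otimes> mon (a, b) = (d i \<otimes> tau a) \<otimes> pmon b"
    using i by (simp add: mon_def m_assoc)
  also have "d i \<otimes> tau a = tau a \<otimes> d i \<oplus> of_int (a i) \<odot> tau a"
    using i by (simp add: mult_eq_br[of "d i" "tau a"] br_d_tau)
  also have "tau a \<otimes> d i = tau (a(i := a i + 1)) \<otimes> p i"
  proof -
    have "tau a \<otimes> t i = t i \<otimes> tau a" using br_t_tau[OF i, of a] i by (simp add: br_eq_zero_iff)
    then show ?thesis using i by (simp add: d_eq m_assoc[symmetric] t_mult_tau)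
  qed
  finally show ?thesis
    using i by (simp add: mon_def l_distr m_assoc p_mult_pmon smult_mult_left)
qed

lemma t_mult_mon: "i \<in> {1..n} \<Longrightarrow> t i \<otimes> mon (a, b) = mon (a(i := a i + 1), b)"
  by (simp add: mon_def m_assoc[symmetric] t_mult_tau)

lemma inv_t_mult_mon: "i \<in> {1..n} \<Longrightarrow> inv t i \<otimes> mon (a, b) = mon (a(i := a i - 1), b)"
  by (simp add: mon_def m_assoc[symmetric] inv_t_mult_tau)

end

subsection \<open>The subalgebra of a Weyl pair and its centralizer\<close>

context complex_algebra
begin

lemma complex_subalgebraI:
  assumes "H \<subseteq> carrier A" "\<one> \<in> H"
    and "\<And>x y. \<lbrakk>x \<in> H; y \<in> H\<rbrakk> \<Longrightarrow> x \<oplus> y \<in> H"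
    and "\<And>x y. \<lbrakk>x \<in> H; y \<in> H\<rbrakk> \<Longrightarrow> x \<otimes> y \<in> H"
    and smult: "\<And>c x. x \<in> H \<Longrightarrow> c \<odot> x \<in> H"
  shows "complex_subalgebra H A"
proof -
  have "\<ominus> x \<in> H" if "x \<in> H" for x
    using smult[OF that, of "-1"] assms(1) that minus_one_smult by force
  with assms show ?thesis
    by (auto simp: complex_subalgebra_def intro!: subringI)
qed

lemma complex_subalgebra_carrier: "complex_subalgebra (carrier A) A"
  by (rule complex_subalgebraI) auto

lemma complex_subalgebra_Inter:
  "\<lbrakk>\<And>H. H \<in> X \<Longrightarrow> complex_subalgebra H A; X \<noteq> {}\<rbrakk> \<Longrightarrow> complex_subalgebra (\<Inter>X) A"
  by (auto simp: complex_subalgebra_def intro!: subring_Inter)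

lemma generated_subalgebra:
  assumes "X \<subseteq> carrier A"
  shows "complex_subalgebra (generated_subalgebra A X) A"
  unfolding generated_subalgebra_def
  using assms complex_subalgebra_carrier by (intro complex_subalgebra_Inter) auto

lemma subset_generated_subalgebra: "X \<subseteq> generated_subalgebra A X"
  by (auto simp: generated_subalgebra_def)

lemma generated_subalgebra_least:
  "\<lbrakk>complex_subalgebra H A; X \<subseteq> H\<rbrakk> \<Longrightarrow> generated_subalgebra A X \<subseteq> H"
  by (auto simp: generated_subalgebra_def)

lemma complex_subalgebra_centralizing:
  assumes "c \<in> carrier A"
  shows "complex_subalgebra {x \<in> carrier A. c \<otimes> x = x \<otimes> c} A"
proof (rule complex_subalgebraI)
  fix x y assume "x \<in> {x \<in> carrier A. c \<otimes> x = x \<otimes> c}" "y \<in> {x \<in> carrier A. c \<otimes> x = x \<otimes> c}"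
  then show "x \<otimes> y \<in> {x \<in> carrier A. c \<otimes> x = x \<otimes> c}"
    using assms commute_mult[of c x y] by simp
qed (use assms in \<open>auto simp: l_distr r_distr smult_mult_left smult_mult_right\<close>)

lemma mem_centralizer_iff:
  "H \<subseteq> carrier A \<Longrightarrow> u \<in> centralizer A H \<longleftrightarrow> u \<in> carrier A \<and> (\<forall>b\<in>H. u \<otimes> b = b \<otimes> u)"
  by (auto simp: centralizer_def subset_iff r_right_minus_eq)

text \<open>The elements commuting with a fixed \<open>u\<close> form a subalgebra, so an element
  that commutes with the generators commutes with everything they generate.\<close>

lemma centralizer_generated_subalgebra:
  assumes "X \<subseteq> carrier A"
  shows "centralizer A (generated_subalgebra A X) = centralizer A X"
proof -
  let ?G = "generated_subalgebra A X"
  have G: "?G \<subseteq> carrier A"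
    by (rule generated_subalgebra_least) (use assms complex_subalgebra_carrier in auto)
  have "?G \<subseteq> {x \<in> carrier A. u \<otimes> x = x \<otimes> u}" if "u \<in> carrier A" "\<forall>b\<in>X. u \<otimes> b = b \<otimes> u" for u
    using that assms by (intro generated_subalgebra_least complex_subalgebra_centralizing) auto
  then show ?thesis
    unfolding set_eq_iff mem_centralizer_iff[OF G] mem_centralizer_iff[OF assms]
    using subset_generated_subalgebra[of X] by blast
qed

lemma centralizer_is_subalgebra:
  assumes "H \<subseteq> carrier A"
  shows "complex_subalgebra (centralizer A H) A"
proof (rule complex_subalgebraI)
  fix x y assume "x \<in> centralizer A H" "y \<in> centralizer A H"
  moreover have "x \<otimes> y \<otimes> b = b \<otimes> (x \<otimes> y)"
    if "x \<in> carrier A" "y \<in> carrier A" "b \<in> carrier A" "x \<otimes> b = b \<otimes> x" "y \<otimes> b = b \<otimes> y" for b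
    using that commute_mult[of b x y] by simp
  ultimately show "x \<otimes> y \<in> centralizer A H"
    using assms by (simp add: mem_centralizer_iff subset_iff)
qed (use assms in \<open>auto simp: mem_centralizer_iff subset_iff l_distr r_distr smult_mult_left
      smult_mult_right\<close>)

lemma finsum_neutral_subset:
  "\<lbrakk>finite J; J' \<subseteq> J; f \<in> J \<rightarrow> carrier A; \<And>j. j \<in> J - J' \<Longrightarrow> f j = \<zero>; \<And>j. j \<in> J' \<Longrightarrow> f j = g j\<rbrakk>
    \<Longrightarrow> finsum A f J = finsum A g J'"
  by (rule add.finprod_mono_neutral_cong_right) auto

end

section \<open>The algebra \<open>B\<close>, its centralizer \<open>C\<close> and the monomials
  spanning \<open>B\<close>\<close>

context weyl_pairs
begin

definition gens :: "'a set"
  where "gens = t ` {1..n} \<union> (\<lambda>i. inv t i) ` {1..n} \<union> d ` {1..n}"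

definition B :: "'a set"
  where "B = generated_subalgebra A gens"

definition C :: "'a set"
  where "C = centralizer A B"

text \<open>\<open>mon\<close> reads exponents at the indices 1 to n only. Forcing them to be zero
  elsewhere makes a label determined by its monomial's exponents, as linear independence
  demands.\<close>

definition labels :: "((nat \<Rightarrow> int) \<times> (nat \<Rightarrow> nat)) set"
  where "labels = {x. \<forall>i. i \<notin> {1..n} \<longrightarrow> fst x i = 0 \<and> snd x i = 0}"

lemma gens_closed: "gens \<subseteq> carrier A"
  by (auto simp: gens_def)

lemma B_subalgebra: "complex_subalgebra B A"
  unfolding B_def by (rule generated_subalgebra[OF gens_closed])

lemma B_subring: "subring B A"
  using B_subalgebra by (simp add: complex_subalgebra_def)

lemma B_closed: "x \<in> B \<Longrightarrow> x \<in> carrier A"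
  using subringE(1)[OF B_subring] by auto

lemma B_smult: "x \<in> B \<Longrightarrow> c \<odot> x \<in> B"
  using B_subalgebra by (simp add: complex_subalgebra_def)

lemma C_subalgebra: "complex_subalgebra C A"
  unfolding C_def by (rule centralizer_is_subalgebra) (auto intro: B_closed)

lemma C_subring: "subring C A"
  using C_subalgebra by (simp add: complex_subalgebra_def)

lemma C_closed [simp]: "x \<in> C \<Longrightarrow> x \<in> carrier A"
  using subringE(1)[OF C_subring] by auto

lemma C_smult: "x \<in> C \<Longrightarrow> c \<odot> x \<in> C"
  using C_subalgebra by (simp add: complex_subalgebra_def)

lemma gens_B: "i \<in> {1..n} \<Longrightarrow> t i \<in> B" "i \<in> {1..n} \<Longrightarrow> inv t i \<in> B" "i \<in> {1..n} \<Longrightarrow> d i \<in> B"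
  unfolding B_def using subset_generated_subalgebra[of gens] by (auto simp: gens_def)

lemma C_iff:
  "c \<in> C \<longleftrightarrow> c \<in> carrier A \<and> (\<forall>i\<in>{1..n}. br (t i) c = \<zero> \<and> br (d i) c = \<zero>)"
proof -
  have "c \<otimes> inv t i = inv t i \<otimes> c"
    if "i \<in> {1..n}" "c \<in> carrier A" "c \<otimes> t i = t i \<otimes> c" for i
    using that t_Units by (intro commute_inv) auto
  moreover have "br (t i) c = \<zero> \<longleftrightarrow> c \<otimes> t i = t i \<otimes> c" "br (d i) c = \<zero> \<longleftrightarrow> c \<otimes> d i = d i \<otimes> c"
    if "i \<in> {1..n}" "c \<in> carrier A" for i
    using that by (auto simp: br_eq_zero_iff)
  ultimately show ?thesis
    unfolding C_def B_def centralizer_generated_subalgebra[OF gens_closed]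
      mem_centralizer_iff[OF gens_closed]
    by (auto simp: gens_def)
qed

lemma BC_commute: "\<lbrakk>b \<in> B; c \<in> C\<rbrakk> \<Longrightarrow> c \<otimes> b = b \<otimes> c"
  unfolding C_def using B_closed by (simp add: mem_centralizer_iff subset_iff)

lemma pow_in_subring: "\<lbrakk>subring H A; x \<in> H\<rbrakk> \<Longrightarrow> x [^] (m::nat) \<in> H"
  by (induct m) (auto intro: subringE)

lemma mon_in_B: "mon x \<in> B"
proof -
  note * = subringE(6)[OF B_subring] pow_in_subring[OF B_subring] cprod_in_subring[OF B_subring]
  have "tp i k \<in> B" if "i \<in> {1..n}" for i k
    using that gens_B by (auto simp: tp_def intro: *)
  moreover have "p i \<in> B" if "i \<in> {1..n}" for i
    using that gens_B by (auto simp: p_def intro: *)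
  ultimately show ?thesis
    unfolding mon_def tau_def pmon_def by (intro *) auto
qed

text \<open>The linear span of the normally ordered monomials, given by closure rules so that linear
  arguments become rule inductions.\<close>

inductive_set mon_span :: "'a set" where
  zero: "\<zero> \<in> mon_span"
| mon: "x \<in> labels \<Longrightarrow> mon x \<in> mon_span"
| add: "\<lbrakk>x \<in> mon_span; y \<in> mon_span\<rbrakk> \<Longrightarrow> x \<oplus> y \<in> mon_span"
| smult: "x \<in> mon_span \<Longrightarrow> c \<odot> x \<in> mon_span"

lemma mon_span_closed: "x \<in> mon_span \<Longrightarrow> x \<in> carrier A"
  by (induct rule: mon_span.induct) auto

lemma gens_mult_mon_span:
  assumes "g \<in> gens" "x \<in> mon_span"
  shows "g \<otimes> x \<in> mon_span"
  using assms(2)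
proof (induct rule: mon_span.induct)
  case (mon x)
  obtain a b where x: "x = (a, b)" by force
  show ?case
    using assms(1) mon unfolding gens_def x
    by (auto simp: t_mult_mon inv_t_mult_mon d_mult_mon labels_def
        intro!: mon_span.intros)
qed (use assms(1) gens_closed in \<open>auto simp: r_distr smult_mult_right mon_span_closed subset_iff intro: mon_span.intros\<close>)

text \<open>The elements whose left multiplication preserves \<open>mon_span\<close> form a
  subalgebra. It contains the generators, hence \<open>B\<close>; applying an element of
  \<open>B\<close> to \<open>\<one>\<close>, itself a monomial, gives the claim.\<close>

lemma B_subset_mon_span: "B \<subseteq> mon_span"
proof
  let ?H = "{x \<in> carrier A. \<forall>m\<in>mon_span. x \<otimes> m \<in> mon_span}"
  fix b assume "b \<in> B"
  have "complex_subalgebra ?H A"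
    by (intro complex_subalgebraI)
       (auto simp: l_distr smult_mult_left mon_span_closed m_assoc intro: mon_span.intros)
  then have "B \<subseteq> ?H"
    unfolding B_def using gens_closed gens_mult_mon_span by (intro generated_subalgebra_least) auto
  moreover have "\<one> \<in> mon_span"
    using mon_span.mon[of "(\<lambda>_. 0, \<lambda>_. 0)"] by (simp add: labels_def mon_def)
  ultimately have "b \<otimes> \<one> \<in> mon_span"
    using \<open>b \<in> B\<close> by blast
  then show "b \<in> mon_span"
    using \<open>b \<in> B\<close> by (simp add: B_closed)
qed

text \<open>Eigenvector argument: \<open>tau a\<close> has weight \<open>a i\<close> under
  \<open>br (d i)\<close>, the coefficients have weight 0, and different labels differ in some
  weight. A single remaining term vanishes because \<open>tau\<close> is a unit.\<close>

lemma tau_independent: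
  assumes "finite J" "inj_on l J" "\<And>j i. \<lbrakk>j \<in> J; i \<notin> {1..n}\<rbrakk> \<Longrightarrow> l j i = 0"
    and "c \<in> J \<rightarrow> C" "(\<Oplus>j\<in>J. tau (l j) \<otimes> c j) = \<zero>" "j \<in> J"
  shows "c j = \<zero>"
  using assms
proof (induct "card J" arbitrary: J c j rule: less_induct)
  case less
  have cC: "\<And>j. j \<in> J \<Longrightarrow> c j \<in> C" using less.prems(4) by auto
  then have cl: "\<And>j. j \<in> J \<Longrightarrow> c j \<in> carrier A" by simp
  show ?case
  proof (cases "J = {j}")
    case True
    then have "tau (l j) \<otimes> c j = \<zero>"
      using less.prems(5) cl by simp
    then have "inv tau (l j) \<otimes> (tau (l j) \<otimes> c j) = \<zero>"
      using tau_Units by simp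
    then show ?thesis
      using tau_Units[of "l j"] cl True by (simp add: m_assoc[symmetric])
  next
    case False
    then obtain k where k: "k \<in> J" "k \<noteq> j" using less.prems(6) by auto
    then have "l k \<noteq> l j" using less.prems(2,6) by (auto simp: inj_on_def)
    then obtain i where i: "l k i \<noteq> l j i" by auto
    have i1: "i \<in> {1..n}"
    proof (rule ccontr)
      assume "i \<notin> {1..n}"
      then have "l k i = 0" "l j i = 0" using less.prems(3) less.prems(6) k(1) by blast+
      with i show False by simp
    qed
    have brc: "\<And>j. j \<in> J \<Longrightarrow> br (d i) (c j) = \<zero>" using cC i1 by (simp add: C_iff)
    \<comment> \<open>Subtracting \<open>l k' i\<close> times the relation from its commutator with
      \<open>d i\<close> removes the term of \<open>k'\<close> and multiplies each other coefficient
      by a difference of weights, which is nonzero at \<open>j'\<close>. The induction hypothesis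
      applies to the shorter relation.\<close>
    have vanish: "c j' = \<zero>" if "j' \<in> J" "l j' i \<noteq> l k' i" "k' \<in> J" for j' k'
    proof -
      let ?s = "\<Oplus>j\<in>J. tau (l j) \<otimes> c j" and ?w = "\<lambda>j. of_int (l j i - l k' i) :: complex"
      have "br (d i) ?s = (\<Oplus>j\<in>J. br (d i) (tau (l j) \<otimes> c j))"
        using less.prems(1) i1 cl by (intro br_finsum) auto
      also have "\<dots> = (\<Oplus>j\<in>J. of_int (l j i) \<odot> (tau (l j) \<otimes> c j))"
        using i1 cl brc by (intro add.finprod_cong') (auto simp: br_mult_right br_d_tau smult_mult_left)
      finally have 1: "(\<Oplus>j\<in>J. of_int (l j i) \<odot> (tau (l j) \<otimes> c j)) = \<zero>"
        using i1 less.prems(5) by simp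
      have "(- of_int (l k' i)) \<odot> ?s = (\<Oplus>j\<in>J. (- of_int (l k' i)) \<odot> (tau (l j) \<otimes> c j))"
        using less.prems(1) cl by (intro smult_finsum) auto
      then have 2: "(\<Oplus>j\<in>J. (- of_int (l k' i)) \<odot> (tau (l j) \<otimes> c j)) = \<zero>"
        using less.prems(5) by simp
      have "(\<Oplus>j\<in>J - {k'}. tau (l j) \<otimes> (?w j \<odot> c j)) =
          (\<Oplus>j\<in>J. of_int (l j i) \<odot> (tau (l j) \<otimes> c j) \<oplus> (- of_int (l k' i)) \<odot> (tau (l j) \<otimes> c j))"
        using less.prems(1) cl
        by (intro finsum_neutral_subset[symmetric])
           (auto simp: smult_add_left[symmetric] smult_mult_right)
      also have "\<dots> = (\<Oplus>j\<in>J. of_int (l j i) \<odot> (tau (l j) \<otimes> c j)) \<oplus>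
          (\<Oplus>j\<in>J. (- of_int (l k' i)) \<odot> (tau (l j) \<otimes> c j))"
        using cl by (intro finsum_addf) auto
      finally have *: "(\<Oplus>j\<in>J - {k'}. tau (l j) \<otimes> (?w j \<odot> c j)) = \<zero>"
        unfolding 1 2 by simp
      have "?w j' \<odot> c j' = \<zero>"
      proof (rule less.hyps[of "J - {k'}" "\<lambda>j. ?w j \<odot> c j" j'])
        show "card (J - {k'}) < card J"
          using less.prems(1) that(3) by (rule card_Diff1_less)
        show "inj_on l (J - {k'})" using less.prems(2) by (rule inj_on_diff)
        show "finite (J - {k'})" using less.prems(1) by simp
        show "l m q = 0" if "m \<in> J - {k'}" "q \<notin> {1..n}" for m q
          using that by (intro less.prems(3)) auto
        show "(\<lambda>j. ?w j \<odot> c j) \<in> J - {k'} \<rightarrow> C" using cC C_smult by blast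
        show "j' \<in> J - {k'}" using that by blast
        show "(\<Oplus>j\<in>J - {k'}. tau (l j) \<otimes> (?w j \<odot> c j)) = \<zero>" by (rule *)
      qed
      then show ?thesis
        using cl[OF that(1)] that(2) by (intro smult_eq_zero[OF _ \<open>?w j' \<odot> c j' = \<zero>\<close>]) auto
    qed
    show ?thesis by (rule vanish[of j k]) (use i k(1) less.prems(6) in auto)
  qed
qed

text \<open>The commutator with \<open>t i\<close> lowers the exponent of \<open>p i\<close>, so
  induction on the total degree in the \<open>p i\<close> kills every coefficient of a label with a
  positive exponent there. The rest is a relation between Laurent monomials.\<close>

lemma mon_independent:
  fixes J :: "'j set" and c :: "'j \<Rightarrow> 'a"
  assumes "finite J" "inj_on l J" "l ` J \<subseteq> labels"
    and "c \<in> J \<rightarrow> C" "(\<Oplus>j\<in>J. mon (l j) \<otimes> c j) = \<zero>" "j \<in> J"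
  shows "c j = \<zero>"
proof -
  have ind: "c j = \<zero>" if "finite J" "inj_on l J" "l ` J \<subseteq> labels"
    and "c \<in> J \<rightarrow> C" "(\<Oplus>j\<in>J. mon (l j) \<otimes> c j) = \<zero>" "j \<in> J"
    and "\<And>j. j \<in> J \<Longrightarrow> (\<Sum>i=1..n. snd (l j) i) < k"
    for k and J :: "'j set" and l :: "'j \<Rightarrow> (nat \<Rightarrow> int) \<times> (nat \<Rightarrow> nat)" and c :: "'j \<Rightarrow> 'a" and j :: 'j
    using that
  proof (induct k arbitrary: J l c j)
    case 0
    from 0(7)[OF 0(6)] show ?case by simp
  next
    case (Suc k)
    have cC: "\<And>j. j \<in> J \<Longrightarrow> c j \<in> C" using Suc.prems(4) by auto
    then have cl: "\<And>j. j \<in> J \<Longrightarrow> c j \<in> carrier A" by simp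
    have vanish: "c j = \<zero>" if j: "j \<in> J" and i: "i \<in> {1..n}" and pos: "snd (l j) i \<noteq> 0" for i j
    proof -
      let ?b = "\<lambda>j. - of_nat (snd (l j) i) :: complex"
      define l' where "l' j = (fst (l j), (snd (l j))(i := snd (l j) i - 1))" for j
      \<comment> \<open>Terms without \<open>p i\<close> drop out of the commutator. They must be
        discarded also for injectivity of \<open>l'\<close>: truncated subtraction would identify
        the exponents 0 and 1.\<close>
      define J' where "J' = {j \<in> J. snd (l j) i \<noteq> 0}"
      have trm: "br (t i) (mon (l j) \<otimes> c j) = mon (l' j) \<otimes> (?b j \<odot> c j)" if "j \<in> J" for j
        using br_t_mon[OF i, of "fst (l j)" "snd (l j)"] i cl[OF that] cC[OF that, unfolded C_iff]
        by (simp add: br_mult_right l'_def smult_mult_left smult_mult_right)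
      have "\<zero> = br (t i) (\<Oplus>j\<in>J. mon (l j) \<otimes> c j)"
        using i Suc.prems(5) by simp
      also have "\<dots> = (\<Oplus>j\<in>J. br (t i) (mon (l j) \<otimes> c j))"
        using Suc.prems(1) i cl by (intro br_finsum) auto
      also have "\<dots> = (\<Oplus>j\<in>J'. mon (l' j) \<otimes> (?b j \<odot> c j))"
        using Suc.prems(1) cl i
        by (intro finsum_neutral_subset) (auto simp: J'_def trm)
      finally have *: "(\<Oplus>j\<in>J'. mon (l' j) \<otimes> (?b j \<odot> c j)) = \<zero>" by simp
      have "?b j \<odot> c j = \<zero>"
      proof (rule Suc.hyps[of J' l' "\<lambda>j. ?b j \<odot> c j" j])
        show "(\<Oplus>j\<in>J'. mon (l' j) \<otimes> (?b j \<odot> c j)) = \<zero>" by (rule *)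
        show "inj_on l' J'"
        proof (rule inj_onI)
          fix x y assume xy: "x \<in> J'" "y \<in> J'" "l' x = l' y"
          then have f: "fst (l x) = fst (l y)" by (simp add: l'_def)
          have eq: "((snd (l x))(i := snd (l x) i - 1)) m = ((snd (l y))(i := snd (l y) i - 1)) m" for m
            using xy(3) by (simp add: l'_def)
          have "snd (l x) m = snd (l y) m" for m
            using xy(1,2) eq[of m] eq[of i] by (cases "m = i") (auto simp: J'_def)
          then have "l x = l y" using f by (simp add: prod_eq_iff fun_eq_iff)
          then show "x = y" using xy Suc.prems(2) by (auto simp: inj_on_def J'_def)
        qed
        show "(\<Sum>i=1..n. snd (l' j) i) < k" if "j \<in> J'" for j
        proof -
          have "(\<Sum>m=1..n. snd (l' j) m) < (\<Sum>m=1..n. snd (l j) m)"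
            using i that by (intro sum_strict_mono_ex1) (auto simp: l'_def J'_def)
          then show ?thesis using Suc.prems(7)[of j] that by (simp add: J'_def)
        qed
        show "l' ` J' \<subseteq> labels"
          using Suc.prems(3) by (auto simp: l'_def J'_def labels_def)
        show "finite J'" using Suc.prems(1) by (simp add: J'_def)
        show "(\<lambda>j. ?b j \<odot> c j) \<in> J' \<rightarrow> C" using cC C_smult unfolding J'_def by blast
        show "j \<in> J'" using j pos by (simp add: J'_def)
      qed
      then show ?thesis
        using cl[OF j] pos by (intro smult_eq_zero[OF _ \<open>?b j \<odot> c j = \<zero>\<close>]) auto
    qed
    show ?case
    proof (cases "\<forall>i\<in>{1..n}. snd (l j) i = 0")
      case False
      then show ?thesis using vanish[OF Suc.prems(6)] by blast
    next
      case True
      define J0 where "J0 = {j \<in> J. \<forall>i\<in>{1..n}. snd (l j) i = 0}"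
      have snd0: "snd (l j) = (\<lambda>_. 0)" if "j \<in> J0" for j
      proof
        fix i show "snd (l j) i = 0"
        proof (cases "i \<in> {1..n}")
          case True
          then show ?thesis using that by (simp add: J0_def)
        next
          case False
          moreover have "l j \<in> labels" using that Suc.prems(3) by (auto simp: J0_def)
          ultimately show ?thesis by (simp add: labels_def)
        qed
      qed
      have J0: "J0 \<subseteq> J" by (auto simp: J0_def)
      have mon0: "mon (l j) = tau (fst (l j))" if "j \<in> J0" for j
        using snd0[OF that] by (simp add: mon_def)
      have J0c: "c j = \<zero>" if "j \<in> J - J0" for j
        using that vanish unfolding J0_def by blast
      have "\<zero> = (\<Oplus>j\<in>J. mon (l j) \<otimes> c j)" using Suc.prems(5) by simp
      also have "\<dots> = (\<Oplus>j\<in>J0. tau (fst (l j)) \<otimes> c j)"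
        using Suc.prems(1) cl J0 by (intro finsum_neutral_subset) (auto simp: mon0 J0c)
      finally have *: "(\<Oplus>j\<in>J0. tau (fst (l j)) \<otimes> c j) = \<zero>" by simp
      show ?thesis
      proof (rule tau_independent[where J = J0 and l = "\<lambda>j. fst (l j)" and c = c and j = j])
        show "(\<Oplus>j\<in>J0. tau (fst (l j)) \<otimes> c j) = \<zero>" by (rule *)
        show "inj_on (\<lambda>j. fst (l j)) J0"
        proof (rule inj_onI)
          fix x y assume xy: "x \<in> J0" "y \<in> J0" "fst (l x) = fst (l y)"
          then have "l x = l y" by (simp add: prod_eq_iff snd0)
          then show "x = y" using inj_onD[OF Suc.prems(2)] xy J0 by blast
        qed
        show "fst (l j) i = 0" if "j \<in> J0" "i \<notin> {1..n}" for j i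
        proof -
          have "l j \<in> labels" using that Suc.prems(3) by (auto simp: J0_def)
          then show ?thesis using that by (simp add: labels_def)
        qed
        show "finite J0" using Suc.prems(1) by (simp add: J0_def)
        show "c \<in> J0 \<rightarrow> C" using cC unfolding J0_def by blast
        show "j \<in> J0" using Suc.prems(6) True by (simp add: J0_def)
      qed
    qed
  qed
  show ?thesis
  \<comment> \<open>The sum of the degrees of all labels, plus one, is a strict bound for each of
    them.\<close>
  proof (rule ind[of J l c j "Suc (\<Sum>j\<in>J. \<Sum>i=1..n. snd (l j) i)"])
    show "(\<Sum>i=1..n. snd (l j) i) < Suc (\<Sum>j\<in>J. \<Sum>i=1..n. snd (l j) i)" if "j \<in> J" for j
      using assms(1) that member_le_sum[of j J "\<lambda>j. \<Sum>i=1..n. snd (l j) i"]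
      by (simp add: less_Suc_eq_le)
  qed (rule assms)+
qed

end

subsection \<open>Weight vectors of finite degree\<close>

context weyl_pairs
begin

text \<open>\<open>ideal_prod\<close> is applied to subalgebras here: by its rules it consists of
  the finite sums of products b c with b in \<open>B\<close> and c in \<open>C\<close>.\<close>

lemma ideal_prod_BC_closed: "x \<in> ideal_prod A B C \<Longrightarrow> x \<in> carrier A"
  by (induct rule: ideal_prod.induct) (auto intro: B_closed)

lemma ideal_prod_BC_subalgebra: "complex_subalgebra (ideal_prod A B C) A"
proof (rule complex_subalgebraI)
  show "ideal_prod A B C \<subseteq> carrier A" using ideal_prod_BC_closed by blast
  show "\<one> \<in> ideal_prod A B C"
    using ideal_prod.prod[OF subringE(3)[OF B_subring] subringE(3)[OF C_subring], of A] by simp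
next
  fix c x assume "x \<in> ideal_prod A B C"
  then show "c \<odot> x \<in> ideal_prod A B C"
  proof induct
    case (prod i j)
    then show ?case
      by (auto simp: smult_mult_left[symmetric] B_closed intro: B_smult ideal_prod.prod)
  qed (auto simp: smult_add_right ideal_prod_BC_closed intro: ideal_prod.sum)
next
  fix x y assume x: "x \<in> ideal_prod A B C" and y: "y \<in> ideal_prod A B C"
  have *: "(b \<otimes> c) \<otimes> y \<in> ideal_prod A B C" if "b \<in> B" "c \<in> C" for b c
    using y
  proof induct
    case (prod b' c')
    have "(b \<otimes> c) \<otimes> (b' \<otimes> c') = b \<otimes> (c \<otimes> b') \<otimes> c'"
      using that prod B_closed by (simp add: m_assoc)
    also have "\<dots> = (b \<otimes> b') \<otimes> (c \<otimes> c')"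
      using that prod B_closed by (simp add: BC_commute m_assoc)
    finally have eq: "(b \<otimes> c) \<otimes> (b' \<otimes> c') = (b \<otimes> b') \<otimes> (c \<otimes> c')" .
    show ?case unfolding eq
      by (intro ideal_prod.prod subringE(6)[OF B_subring] subringE(6)[OF C_subring] that prod)
  next
    case (sum x y)
    then show ?case
      using that B_closed ideal_prod_BC_closed by (simp add: r_distr ideal_prod.sum)
  qed
  show "x \<otimes> y \<in> ideal_prod A B C"
    using x
  proof induct
    case (sum x x')
    then show ?case using y ideal_prod_BC_closed by (simp add: l_distr ideal_prod.sum)
  qed (rule *)
qed (rule ideal_prod.sum)

lemma B_in_ideal_prod: "x \<in> B \<Longrightarrow> x \<in> ideal_prod A B C"
  using ideal_prod.prod[of x B "\<one>" C A] subringE(3)[OF C_subring] by (simp add: B_closed)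

text \<open>Grothendieck's description of differential operators: all k-fold commutators with the
  functions \<open>t i\<close> vanish. Note the shift: \<open>nilp k\<close> means order less than
  k, so order 0 is \<open>nilp 1\<close>.\<close>

primrec nilp :: "nat \<Rightarrow> 'a \<Rightarrow> bool" where
  "nilp 0 u \<longleftrightarrow> u = \<zero>"
| "nilp (Suc k) u \<longleftrightarrow> (\<forall>i\<in>{1..n}. nilp k (br (t i) u))"

text \<open>As \<open>br (t i)\<close> is minus the partial derivative in \<open>p i\<close>, this
  is minus the Euler operator in the variables \<open>p i\<close>, written so that it makes sense
  for every element of \<open>A\<close>.\<close>

definition euler :: "'a \<Rightarrow> 'a"
  where "euler u = (\<Oplus>i\<in>{1..n}. br (t i) u \<otimes> p i)"

lemma euler_closed [simp]: "u \<in> carrier A \<Longrightarrow> euler u \<in> carrier A"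
  unfolding euler_def by (rule finsum_closed) auto

text \<open>The extra term comes from \<open>br (t j) (p j)\<close>, which is minus one. It turns
  the coefficient k + 1 into k when \<open>br (t j)\<close> is applied, which matches the drop of
  the order by one.\<close>

lemma br_t_euler:
  assumes u: "u \<in> carrier A" and j: "j \<in> {1..n}"
  shows "br (t j) (euler u) = euler (br (t j) u) \<oplus> (-1) \<odot> br (t j) u"
proof -
  let ?v = "br (t j) u"
  have v: "?v \<in> carrier A" using u j by simp
  have "br (t j) (br (t i) u \<otimes> p i) = br (t i) ?v \<otimes> p i \<oplus> (if j = i then (-1) \<odot> br (t i) u else \<zero>)"
    if "i \<in> {1..n}" for i
    using that u j br_br_commute[of "t j" "t i" u]
    by (simp add: br_mult_right br_t_t br_t_p smult_mult_right)
  then have "(\<Oplus>i\<in>{1..n}. br (t j) (br (t i) u \<otimes> p i)) =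
      (\<Oplus>i\<in>{1..n}. br (t i) ?v \<otimes> p i \<oplus> (if j = i then (-1) \<odot> br (t i) u else \<zero>))"
    using u j v by (intro add.finprod_cong') auto
  moreover have "br (t j) (euler u) = (\<Oplus>i\<in>{1..n}. br (t j) (br (t i) u \<otimes> p i))"
    unfolding euler_def using u j by (intro br_finsum) auto
  ultimately have "br (t j) (euler u) =
      (\<Oplus>i\<in>{1..n}. br (t i) ?v \<otimes> p i \<oplus> (if j = i then (-1) \<odot> br (t i) u else \<zero>))"
    by simp
  also have "\<dots> = euler ?v \<oplus> (\<Oplus>i\<in>{1..n}. if j = i then (-1) \<odot> br (t i) u else \<zero>)"
    unfolding euler_def using u j v by (intro finsum_addf) auto
  also have "(\<Oplus>i\<in>{1..n}. if j = i then (-1) \<odot> br (t i) u else \<zero>) = (-1) \<odot> ?v"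
    using u j by (intro add.finprod_singleton) auto
  finally show ?thesis .
qed

text \<open>On the top-degree part of an element of degree \<open>k\<close> in the \<open>p i\<close>, the operator
  \<open>euler\<close> acts as multiplication by \<open>- k\<close>.\<close>

lemma nilp_euler:
  "\<lbrakk>u \<in> carrier A; nilp (Suc k) u\<rbrakk> \<Longrightarrow> nilp k (of_nat k \<odot> u \<oplus> euler u)"
proof (induct k arbitrary: u)
  case 0
  then have "euler u = (\<Oplus>i\<in>{1..n}. \<zero>)"
    unfolding euler_def by (intro add.finprod_cong') auto
  then show ?case using 0 by simp
next
  case (Suc k)
  show ?case unfolding nilp.simps(2)
  proof
    fix j assume j: "j \<in> {1..n}"
    let ?v = "br (t j) u"
    have v: "?v \<in> carrier A" using Suc.prems j by simp
    have "br (t j) (of_nat (Suc k) \<odot> u \<oplus> euler u) =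
        of_nat (Suc k) \<odot> ?v \<oplus> (euler ?v \<oplus> (-1) \<odot> ?v)"
      using Suc.prems j by (simp add: br_add_right br_smult_right br_t_euler)
    also have "\<dots> = (of_nat (Suc k) \<odot> ?v \<oplus> (-1) \<odot> ?v) \<oplus> euler ?v"
      using v by (simp add: a_ac)
    also have "of_nat (Suc k) \<odot> ?v \<oplus> (-1) \<odot> ?v = of_nat k \<odot> ?v"
      using v by (simp add: smult_add_left[symmetric])
    finally show "nilp k (br (t j) (of_nat (Suc k) \<odot> u \<oplus> euler u))"
      using Suc.hyps[OF v] Suc.prems j by simp
  qed
qed

definition weight :: "(nat \<Rightarrow> int) \<Rightarrow> 'a \<Rightarrow> bool"
  where "weight w u \<longleftrightarrow> (\<forall>i\<in>{1..n}. br (d i) u = of_int (w i) \<odot> u)"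

text \<open>\<open>t i\<close> itself has weight one in coordinate \<open>i\<close> and zero in the
  others; by the Jacobi identity its weight is added.\<close>

lemma weight_br_t:
  assumes "u \<in> carrier A" "weight w u" "i \<in> {1..n}"
  shows "weight (w(i := w i + 1)) (br (t i) u)"
  unfolding weight_def
proof
  fix j assume j: "j \<in> {1..n}"
  have "br (d j) (br (t i) u) = br (br (d j) (t i)) u \<oplus> br (t i) (br (d j) u)"
    using assms j by (intro br_jacobi) auto
  also have "\<dots> = of_int ((w(i := w i + 1)) j) \<odot> br (t i) u"
    using assms j by (auto simp: br_d_t weight_def br_smult_right smult_add_left a_comm)
  finally show "br (d j) (br (t i) u) = of_int ((w(i := w i + 1)) j) \<odot> br (t i) u" .
qed

text \<open>In each summand the factor \<open>p i\<close> has the opposite weight of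
  \<open>t i\<close> and undoes the shift made by \<open>br (t i)\<close>.\<close>

lemma weight_euler:
  assumes u: "u \<in> carrier A" and w: "weight w u"
  shows "weight w (euler u)"
  unfolding weight_def
proof
  fix j assume j: "j \<in> {1..n}"
  have "br (d j) (br (t i) u \<otimes> p i) = of_int (w j) \<odot> (br (t i) u \<otimes> p i)" if i: "i \<in> {1..n}" for i
  proof -
    have "br (d j) (br (t i) u \<otimes> p i) =
        (of_int ((w(i := w i + 1)) j) + (if i = j then -1 else 0)) \<odot> (br (t i) u \<otimes> p i)"
      using weight_br_t[OF u w i] i j u
      by (intro br_eigen_mult) (auto simp: weight_def br_d_p)
    then show ?thesis by auto
  qed
  then have "(\<Oplus>i\<in>{1..n}. br (d j) (br (t i) u \<otimes> p i)) =
      (\<Oplus>i\<in>{1..n}. of_int (w j) \<odot> (br (t i) u \<otimes> p i))"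
    using u by (intro add.finprod_cong') auto
  moreover have "br (d j) (euler u) = (\<Oplus>i\<in>{1..n}. br (d j) (br (t i) u \<otimes> p i))"
    unfolding euler_def using u j by (intro br_finsum) auto
  ultimately have "br (d j) (euler u) = (\<Oplus>i\<in>{1..n}. of_int (w j) \<odot> (br (t i) u \<otimes> p i))"
    by simp
  also have "\<dots> = of_int (w j) \<odot> euler u"
    unfolding euler_def using u by (intro smult_finsum[symmetric]) auto
  finally show "br (d j) (euler u) = of_int (w j) \<odot> euler u" .
qed

text \<open>Weights are carried through the induction because the final step in order 0 needs the
  exact exponent of the compensating monomial. All auxiliary elements are again weight vectors:
  \<open>br (t i) u\<close> with shifted weight, \<open>?v\<close> with the same one.\<close>

lemma weight_in_ideal_prod:
  "\<lbrakk>u \<in> carrier A; nilp k u; weight w u\<rbrakk> \<Longrightarrow> u \<in> ideal_prod A B C"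
proof (induct k arbitrary: u w)
  case 0
  then show ?case
    using subringE(2) ideal_prod_BC_subalgebra by (auto simp: complex_subalgebra_def)
next
  case (Suc k)
  let ?S = "ideal_prod A B C"
  note S = ideal_prod_BC_subalgebra[unfolded complex_subalgebra_def]
  note closed = subringE(6)[OF conjunct1[OF S]] subringE(7)[OF conjunct1[OF S]]
  show ?case
  proof (cases "k = 0")
    case True
    then have brt: "br (t i) u = \<zero>" if "i \<in> {1..n}" for i
      using Suc.prems(2) that by simp
    \<comment> \<open>The monomial cancels the weight \<open>w\<close> and commutes with all
      \<open>t i\<close>, so the quotient satisfies both conditions of \<open>C_iff\<close>.\<close>
    let ?v = "inv tau w \<otimes> u"
    have T: "tau w \<in> Units A" by (rule tau_Units)
    have "?v \<in> C"
      unfolding C_iff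
    proof (intro conjI ballI)
      show "?v \<in> carrier A" using T Suc.prems(1) by simp
      fix i assume i: "i \<in> {1..n}"
      show "br (t i) ?v = \<zero>"
        using i T Suc.prems(1) brt[OF i] by (simp add: br_mult_right br_inv br_t_tau)
      have "br (d i) (inv tau w) = (- of_int (w i)) \<odot> inv tau w"
        using i T by (intro br_eigen_inv) (auto simp: br_d_tau)
      then have "br (d i) ?v = (- of_int (w i) + of_int (w i)) \<odot> ?v"
        using i T Suc.prems by (intro br_eigen_mult) (auto simp: weight_def)
      then show "br (d i) ?v = \<zero>" using T Suc.prems(1) by simp
    qed
    moreover have "tau w \<in> B"
      using mon_in_B[of "(w, \<lambda>_. 0)"] by (simp add: mon_def)
    moreover have "tau w \<otimes> ?v = u"
      using T Suc.prems(1) by (simp add: m_assoc[symmetric])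
    ultimately show ?thesis by (metis ideal_prod.prod)
  next
    case False
    let ?v = "of_nat k \<odot> u \<oplus> euler u"
    have br_in: "br (t i) u \<in> ?S" if i: "i \<in> {1..n}" for i
      using Suc.hyps[OF _ _ weight_br_t[OF Suc.prems(1,3) i]] Suc.prems(1,2) i by simp
    have pS: "p i \<in> ?S" if "i \<in> {1..n}" for i
      using gens_B[OF that] B_in_ideal_prod closed by (simp add: p_def)
    have "finsum A (\<lambda>i. br (t i) u \<otimes> p i) I \<in> ?S" if "finite I" "I \<subseteq> {1..n}" for I
      using that
    proof (induct I)
      case empty
      then show ?case using S subringE(2) by force
    next
      case (insert x F)
      have "finsum A (\<lambda>i. br (t i) u \<otimes> p i) (insert x F) =
          br (t x) u \<otimes> p x \<oplus> finsum A (\<lambda>i. br (t i) u \<otimes> p i) F"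
        using insert Suc.prems(1) by (intro finsum_insert) auto
      then show ?case using insert br_in pS closed by auto
    qed
    then have E: "euler u \<in> ?S" by (simp add: euler_def)
    have "weight w ?v"
      using weight_euler[OF Suc.prems(1,3)] Suc.prems(1,3)
      by (simp add: weight_def br_add_right br_smult_right smult_add_right smult_smult mult.commute)
    then have "?v \<in> ?S"
      using Suc.hyps[of ?v w] nilp_euler[OF Suc.prems(1,2)] Suc.prems(1) by simp
    then have "?v \<oplus> (-1) \<odot> euler u \<in> ?S"
      using E closed S by simp
    also have "?v \<oplus> (-1) \<odot> euler u = of_nat k \<odot> u"
      using Suc.prems(1) by (simp add: minus_one_smult a_assoc r_neg)
    \<comment> \<open>Here k is nonzero and is inverted in the complex numbers.\<close>
    finally have "(1 / of_nat k) \<odot> (of_nat k \<odot> u) \<in> ?S"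
      using S by blast
    then show ?thesis using False Suc.prems(1) by (simp add: smult_smult)
  qed
qed

end

subsection \<open>Quotients of algebras\<close>

lemma alg_hom_closed: "\<lbrakk>f \<in> alg_hom A A'; x \<in> carrier A\<rbrakk> \<Longrightarrow> f x \<in> carrier A'"
  and alg_hom_mult: "\<lbrakk>f \<in> alg_hom A A'; x \<in> carrier A; y \<in> carrier A\<rbrakk>
    \<Longrightarrow> f (x \<otimes>\<^bsub>A\<^esub> y) = f x \<otimes>\<^bsub>A'\<^esub> f y"
  and alg_hom_add: "\<lbrakk>f \<in> alg_hom A A'; x \<in> carrier A; y \<in> carrier A\<rbrakk>
    \<Longrightarrow> f (x \<oplus>\<^bsub>A\<^esub> y) = f x \<oplus>\<^bsub>A'\<^esub> f y"
  and alg_hom_one: "f \<in> alg_hom A A' \<Longrightarrow> f \<one>\<^bsub>A\<^esub> = \<one>\<^bsub>A'\<^esub>"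
  and alg_hom_smult: "\<lbrakk>f \<in> alg_hom A A'; x \<in> carrier A\<rbrakk> \<Longrightarrow> f (c \<odot>\<^bsub>A\<^esub> x) = c \<odot>\<^bsub>A'\<^esub> f x"
  by (auto simp: alg_hom_def dest: ring_hom_closed ring_hom_mult ring_hom_add ring_hom_one)

lemma alg_homI:
  assumes "\<And>x. x \<in> carrier A \<Longrightarrow> f x \<in> carrier A'"
    and "\<And>x y. \<lbrakk>x \<in> carrier A; y \<in> carrier A\<rbrakk> \<Longrightarrow> f (x \<otimes>\<^bsub>A\<^esub> y) = f x \<otimes>\<^bsub>A'\<^esub> f y"
    and "\<And>x y. \<lbrakk>x \<in> carrier A; y \<in> carrier A\<rbrakk> \<Longrightarrow> f (x \<oplus>\<^bsub>A\<^esub> y) = f x \<oplus>\<^bsub>A'\<^esub> f y"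
    and "f \<one>\<^bsub>A\<^esub> = \<one>\<^bsub>A'\<^esub>"
    and "\<And>c x. x \<in> carrier A \<Longrightarrow> f (c \<odot>\<^bsub>A\<^esub> x) = c \<odot>\<^bsub>A'\<^esub> f x"
  shows "f \<in> alg_hom A A'"
  unfolding alg_hom_def using assms by (auto intro: ring_hom_memI)

lemma alg_hom_comp: "\<lbrakk>f \<in> alg_hom A A'; g \<in> alg_hom A' A''\<rbrakk> \<Longrightarrow> g \<circ> f \<in> alg_hom A A''"
  by (auto simp: alg_hom_def intro: ring_hom_trans dest: ring_hom_closed)

context complex_algebra
begin

lemma coset_eq_iff:
  assumes "ideal I A" "x \<in> carrier A" "y \<in> carrier A"
  shows "I +> x = I +> y \<longleftrightarrow> x \<ominus> y \<in> I"
proof -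
  interpret ideal I A by fact
  show ?thesis
    using a_rcos_module_minus[OF ring_axioms assms(3,2)] a_repr_independence'[of x y]
      a_rcos_self[OF assms(2)] assms by auto
qed

text \<open>Scalars act as multiplication by multiples of \<open>\<one>\<close>, so every ring ideal
  is a subspace.\<close>

lemma ideal_smult:
  assumes "ideal I A" "x \<in> I"
  shows "c \<odot> x \<in> I"
proof -
  interpret ideal I A by fact
  have "(c \<odot> \<one>) \<otimes> x \<in> I" using assms(2) by (intro I_l_closed) auto
  then show ?thesis using assms(2) by (simp add: smult_mult_left)
qed

text \<open>Scalar multiplication on the quotient is a union over all representatives; they all
  yield the same coset, so the union is that coset.\<close>

lemma quotient_alg_proj:
  assumes "ideal I A"
  shows "(\<lambda>x. I +> x) \<in> alg_hom A (quotient_alg A I)"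
proof -
  interpret ideal I A by fact
  have "c \<odot>\<^bsub>quotient_alg A I\<^esub> (I +> x) = I +> (c \<odot> x)" if x: "x \<in> carrier A" for c x
  proof -
    have "I +> (c \<odot> y) = I +> (c \<odot> x)" if y: "y \<in> I +> x" for y
    proof -
      obtain z where z: "z \<in> I" "y = z \<oplus> x"
        using y unfolding a_r_coset_def' by auto
      then have zc: "z \<in> carrier A" by simp
      have "c \<odot> y \<ominus> c \<odot> x = c \<odot> z"
        using z(2) zc x by (simp add: smult_add_right minus_eq a_assoc r_neg)
      then have "c \<odot> y \<ominus> c \<odot> x \<in> I"
        using ideal_smult[OF assms z(1)] by simp
      moreover have "c \<odot> y \<in> carrier A" "c \<odot> x \<in> carrier A"
        using z(2) zc x by auto
      ultimately show ?thesis by (simp only: coset_eq_iff[OF assms])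
    qed
    then have "(\<Union>y \<in> I +> x. I +> (c \<odot> y)) = (\<Union>y \<in> I +> x. I +> (c \<odot> x))"
      by (rule SUP_cong[OF refl])
    also have "\<dots> = I +> (c \<odot> x)"
      using a_rcos_self[OF x] by blast
    finally show ?thesis by (simp add: quotient_alg_def)
  qed
  moreover have "(\<lambda>x. I +> x) \<in> Ring.ring_hom A (quotient_alg A I)"
    using rcos_ring_hom unfolding Ring.ring_hom_def quotient_alg_def by simp
  ultimately show ?thesis by (simp add: alg_hom_def)
qed

lemma quotient_alg_carrier: "carrier (quotient_alg A I) = (\<lambda>x. I +> x) ` carrier A"
  by (auto simp: quotient_alg_def FactRing_simps)

lemma quotient_alg_ring:
  assumes "ideal I A"
  shows "ring (quotient_alg A I)"
proof -
  let ?h = "\<lambda>x. I +> x" and ?Q = "quotient_alg A I"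
  interpret ideal I A by fact
  have h: "?h \<in> Ring.ring_hom A ?Q"
    using quotient_alg_proj[OF assms] by (simp add: alg_hom_def)
  have z: "?h \<zero> = \<zero>\<^bsub>?Q\<^esub>"
    using a_subset by (simp add: quotient_alg_def FactRing_def)
  \<comment> \<open>The image of a ring homomorphism is a ring after its carrier and zero have been
    replaced; here both replacements change nothing.\<close>
  have "?Q\<lparr>carrier := ?h ` carrier A, zero := ?h \<zero>\<rparr> = ?Q"
    unfolding z quotient_alg_carrier[symmetric] by simp
  then show ?thesis
    using ring_hom_imp_img_ring[OF h] by simp
qed

text \<open>First isomorphism theorem. Since \<open>alg_isomorphic\<close> asks for a map out of its
  first argument, the map goes from \<open>A'\<close> to the quotient: choose a preimage under
  \<open>f\<close> and take its coset.\<close>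

lemma alg_isomorphic_quotient:
  assumes A': "complex_algebra A'" and f: "f \<in> alg_hom A A'"
    and surj: "carrier A' \<subseteq> f ` carrier A" and I: "ideal I A"
    and ker: "\<And>x. x \<in> carrier A \<Longrightarrow> f x = \<zero>\<^bsub>A'\<^esub> \<longleftrightarrow> x \<in> I"
  shows "alg_isomorphic A' (quotient_alg A I)"
proof -
  interpret A': complex_algebra A' by fact
  define s where "s a = (SOME x. x \<in> carrier A \<and> f x = a)" for a
  have s: "s a \<in> carrier A" "f (s a) = a" if "a \<in> carrier A'" for a
    using that surj someI_ex[of "\<lambda>x. x \<in> carrier A \<and> f x = a"] by (auto simp: s_def)
  let ?h = "\<lambda>x. I +> x" and ?Q = "quotient_alg A I"
  have h: "?h \<in> alg_hom A ?Q" by (rule quotient_alg_proj[OF I])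
  have f_eq_iff: "f x = f y \<longleftrightarrow> ?h x = ?h y" if "x \<in> carrier A" "y \<in> carrier A" for x y
  proof -
    have "f (x \<ominus> y) = f (x \<oplus> (-1) \<odot> y)"
      using that by (simp add: minus_one_smult minus_eq)
    also have "\<dots> = f x \<ominus>\<^bsub>A'\<^esub> f y"
      using that alg_hom_closed[OF f]
      by (simp add: alg_hom_add[OF f] alg_hom_smult[OF f] A'.minus_one_smult A'.minus_eq)
    finally have "f x = f y \<longleftrightarrow> f (x \<ominus> y) = \<zero>\<^bsub>A'\<^esub>"
      using that alg_hom_closed[OF f] by simp
    then show ?thesis using that by (simp add: ker coset_eq_iff[OF I])
  qed
  let ?g = "\<lambda>a. ?h (s a)"
  \<comment> \<open>Two preimages of one element differ by an element of \<open>I\<close>, so the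
    choice is immaterial; the laws for \<open>?g\<close> then follow from those for
    \<open>?h\<close>.\<close>
  have g: "?g (f x) = ?h x" if "x \<in> carrier A" for x
    using s[OF alg_hom_closed[OF f that]] f_eq_iff[of "s (f x)" x] that by simp
  have "?g \<in> alg_hom A' ?Q"
  proof (rule alg_homI)
    fix a assume "a \<in> carrier A'"
    then show "?g a \<in> carrier ?Q" using s(1) alg_hom_closed[OF h] by blast
  next
    fix a b assume a: "a \<in> carrier A'" and b: "b \<in> carrier A'"
    have "a \<otimes>\<^bsub>A'\<^esub> b = f (s a \<otimes> s b)" "a \<oplus>\<^bsub>A'\<^esub> b = f (s a \<oplus> s b)"
      using s a b by (simp_all add: alg_hom_mult[OF f] alg_hom_add[OF f])
    then show "?g (a \<otimes>\<^bsub>A'\<^esub> b) = ?g a \<otimes>\<^bsub>?Q\<^esub> ?g b" "?g (a \<oplus>\<^bsub>A'\<^esub> b) = ?g a \<oplus>\<^bsub>?Q\<^esub> ?g b"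
      using s(1)[OF a] s(1)[OF b] by (simp_all add: g alg_hom_mult[OF h] alg_hom_add[OF h])
  next
    show "?g \<one>\<^bsub>A'\<^esub> = \<one>\<^bsub>?Q\<^esub>"
      using g[of \<one>] alg_hom_one[OF f] alg_hom_one[OF h] by simp
  next
    fix c a assume a: "a \<in> carrier A'"
    have "c \<odot>\<^bsub>A'\<^esub> a = f (c \<odot> s a)"
      using s a by (simp add: alg_hom_smult[OF f])
    then show "?g (c \<odot>\<^bsub>A'\<^esub> a) = c \<odot>\<^bsub>?Q\<^esub> ?g a"
      using s(1)[OF a] by (simp add: g alg_hom_smult[OF h])
  qed
  moreover have "bij_betw ?g (carrier A') (carrier ?Q)"
    unfolding bij_betw_def
  proof
    show "inj_on ?g (carrier A')"
    proof (rule inj_onI)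
      fix a b assume ab: "a \<in> carrier A'" "b \<in> carrier A'" "?g a = ?g b"
      then have "f (s a) = f (s b)" using s(1) by (simp add: f_eq_iff)
      then show "a = b" using s(2) ab by simp
    qed
    show "?g ` carrier A' = carrier ?Q"
    proof
      show "?g ` carrier A' \<subseteq> carrier ?Q" using s(1) alg_hom_closed[OF h] by blast
      show "carrier ?Q \<subseteq> ?g ` carrier A'"
      proof
        fix X assume "X \<in> carrier ?Q"
        then obtain x where x: "x \<in> carrier A" "X = ?h x" by (auto simp: quotient_alg_carrier)
        then have "X = ?g (f x)" by (simp add: g)
        then show "X \<in> ?g ` carrier A'" using alg_hom_closed[OF f x(1)] by (rule image_eqI)
      qed
    qed
  qed
  ultimately show ?thesis unfolding alg_isomorphic_def by blast
qed

end

subsection \<open>Monoid algebras\<close>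

lemma monoid_alg_simps [simp]:
  "f \<in> carrier (monoid_alg M) \<longleftrightarrow> Poly_Mapping.keys f \<subseteq> carrier M"
  "\<one>\<^bsub>monoid_alg M\<^esub> = Poly_Mapping.single \<one>\<^bsub>M\<^esub> 1"
  "\<zero>\<^bsub>monoid_alg M\<^esub> = 0"
  "f \<oplus>\<^bsub>monoid_alg M\<^esub> g = f + g"
  "c \<odot>\<^bsub>monoid_alg M\<^esub> f = Poly_Mapping.map ((*) c) f"
  by (simp_all add: monoid_alg_def)

lemma lookup_map_times [simp]:
  "Poly_Mapping.lookup (Poly_Mapping.map ((*) c) f) u = c * (Poly_Mapping.lookup f u :: complex)"
  by (simp add: Poly_Mapping.map.rep_eq when_def)

lemma map_times_add: "Poly_Mapping.map ((*) (c::complex)) (f + g) =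
    Poly_Mapping.map ((*) c) f + Poly_Mapping.map ((*) c) g"
  by (rule poly_mapping_eqI) (simp add: lookup_add ring_distribs)

lemma map_times_zero [simp]: "Poly_Mapping.map ((*) (c::complex)) 0 = 0"
  by (rule poly_mapping_eqI) simp

lemma map_times_single:
  "Poly_Mapping.map ((*) (c::complex)) (Poly_Mapping.single u a) = Poly_Mapping.single u (c * a)"
  by (rule poly_mapping_eqI) (simp add: lookup_single when_def)

lemma keys_map_times: "Poly_Mapping.keys (Poly_Mapping.map ((*) (c::complex)) f) \<subseteq> Poly_Mapping.keys f"
  by (auto simp: in_keys_iff)

text \<open>Induction on the size of the support, splitting off one basis vector. It reduces
  multilinear identities in monoid algebras to identities in the monoid.\<close>

lemma poly_mapping_induct_keys [consumes 1, case_names zero single add]: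
  fixes f :: "'w \<Rightarrow>\<^sub>0 complex"
  assumes "Poly_Mapping.keys f \<subseteq> X"
    and zero: "P 0"
    and single: "\<And>u c. u \<in> X \<Longrightarrow> P (Poly_Mapping.single u c)"
    and add: "\<And>f g. \<lbrakk>Poly_Mapping.keys f \<subseteq> X; Poly_Mapping.keys g \<subseteq> X; P f; P g\<rbrakk> \<Longrightarrow> P (f + g)"
  shows "P f"
  using assms(1)
proof (induct "card (Poly_Mapping.keys f)" arbitrary: f rule: less_induct)
  case less
  show ?case
  proof (cases "f = 0")
    case True
    then show ?thesis using zero by simp
  next
    case False
    then obtain u where u: "u \<in> Poly_Mapping.keys f"
      by (metis all_not_in_conv keys_eq_empty)
    let ?s = "Poly_Mapping.single u (Poly_Mapping.lookup f u)"
    have sub: "Poly_Mapping.keys (f - ?s) \<subseteq> Poly_Mapping.keys f - {u}"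
      by (auto simp: in_keys_iff lookup_minus lookup_single when_def split: if_splits)
    then have "card (Poly_Mapping.keys (f - ?s)) < card (Poly_Mapping.keys f)"
      using u by (intro psubset_card_mono) auto
    then have "P (f - ?s)" using less sub by blast
    moreover have "Poly_Mapping.keys ?s \<subseteq> X" using u less.prems by auto
    ultimately have "P ((f - ?s) + ?s)"
      using single[of u] u less.prems sub by (intro add) auto
    then show ?thesis by simp
  qed
qed

text \<open>With freely chosen finite index sets, products whose supports differ can be compared
  termwise; distributivity is the use.\<close>

lemma monoid_alg_mult_superset:
  assumes "finite F" "finite G" "Poly_Mapping.keys f \<subseteq> F" "Poly_Mapping.keys g \<subseteq> G"
  shows "f \<otimes>\<^bsub>monoid_alg M\<^esub> g = (\<Sum>u\<in>F. \<Sum>v\<in>G. Poly_Mapping.single (u \<otimes>\<^bsub>M\<^esub> v)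
    (Poly_Mapping.lookup f u * Poly_Mapping.lookup g v))"
proof -
  have "f \<otimes>\<^bsub>monoid_alg M\<^esub> g = (\<Sum>u\<in>Poly_Mapping.keys f. \<Sum>v\<in>G. Poly_Mapping.single (u \<otimes>\<^bsub>M\<^esub> v)
      (Poly_Mapping.lookup f u * Poly_Mapping.lookup g v))"
    unfolding monoid_alg_def
    using assms by (auto intro!: sum.cong[OF refl] sum.mono_neutral_left simp: in_keys_iff)
  also have "\<dots> = (\<Sum>u\<in>F. \<Sum>v\<in>G. Poly_Mapping.single (u \<otimes>\<^bsub>M\<^esub> v)
      (Poly_Mapping.lookup f u * Poly_Mapping.lookup g v))"
    using assms by (auto intro!: sum.mono_neutral_left simp: in_keys_iff)
  finally show ?thesis .
qed

lemma monoid_alg_mult_single: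
  "Poly_Mapping.single u a \<otimes>\<^bsub>monoid_alg M\<^esub> Poly_Mapping.single v b =
    Poly_Mapping.single (u \<otimes>\<^bsub>M\<^esub> v) (a * b)"
  by (simp add: monoid_alg_mult_superset[of "{u}" "{v}"])

lemma monoid_alg_distrib_right:
  "(f + f') \<otimes>\<^bsub>monoid_alg M\<^esub> g = f \<otimes>\<^bsub>monoid_alg M\<^esub> g + f' \<otimes>\<^bsub>monoid_alg M\<^esub> g"
  by (simp add: monoid_alg_mult_superset[where F = "Poly_Mapping.keys f \<union> Poly_Mapping.keys f'"
        and G = "Poly_Mapping.keys g"] keys_add lookup_add ring_distribs single_add sum.distrib)

lemma monoid_alg_distrib_left:
  "g \<otimes>\<^bsub>monoid_alg M\<^esub> (f + f') = g \<otimes>\<^bsub>monoid_alg M\<^esub> f + g \<otimes>\<^bsub>monoid_alg M\<^esub> f'"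
  by (simp add: monoid_alg_mult_superset[where G = "Poly_Mapping.keys f \<union> Poly_Mapping.keys f'"
        and F = "Poly_Mapping.keys g"] keys_add lookup_add ring_distribs single_add sum.distrib)

lemma monoid_alg_mult_zero [simp]:
  "0 \<otimes>\<^bsub>monoid_alg M\<^esub> g = 0" "g \<otimes>\<^bsub>monoid_alg M\<^esub> 0 = 0"
  by (simp_all add: monoid_alg_def)

lemma monoid_alg_complex_algebra:
  assumes "Group.monoid M"
  shows "complex_algebra (monoid_alg M)"
proof -
  interpret M: Group.monoid M by fact
  let ?A = "monoid_alg M"
  note dist = monoid_alg_distrib_left monoid_alg_distrib_right
  have closed: "f \<otimes>\<^bsub>?A\<^esub> g \<in> carrier ?A" if "f \<in> carrier ?A" "g \<in> carrier ?A" for f g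
  proof -
    have f: "Poly_Mapping.keys f \<subseteq> carrier M" and g: "Poly_Mapping.keys g \<subseteq> carrier M"
      using that by simp_all
    show ?thesis
      using f
    proof (induct rule: poly_mapping_induct_keys)
      case (single u c)
      show ?case using g
      proof (induct rule: poly_mapping_induct_keys)
        case (add f g)
        then show ?case
          using keys_add[of "Poly_Mapping.single u c \<otimes>\<^bsub>?A\<^esub> f" "Poly_Mapping.single u c \<otimes>\<^bsub>?A\<^esub> g"]
          by (simp add: dist) blast
      qed (use single in \<open>auto simp: monoid_alg_mult_single\<close>)
    next
      case (add f f')
      then show ?case
        using keys_add[of "f \<otimes>\<^bsub>?A\<^esub> g" "f' \<otimes>\<^bsub>?A\<^esub> g"] by (simp add: dist) blast
    qed simp
  qed
  have assoc: "(f \<otimes>\<^bsub>?A\<^esub> g) \<otimes>\<^bsub>?A\<^esub> h = f \<otimes>\<^bsub>?A\<^esub> (g \<otimes>\<^bsub>?A\<^esub> h)"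
    if "f \<in> carrier ?A" "g \<in> carrier ?A" "h \<in> carrier ?A" for f g h
  proof -
    have f: "Poly_Mapping.keys f \<subseteq> carrier M" and g: "Poly_Mapping.keys g \<subseteq> carrier M"
      and h: "Poly_Mapping.keys h \<subseteq> carrier M"
      using that by simp_all
    show ?thesis
      using f
    proof (induct rule: poly_mapping_induct_keys)
      case f: (single u a)
      show ?case using g
      proof (induct rule: poly_mapping_induct_keys)
        case g: (single v b)
        show ?case using h
        proof (induct rule: poly_mapping_induct_keys)
          case (single w c)
          then show ?case using f g by (simp add: monoid_alg_mult_single M.m_assoc mult.assoc)
        qed (simp_all add: dist)
      qed (simp_all add: dist)
    qed (simp_all add: dist)
  qed
  have one: "\<one>\<^bsub>?A\<^esub> \<otimes>\<^bsub>?A\<^esub> f = f \<and> f \<otimes>\<^bsub>?A\<^esub> \<one>\<^bsub>?A\<^esub> = f" if "f \<in> carrier ?A" for f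
  proof -
    have f: "Poly_Mapping.keys f \<subseteq> carrier M" using that by simp
    show ?thesis
      using f by (induct rule: poly_mapping_induct_keys) (simp_all add: dist monoid_alg_mult_single)
  qed
  have ab: "abelian_group ?A"
  proof (rule abelian_groupI)
    fix f assume "f \<in> carrier ?A"
    then show "\<exists>g\<in>carrier ?A. g \<oplus>\<^bsub>?A\<^esub> f = \<zero>\<^bsub>?A\<^esub>"
      by (intro bexI[of _ "- f"]) auto
  qed (auto simp: add_ac dest: subsetD[OF keys_add])
  have mon: "Group.monoid ?A"
    by (rule monoidI) (use closed assoc one in \<open>simp_all del: monoid_alg_simps(1) add: monoid_alg_simps(1)[of "Poly_Mapping.single _ _"]\<close>)
  have "ring ?A"
    by (rule ringI[OF ab mon]) (simp_all add: dist)
  moreover have "Module.module (class_ring :: complex ring) ?A"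
  proof (rule moduleI)
    show "cring (class_ring :: complex ring)" by (rule class_cring.cring_axioms)
    show "abelian_group ?A" by (rule ab)
    fix a b :: complex and f g assume f: "f \<in> carrier ?A" and g: "g \<in> carrier ?A"
    show "a \<odot>\<^bsub>?A\<^esub> f \<in> carrier ?A" using f keys_map_times[of a f] by simp
    show "(a \<oplus>\<^bsub>class_ring\<^esub> b) \<odot>\<^bsub>?A\<^esub> f = a \<odot>\<^bsub>?A\<^esub> f \<oplus>\<^bsub>?A\<^esub> b \<odot>\<^bsub>?A\<^esub> f"
      by (auto intro!: poly_mapping_eqI simp: lookup_add ring_distribs)
    show "a \<odot>\<^bsub>?A\<^esub> (f \<oplus>\<^bsub>?A\<^esub> g) = a \<odot>\<^bsub>?A\<^esub> f \<oplus>\<^bsub>?A\<^esub> a \<odot>\<^bsub>?A\<^esub> g"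
      by (simp add: map_times_add)
    show "(a \<otimes>\<^bsub>class_ring\<^esub> b) \<odot>\<^bsub>?A\<^esub> f = a \<odot>\<^bsub>?A\<^esub> (b \<odot>\<^bsub>?A\<^esub> f)"
      by (auto intro!: poly_mapping_eqI)
    show "\<one>\<^bsub>class_ring\<^esub> \<odot>\<^bsub>?A\<^esub> f = f"
      by (auto intro!: poly_mapping_eqI)
  qed
  moreover have "complex_algebra_axioms ?A"
  proof
    fix f g and c :: complex assume f: "f \<in> carrier ?A" and g: "g \<in> carrier ?A"
    have f: "Poly_Mapping.keys f \<subseteq> carrier M" and g: "Poly_Mapping.keys g \<subseteq> carrier M"
      using f g by simp_all
    show "(c \<odot>\<^bsub>?A\<^esub> f) \<otimes>\<^bsub>?A\<^esub> g = c \<odot>\<^bsub>?A\<^esub> (f \<otimes>\<^bsub>?A\<^esub> g)"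
      using f
    proof (induct rule: poly_mapping_induct_keys)
      case (single u a)
      show ?case using g
        by (induct rule: poly_mapping_induct_keys)
           (simp_all add: dist map_times_add map_times_single monoid_alg_mult_single mult.assoc)
    qed (simp_all add: dist map_times_add)
    show "f \<otimes>\<^bsub>?A\<^esub> (c \<odot>\<^bsub>?A\<^esub> g) = c \<odot>\<^bsub>?A\<^esub> (f \<otimes>\<^bsub>?A\<^esub> g)"
      using f
    proof (induct rule: poly_mapping_induct_keys)
      case (single u a)
      show ?case using g
        by (induct rule: poly_mapping_induct_keys)
           (simp_all add: dist map_times_add map_times_single monoid_alg_mult_single mult_ac)
    qed (simp_all add: dist map_times_add)
  qed
  ultimately show ?thesis by (simp add: complex_algebra_def)
qed

section \<open>Linear extension of maps from a monoid to its monoid algebra\<close>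

definition linear_ext :: "(complex, 'a) module \<Rightarrow> ('w \<Rightarrow> 'a) \<Rightarrow> ('w \<Rightarrow>\<^sub>0 complex) \<Rightarrow> 'a"
  where "linear_ext A h f =
    finsum A (\<lambda>u. Poly_Mapping.lookup f u \<odot>\<^bsub>A\<^esub> h u) (Poly_Mapping.keys f)"

context complex_algebra
begin

lemma linear_ext_superset:
  assumes "finite F" "Poly_Mapping.keys f \<subseteq> F" "h \<in> F \<rightarrow> carrier A"
  shows "linear_ext A h f = (\<Oplus>u\<in>F. Poly_Mapping.lookup f u \<odot> h u)"
  unfolding linear_ext_def using assms
  by (intro finsum_neutral_subset[symmetric]) (auto simp: in_keys_iff Pi_iff)

lemma linear_ext_single: "h u \<in> carrier A \<Longrightarrow> linear_ext A h (Poly_Mapping.single u c) = c \<odot> h u"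
  by (simp add: linear_ext_superset[of "{u}"])

lemma linear_ext_add:
  assumes "Poly_Mapping.keys f \<subseteq> X" "Poly_Mapping.keys g \<subseteq> X" "h \<in> X \<rightarrow> carrier A"
  shows "linear_ext A h (f + g) = linear_ext A h f \<oplus> linear_ext A h g"
proof -
  let ?F = "Poly_Mapping.keys f \<union> Poly_Mapping.keys g"
  have h: "h \<in> ?F \<rightarrow> carrier A" using assms by auto
  have hu: "h u \<in> carrier A" if "u \<in> ?F" for u using that h by auto
  have "linear_ext A h (f + g) = (\<Oplus>u\<in>?F. Poly_Mapping.lookup (f + g) u \<odot> h u)"
    using h keys_add[of f g] by (intro linear_ext_superset) auto
  also have "\<dots> = (\<Oplus>u\<in>?F. Poly_Mapping.lookup f u \<odot> h u \<oplus> Poly_Mapping.lookup g u \<odot> h u)"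
    using hu by (intro add.finprod_cong') (auto simp: lookup_add smult_add_left)
  also have "\<dots> = (\<Oplus>u\<in>?F. Poly_Mapping.lookup f u \<odot> h u) \<oplus> (\<Oplus>u\<in>?F. Poly_Mapping.lookup g u \<odot> h u)"
    using h by (intro finsum_addf) auto
  also have "(\<Oplus>u\<in>?F. Poly_Mapping.lookup f u \<odot> h u) = linear_ext A h f"
    using h by (intro linear_ext_superset[symmetric]) auto
  also have "(\<Oplus>u\<in>?F. Poly_Mapping.lookup g u \<odot> h u) = linear_ext A h g"
    using h by (intro linear_ext_superset[symmetric]) auto
  finally show ?thesis .
qed

text \<open>The universal property of the monoid algebra: both sides of each law are linear in every
  argument, so basis elements decide.\<close>

lemma linear_ext_alg_hom:
  assumes M: "Group.monoid M" and closed: "h \<in> carrier M \<rightarrow> carrier A"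
    and one: "h \<one>\<^bsub>M\<^esub> = \<one>"
    and mult: "\<And>u v. \<lbrakk>u \<in> carrier M; v \<in> carrier M\<rbrakk> \<Longrightarrow> h (u \<otimes>\<^bsub>M\<^esub> v) = h u \<otimes> h v"
  shows "linear_ext A h \<in> alg_hom (monoid_alg M) A"
proof -
  interpret M: Group.monoid M by fact
  interpret MA: complex_algebra "monoid_alg M" by (rule monoid_alg_complex_algebra[OF M])
  let ?R = "monoid_alg M" and ?f = "linear_ext A h"
  note add = linear_ext_add[OF _ _ closed]
  have single: "linear_ext A h (Poly_Mapping.single u c) = c \<odot> h u" if "u \<in> carrier M" for u c
    using that closed by (intro linear_ext_single) auto
  have cl: "?f x \<in> carrier A" if "Poly_Mapping.keys x \<subseteq> carrier M" for x
    unfolding linear_ext_def using that closed by (intro finsum_closed) auto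
  have z: "?f 0 = \<zero>" by (simp add: linear_ext_def)
  have keys_mult: "Poly_Mapping.keys (x \<otimes>\<^bsub>?R\<^esub> y) \<subseteq> carrier M"
    if "Poly_Mapping.keys x \<subseteq> carrier M" "Poly_Mapping.keys y \<subseteq> carrier M" for x y
    using MA.m_closed[of x y] that by simp
  show ?thesis
  proof (rule alg_homI)
    fix x assume "x \<in> carrier ?R"
    then show "?f x \<in> carrier A" by (simp add: cl)
  next
    fix x y assume "x \<in> carrier ?R" "y \<in> carrier ?R"
    then have x: "Poly_Mapping.keys x \<subseteq> carrier M" and y: "Poly_Mapping.keys y \<subseteq> carrier M"
      by simp_all
    then show "?f (x \<oplus>\<^bsub>?R\<^esub> y) = ?f x \<oplus> ?f y" by (simp add: add)
    show "?f (x \<otimes>\<^bsub>?R\<^esub> y) = ?f x \<otimes> ?f y"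
      using x
    proof (induct rule: poly_mapping_induct_keys)
      case u: (single u a)
      have ku: "Poly_Mapping.keys (Poly_Mapping.single u a) \<subseteq> carrier M" using u by simp
      show ?case using y
      proof (induct rule: poly_mapping_induct_keys)
        case zero
        then show ?case using cl[OF ku] by (simp add: z)
      next
        case v: (single v b)
        then show ?case
          using u Pi_mem[OF closed]
          by (simp add: monoid_alg_mult_single single mult smult_mult_left smult_mult_right smult_smult mult.commute)
      next
        case (add y y')
        then show ?case
          using ku by (simp add: monoid_alg_distrib_left linear_ext_add[OF _ _ closed] keys_mult r_distr cl)
      qed
    next
      case zero
      then show ?case using cl[OF y] by (simp add: z)
    next
      case (add x x')
      then show ?case
        using y by (simp add: monoid_alg_distrib_right linear_ext_add[OF _ _ closed] keys_mult l_distr cl)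
    qed
  next
    show "?f \<one>\<^bsub>?R\<^esub> = \<one>" by (simp add: single one)
  next
    fix c x assume "x \<in> carrier ?R"
    then have x: "Poly_Mapping.keys x \<subseteq> carrier M" by simp
    then have "?f (Poly_Mapping.map ((*) c) x) = c \<odot> ?f x"
    proof (induct rule: poly_mapping_induct_keys)
      case zero
      show ?case by (simp add: z)
    next
      case (single u a)
      then show ?case using Pi_mem[OF closed]
        by (simp add: map_times_single linear_ext_single smult_smult)
    next
      case (add x y)
      have "Poly_Mapping.keys (Poly_Mapping.map ((*) c) x) \<subseteq> carrier M"
        "Poly_Mapping.keys (Poly_Mapping.map ((*) c) y) \<subseteq> carrier M"
        by (rule subset_trans[OF keys_map_times add(1)], rule subset_trans[OF keys_map_times add(2)])
      then show ?case
        using add by (simp add: map_times_add linear_ext_add[OF _ _ closed] smult_add_right cl)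
    qed
    then show "?f (c \<odot>\<^bsub>?R\<^esub> x) = c \<odot> ?f x" by simp
  qed
qed

end

subsection \<open>The tensor decomposition\<close>

lemma alg_isomorphic_refl: "alg_isomorphic A A"
  unfolding alg_isomorphic_def by (intro bexI[of _ "\<lambda>x. x"] alg_homI) (auto simp: bij_betw_def)

context weyl_pairs
begin

abbreviation BC_monoid :: "('a \<times> 'a) monoid"
  where "BC_monoid \<equiv> restrict_alg A B \<times>\<times> restrict_alg A C"

abbreviation pair_alg :: "(complex, 'a \<times> 'a \<Rightarrow>\<^sub>0 complex) module"
  where "pair_alg \<equiv> monoid_alg BC_monoid"

abbreviation relations :: "('a \<times> 'a \<Rightarrow>\<^sub>0 complex) set"
  where "relations \<equiv> tensor_relations (restrict_alg A B) (restrict_alg A C)"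

definition tensor_ideal :: "('a \<times> 'a \<Rightarrow>\<^sub>0 complex) set"
  where "tensor_ideal = Idl\<^bsub>pair_alg\<^esub> relations"

definition mult_map :: "('a \<times> 'a \<Rightarrow>\<^sub>0 complex) \<Rightarrow> 'a"
  where "mult_map = linear_ext A (\<lambda>(b, c). b \<otimes> c)"

abbreviation pure :: "'a \<Rightarrow> 'a \<Rightarrow> 'a \<times> 'a \<Rightarrow>\<^sub>0 complex"
  where "pure b c \<equiv> Poly_Mapping.single (b, c) 1"

lemma BC_monoid: "Group.monoid BC_monoid"
  using subring_is_ring[OF B_subring] subring_is_ring[OF C_subring]
  by (intro DirProd_monoid) (auto simp: ring.is_monoid)

lemma carrier_BC_monoid [simp]: "carrier BC_monoid = B \<times> C"
  by (simp add: DirProd_def)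

lemma pair_alg: "complex_algebra pair_alg"
  by (rule monoid_alg_complex_algebra[OF BC_monoid])

lemma ring_pair_alg: "ring pair_alg"
  using pair_alg by (simp add: complex_algebra_def)

text \<open>Multiplication of pairs is compatible with the product in \<open>A\<close> exactly
  because elements of \<open>C\<close> can be moved past elements of \<open>B\<close>.\<close>

lemma mult_map_hom: "mult_map \<in> alg_hom pair_alg A"
  unfolding mult_map_def
proof (rule linear_ext_alg_hom[OF BC_monoid])
  show "(\<lambda>(b, c). b \<otimes> c) \<in> carrier BC_monoid \<rightarrow> carrier A"
    by (auto intro: B_closed)
  show "(\<lambda>(b, c). b \<otimes> c) \<one>\<^bsub>BC_monoid\<^esub> = \<one>"
    by (simp add: DirProd_def)
  fix u v assume "u \<in> carrier BC_monoid" "v \<in> carrier BC_monoid"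
  then obtain b c b' c' where uv: "u = (b, c)" "v = (b', c')" "b \<in> B" "c \<in> C" "b' \<in> B" "c' \<in> C"
    by auto
  have cl: "b \<in> carrier A" "c \<in> carrier A" "b' \<in> carrier A" "c' \<in> carrier A"
    using uv B_closed by auto
  have "(b \<otimes> b') \<otimes> (c \<otimes> c') = b \<otimes> (b' \<otimes> c) \<otimes> c'"
    using cl by (simp add: m_assoc)
  also have "\<dots> = b \<otimes> (c \<otimes> b') \<otimes> c'"
    using BC_commute[OF uv(5,4)] by simp
  also have "\<dots> = (b \<otimes> c) \<otimes> (b' \<otimes> c')"
    using cl by (simp add: m_assoc)
  finally show "(\<lambda>(b, c). b \<otimes> c) (u \<otimes>\<^bsub>BC_monoid\<^esub> v) =
      (\<lambda>(b, c). b \<otimes> c) u \<otimes> (\<lambda>(b, c). b \<otimes> c) v"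
    by (simp add: uv DirProd_def)
qed

lemma mult_map_single:
  "\<lbrakk>b \<in> B; c \<in> C\<rbrakk> \<Longrightarrow> mult_map (Poly_Mapping.single (b, c) k) = k \<odot> (b \<otimes> c)"
  unfolding mult_map_def by (subst linear_ext_single) (auto intro: B_closed)

lemma mult_map_add:
  "\<lbrakk>Poly_Mapping.keys f \<subseteq> B \<times> C; Poly_Mapping.keys g \<subseteq> B \<times> C\<rbrakk>
    \<Longrightarrow> mult_map (f + g) = mult_map f \<oplus> mult_map g"
  using alg_hom_add[OF mult_map_hom, of f g] by simp

lemma mult_map_closed: "Poly_Mapping.keys f \<subseteq> B \<times> C \<Longrightarrow> mult_map f \<in> carrier A"
  using alg_hom_closed[OF mult_map_hom, of f] by simp

lemma mult_map_diff:
  assumes "Poly_Mapping.keys f \<subseteq> B \<times> C" "Poly_Mapping.keys g \<subseteq> B \<times> C"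
  shows "mult_map (f - g) = mult_map f \<ominus> mult_map g"
proof -
  have "Poly_Mapping.keys (f - g) \<subseteq> B \<times> C" using keys_diff[of f g] assms by blast
  then have "mult_map ((f - g) + g) = mult_map (f - g) \<oplus> mult_map g" "mult_map (f - g) \<in> carrier A"
    using assms mult_map_add mult_map_closed by blast+
  then show ?thesis
    using assms mult_map_closed by (simp add: minus_eq a_assoc r_neg)
qed

lemma keys_diff_subset:
  "\<lbrakk>Poly_Mapping.keys f \<subseteq> X; Poly_Mapping.keys g \<subseteq> X\<rbrakk> \<Longrightarrow> Poly_Mapping.keys (f - g) \<subseteq> X"
  for f g :: "'w \<Rightarrow>\<^sub>0 complex"
  using keys_diff[of f g] by blast

lemma BC_add_closed: "\<lbrakk>b \<in> B; b' \<in> B\<rbrakk> \<Longrightarrow> b \<oplus> b' \<in> B" "\<lbrakk>c \<in> C; c' \<in> C\<rbrakk> \<Longrightarrow> c \<oplus> c' \<in> C"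
  using subringE(7)[OF B_subring] subringE(7)[OF C_subring] by auto

lemma relation_cases:
  assumes "r \<in> relations"
  obtains (add_left) b b' c where "b \<in> B" "b' \<in> B" "c \<in> C" "r = pure (b \<oplus> b') c - pure b c - pure b' c"
  | (add_right) b c c' where "b \<in> B" "c \<in> C" "c' \<in> C" "r = pure b (c \<oplus> c') - pure b c - pure b c'"
  | (smult_left) k b c where "b \<in> B" "c \<in> C" "r = pure (k \<odot> b) c - Poly_Mapping.single (b, c) k"
  | (smult_right) k b c where "b \<in> B" "c \<in> C" "r = pure b (k \<odot> c) - Poly_Mapping.single (b, c) k"
  using assms unfolding tensor_relations_def by auto

lemma relations_closed: "relations \<subseteq> carrier pair_alg"
proof
  fix r assume "r \<in> relations"
  then show "r \<in> carrier pair_alg"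
    by (cases rule: relation_cases)
       (simp_all add: keys_diff_subset BC_add_closed B_smult C_smult)
qed

lemma tensor_ideal: "ideal tensor_ideal pair_alg"
  unfolding tensor_ideal_def by (rule ring.genideal_ideal[OF ring_pair_alg relations_closed])

lemma relations_subset: "relations \<subseteq> tensor_ideal"
  unfolding tensor_ideal_def by (rule ring.genideal_self[OF ring_pair_alg relations_closed])

lemma mult_map_relation:
  assumes "r \<in> relations"
  shows "mult_map r = \<zero>"
proof -
  have cancel: "x \<oplus> y \<ominus> x \<ominus> y = \<zero>" if "x \<in> carrier A" "y \<in> carrier A" for x y
    using that by algebra
  show ?thesis using assms
  by (cases rule: relation_cases)
     (simp_all add: mult_map_diff keys_diff_subset BC_add_closed B_smult C_smult mult_map_single
        B_closed l_distr r_distr smult_mult_left smult_mult_right cancel r_right_minus_eq)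
qed

lemma mult_map_tensor_ideal:
  assumes "f \<in> tensor_ideal"
  shows "mult_map f = \<zero>"
proof -
  have "ring_hom_ring pair_alg A mult_map"
    using mult_map_hom ring_pair_alg ring_axioms by (intro ring_hom_ringI2) (simp_all add: alg_hom_def)
  then have "ideal (a_kernel pair_alg A mult_map) pair_alg"
    by (rule ring_hom_ring.kernel_is_ideal)
  moreover have "relations \<subseteq> a_kernel pair_alg A mult_map"
    using relations_closed mult_map_relation unfolding a_kernel_def' by blast
  ultimately have "tensor_ideal \<subseteq> a_kernel pair_alg A mult_map"
    unfolding tensor_ideal_def by (rule ring.genideal_minimal[OF ring_pair_alg])
  then show ?thesis using assms by (auto simp: a_kernel_def')
qed

lemma tensor_ideal_zero: "0 \<in> tensor_ideal"
  using additive_subgroup.zero_closed[OF ideal.axioms(1)[OF tensor_ideal]] by simp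

lemma tensor_ideal_add: "\<lbrakk>f \<in> tensor_ideal; g \<in> tensor_ideal\<rbrakk> \<Longrightarrow> f + g \<in> tensor_ideal"
  using additive_subgroup.a_closed[OF ideal.axioms(1)[OF tensor_ideal], of f g] by simp

lemma tensor_ideal_diff:
  assumes "f \<in> tensor_ideal" "g \<in> tensor_ideal"
  shows "f - g \<in> tensor_ideal"
proof -
  have "Poly_Mapping.map ((*) (-1)) g \<in> tensor_ideal"
    using complex_algebra.ideal_smult[OF pair_alg tensor_ideal assms(2), of "-1"] by simp
  then have "f + Poly_Mapping.map ((*) (-1)) g \<in> tensor_ideal"
    using assms(1) by (rule tensor_ideal_add[rotated])
  also have "f + Poly_Mapping.map ((*) (-1)) g = f - g"
    by (rule poly_mapping_eqI) (simp add: lookup_add lookup_minus)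
  finally show ?thesis .
qed

lemma tensor_ideal_sum:
  "(\<And>x. x \<in> X \<Longrightarrow> f x \<in> tensor_ideal) \<Longrightarrow> sum f X \<in> tensor_ideal"
  by (induct X rule: infinite_finite_induct) (auto intro: tensor_ideal_zero tensor_ideal_add)

text \<open>Equality in the tensor product, expressed on representatives, so that tensors can be
  rewritten in transitivity chains without cosets.\<close>

definition cong_tensor :: "('a \<times> 'a \<Rightarrow>\<^sub>0 complex) \<Rightarrow> ('a \<times> 'a \<Rightarrow>\<^sub>0 complex) \<Rightarrow> bool" (infix "\<approx>" 50)
  where "f \<approx> g \<longleftrightarrow> f - g \<in> tensor_ideal"

lemma cong_refl: "f \<approx> f"
  by (simp add: cong_tensor_def tensor_ideal_zero)

lemma cong_sym: "f \<approx> g \<Longrightarrow> g \<approx> f"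
  using tensor_ideal_diff[OF tensor_ideal_zero, of "f - g"] by (simp add: cong_tensor_def)

lemma cong_trans [trans]: "\<lbrakk>f \<approx> g; g \<approx> h\<rbrakk> \<Longrightarrow> f \<approx> h"
  using tensor_ideal_add[of "f - g" "g - h"] by (simp add: cong_tensor_def)

lemma cong_add: "\<lbrakk>f \<approx> g; f' \<approx> g'\<rbrakk> \<Longrightarrow> f + f' \<approx> g + g'"
  using tensor_ideal_add[of "f - g" "f' - g'"] by (simp add: cong_tensor_def algebra_simps)

lemma cong_sum: "(\<And>x. x \<in> X \<Longrightarrow> f x \<approx> g x) \<Longrightarrow> sum f X \<approx> sum g X"
  using tensor_ideal_sum[of X "\<lambda>x. f x - g x"] by (simp add: cong_tensor_def sum_subtractf)

lemma cong_zero_iff: "f \<approx> 0 \<longleftrightarrow> f \<in> tensor_ideal"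
  by (simp add: cong_tensor_def)

lemma relationI:
  "\<lbrakk>b \<in> B; b' \<in> B; c \<in> C\<rbrakk> \<Longrightarrow> pure (b \<oplus> b') c - pure b c - pure b' c \<in> relations"
  "\<lbrakk>b \<in> B; c \<in> C; c' \<in> C\<rbrakk> \<Longrightarrow> pure b (c \<oplus> c') - pure b c - pure b c' \<in> relations"
  "\<lbrakk>b \<in> B; c \<in> C\<rbrakk> \<Longrightarrow> pure (k \<odot> b) c - Poly_Mapping.single (b, c) k \<in> relations"
  "\<lbrakk>b \<in> B; c \<in> C\<rbrakk> \<Longrightarrow> pure b (k \<odot> c) - Poly_Mapping.single (b, c) k \<in> relations"
  unfolding tensor_relations_def
  subgoal by (rule UnI1, rule UnI1, rule UnI1, rule CollectI, rule exI[of _ b], rule exI[of _ b'], rule exI[of _ c]) simp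
  subgoal by (rule UnI1, rule UnI1, rule UnI2, rule CollectI, rule exI[of _ b], rule exI[of _ c], rule exI[of _ c']) simp
  subgoal by (rule UnI1, rule UnI2, rule CollectI, rule exI[of _ k], rule exI[of _ b], rule exI[of _ c]) simp
  subgoal by (rule UnI2, rule CollectI, rule exI[of _ k], rule exI[of _ b], rule exI[of _ c]) simp
  done

lemma pure_add_left: "\<lbrakk>b \<in> B; b' \<in> B; c \<in> C\<rbrakk> \<Longrightarrow> pure (b \<oplus> b') c \<approx> pure b c + pure b' c"
  unfolding cong_tensor_def diff_diff_eq[symmetric]
  by (rule subsetD[OF relations_subset relationI(1)])

lemma pure_add_right: "\<lbrakk>b \<in> B; c \<in> C; c' \<in> C\<rbrakk> \<Longrightarrow> pure b (c \<oplus> c') \<approx> pure b c + pure b c'"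
  unfolding cong_tensor_def diff_diff_eq[symmetric]
  by (rule subsetD[OF relations_subset relationI(2)])

lemma pure_smult_left: "\<lbrakk>b \<in> B; c \<in> C\<rbrakk> \<Longrightarrow> pure (k \<odot> b) c \<approx> Poly_Mapping.single (b, c) k"
  unfolding cong_tensor_def by (rule subsetD[OF relations_subset relationI(3)])

lemma pure_smult_right: "\<lbrakk>b \<in> B; c \<in> C\<rbrakk> \<Longrightarrow> pure b (k \<odot> c) \<approx> Poly_Mapping.single (b, c) k"
  unfolding cong_tensor_def by (rule subsetD[OF relations_subset relationI(4)])

lemma zero_mem: "\<zero> \<in> B" "\<zero> \<in> C"
  using subringE(2)[OF B_subring] subringE(2)[OF C_subring] by auto

text \<open>This is the scalar relation with k = 0, because
  \<open>Poly_Mapping.single (\<zero>, c) 0\<close> is the zero function.\<close>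

lemma pure_zero_left: "c \<in> C \<Longrightarrow> pure \<zero> c \<approx> 0"
  using pure_smult_left[of \<zero> c 0] zero_mem by simp

lemma pure_zero_right: "b \<in> B \<Longrightarrow> pure b \<zero> \<approx> 0"
  using pure_smult_right[of b \<zero> 0] zero_mem by simp

abbreviation normal_sum ::
    "((nat \<Rightarrow> int) \<times> (nat \<Rightarrow> nat)) set \<Rightarrow> ((nat \<Rightarrow> int) \<times> (nat \<Rightarrow> nat) \<Rightarrow> 'a) \<Rightarrow> 'a \<times> 'a \<Rightarrow>\<^sub>0 complex"
  where "normal_sum X c \<equiv> \<Sum>x\<in>X. pure (mon x) (c x)"

text \<open>Normal form of a tensor: the left factors are distinct monomials, and all scalars have
  been moved into the right factors.\<close>

definition normalizable :: "('a \<times> 'a \<Rightarrow>\<^sub>0 complex) \<Rightarrow> bool" where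
  "normalizable f \<longleftrightarrow> (\<exists>X c. finite X \<and> X \<subseteq> labels \<and> c \<in> X \<rightarrow> C \<and> f \<approx> normal_sum X c)"

lemma normalizable_cong: "\<lbrakk>f \<approx> g; normalizable g\<rbrakk> \<Longrightarrow> normalizable f"
  unfolding normalizable_def using cong_trans by blast

lemma normalizable_zero: "normalizable 0"
  unfolding normalizable_def by (intro exI[of _ "{}"]) (simp add: cong_refl)

text \<open>Padding with zero coefficients brings two normal forms to a common index set, where they
  can be added coefficientwise.\<close>

lemma normal_sum_extend:
  assumes "finite Z" "X \<subseteq> Z"
  shows "normal_sum X c \<approx> normal_sum Z (\<lambda>x. if x \<in> X then c x else \<zero>)"
proof -
  have "normal_sum Z (\<lambda>x. if x \<in> X then c x else \<zero>) =
      (\<Sum>x\<in>Z - X. pure (mon x) \<zero>) + normal_sum X c"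
    unfolding sum.subset_diff[OF assms(2,1)] by (intro arg_cong2[where f = "(+)"] sum.cong refl) simp_all
  moreover have "(\<Sum>x\<in>Z - X. pure (mon x) \<zero>) \<approx> (\<Sum>x\<in>Z - X. 0)"
    by (intro cong_sum pure_zero_right mon_in_B)
  ultimately have "normal_sum Z (\<lambda>x. if x \<in> X then c x else \<zero>) \<approx> normal_sum X c"
    using cong_add[of "\<Sum>x\<in>Z - X. pure (mon x) \<zero>" 0 "normal_sum X c" "normal_sum X c"]
    by (simp add: cong_refl)
  then show ?thesis by (rule cong_sym)
qed

lemma normalizable_add:
  assumes "normalizable f" "normalizable g"
  shows "normalizable (f + g)"
proof -
  obtain X c where X: "finite X" "X \<subseteq> labels" "c \<in> X \<rightarrow> C" "f \<approx> normal_sum X c"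
    using assms(1) by (auto simp: normalizable_def)
  obtain Y e where Y: "finite Y" "Y \<subseteq> labels" "e \<in> Y \<rightarrow> C" "g \<approx> normal_sum Y e"
    using assms(2) by (auto simp: normalizable_def)
  let ?Z = "X \<union> Y"
  let ?c = "\<lambda>x. if x \<in> X then c x else \<zero>" and ?e = "\<lambda>x. if x \<in> Y then e x else \<zero>"
  have ce: "?c x \<in> C" "?e x \<in> C" for x using X Y zero_mem by auto
  have "f + g \<approx> normal_sum X c + normal_sum Y e"
    by (rule cong_add[OF X(4) Y(4)])
  also have "\<dots> \<approx> normal_sum ?Z ?c + normal_sum ?Z ?e"
    using X(1) Y(1) by (intro cong_add normal_sum_extend) auto
  also have "\<dots> = (\<Sum>x\<in>?Z. pure (mon x) (?c x) + pure (mon x) (?e x))"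
    by (rule sum.distrib[symmetric])
  also have "\<dots> \<approx> normal_sum ?Z (\<lambda>x. ?c x \<oplus> ?e x)"
    by (intro cong_sum cong_sym[OF pure_add_right] mon_in_B ce)
  finally have "f + g \<approx> normal_sum ?Z (\<lambda>x. ?c x \<oplus> ?e x)" .
  moreover have "(\<lambda>x. ?c x \<oplus> ?e x) \<in> ?Z \<rightarrow> C"
    by (intro Pi_I BC_add_closed ce)
  ultimately show ?thesis
    unfolding normalizable_def using X(1,2) Y(1,2) by (intro exI[of _ ?Z] exI[of _ "\<lambda>x. ?c x \<oplus> ?e x"]) blast
qed

lemma mon_span_in_B: "x \<in> mon_span \<Longrightarrow> x \<in> B"
  by (induct rule: mon_span.induct) (auto intro: zero_mem mon_in_B BC_add_closed B_smult)

lemma normalizable_pure: "\<lbrakk>b \<in> mon_span; c \<in> C\<rbrakk> \<Longrightarrow> normalizable (pure b c)"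
proof (induct arbitrary: c rule: mon_span.induct)
  case zero
  then show ?case using pure_zero_left normalizable_zero normalizable_cong by blast
next
  case (mon x)
  then show ?case
    unfolding normalizable_def
    by (intro exI[of _ "{x}"] exI[of _ "\<lambda>_. c"]) (simp add: cong_refl)
next
  case (add x y)
  then show ?case
    using normalizable_cong[OF pure_add_left normalizable_add] mon_span_in_B by blast
next
  case (smult x k)
  have "pure (k \<odot> x) c \<approx> pure x (k \<odot> c)"
    using cong_trans[OF pure_smult_left cong_sym[OF pure_smult_right]] smult mon_span_in_B by blast
  then show ?case using smult C_smult normalizable_cong by blast
qed

lemma normalizable:
  assumes "f \<in> carrier pair_alg"
  shows "normalizable f"
proof -
  have "Poly_Mapping.keys f \<subseteq> B \<times> C" using assms by simp
  then show ?thesis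
  proof (induct rule: poly_mapping_induct_keys)
    case (single u k)
    then obtain b c where u: "u = (b, c)" "b \<in> B" "c \<in> C" by auto
    have "Poly_Mapping.single u k \<approx> pure (k \<odot> b) c"
      using u pure_smult_left cong_sym by blast
    moreover have "normalizable (pure (k \<odot> b) c)"
      using u B_smult B_subset_mon_span by (intro normalizable_pure) auto
    ultimately show ?case by (rule normalizable_cong)
  qed (auto intro: normalizable_zero normalizable_add)
qed

lemma mult_map_normal_sum:
  assumes "finite X" "c \<in> X \<rightarrow> C"
  shows "Poly_Mapping.keys (normal_sum X c) \<subseteq> B \<times> C \<and>
    mult_map (normal_sum X c) = (\<Oplus>x\<in>X. mon x \<otimes> c x)"
  using assms
proof (induct X rule: finite_induct)
  case empty
  then show ?case using mult_map_tensor_ideal[OF tensor_ideal_zero] by simp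
next
  case (insert x X)
  then have IH: "Poly_Mapping.keys (normal_sum X c) \<subseteq> B \<times> C"
    "mult_map (normal_sum X c) = (\<Oplus>x\<in>X. mon x \<otimes> c x)" and cx: "c x \<in> C"
    by auto
  have k: "Poly_Mapping.keys (pure (mon x) (c x)) \<subseteq> B \<times> C"
    using cx mon_in_B by simp
  have "Poly_Mapping.keys (pure (mon x) (c x) + normal_sum X c) \<subseteq> B \<times> C"
    using keys_add[of "pure (mon x) (c x)" "normal_sum X c"] k IH(1) by blast
  moreover have "mult_map (pure (mon x) (c x) + normal_sum X c) = mon x \<otimes> c x \<oplus> (\<Oplus>x\<in>X. mon x \<otimes> c x)"
    using mult_map_add[OF k IH(1)] IH(2) mult_map_single[OF mon_in_B cx] cx by simp
  moreover have "(\<Oplus>x\<in>insert x X. mon x \<otimes> c x) = mon x \<otimes> c x \<oplus> (\<Oplus>x\<in>X. mon x \<otimes> c x)"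
    using insert(1,2,4) by (intro finsum_insert) (auto dest: Pi_mem)
  ultimately show ?case using insert(1,2) by simp
qed

text \<open>For a tensor in normal form the image is a combination of distinct monomials with
  coefficients in \<open>C\<close>. By \<open>mon_independent\<close> it vanishes only if all
  coefficients do, and then the tensor is zero.\<close>

lemma mult_map_eq_zero_iff:
  assumes "f \<in> carrier pair_alg"
  shows "mult_map f = \<zero> \<longleftrightarrow> f \<in> tensor_ideal"
proof
  assume f: "mult_map f = \<zero>"
  obtain X c where X: "finite X" "X \<subseteq> labels" "c \<in> X \<rightarrow> C" "f \<approx> normal_sum X c"
    using normalizable[OF assms] unfolding normalizable_def by blast
  note ns = mult_map_normal_sum[OF X(1,3)]
  have cl: "(\<Oplus>x\<in>X. mon x \<otimes> c x) \<in> carrier A"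
    using mult_map_closed[OF conjunct1[OF ns]] unfolding conjunct2[OF ns] .
  let ?s = "\<Oplus>x\<in>X. mon x \<otimes> c x"
  have "mult_map (f - normal_sum X c) = \<zero>"
    using X(4) unfolding cong_tensor_def by (rule mult_map_tensor_ideal)
  moreover have "mult_map (f - normal_sum X c) = mult_map f \<ominus> mult_map (normal_sum X c)"
    using assms ns by (intro mult_map_diff) auto
  ultimately have "\<zero> \<ominus> ?s = \<zero>" using ns f by simp
  then have "\<ominus> ?s = \<zero>" using cl by (simp add: minus_eq)
  then have "?s = \<zero>" using minus_minus[OF cl] by simp
  then have "c x = \<zero>" if "x \<in> X" for x
    using that X mon_independent[of X "\<lambda>x. x" c x] by simp
  then have "normal_sum X c \<approx> (\<Sum>x\<in>X. 0)"
    using pure_zero_right mon_in_B by (intro cong_sum) auto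
  with X(4) have "f \<approx> 0" using cong_trans by simp
  then show "f \<in> tensor_ideal" by (simp add: cong_zero_iff)
qed (rule mult_map_tensor_ideal)

theorem tensor_decomposition:
  assumes "carrier A = ideal_prod A B C"
  shows "alg_isomorphic A (tensor_alg (restrict_alg A B) (restrict_alg A C))"
  unfolding tensor_alg_def tensor_ideal_def[symmetric]
proof (rule complex_algebra.alg_isomorphic_quotient[OF pair_alg complex_algebra_axioms mult_map_hom])
  have "x \<in> mult_map ` carrier pair_alg" if "x \<in> ideal_prod A B C" for x
    using that
  proof induct
    case (prod b c)
    then have "b \<otimes> c = mult_map (pure b c)"
      using B_closed[of b] by (simp add: mult_map_single)
    moreover have "pure b c \<in> carrier pair_alg" using prod by simp
    ultimately show ?case by (rule image_eqI)
  next
    case (sum x y)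
    then obtain f g where fg: "x = mult_map f" "f \<in> carrier pair_alg" "y = mult_map g" "g \<in> carrier pair_alg"
      by (elim imageE)
    then have k: "Poly_Mapping.keys f \<subseteq> B \<times> C" "Poly_Mapping.keys g \<subseteq> B \<times> C" by simp_all
    then have "Poly_Mapping.keys (f + g) \<subseteq> B \<times> C" using keys_add[of f g] by blast
    then have "f + g \<in> carrier pair_alg" by simp
    then show ?case unfolding fg(1,3) mult_map_add[OF k, symmetric] by (rule imageI)
  qed
  then show "carrier A \<subseteq> mult_map ` carrier pair_alg" using assms by blast
  show "ideal tensor_ideal pair_alg" by (rule tensor_ideal)
  show "mult_map f = \<zero> \<longleftrightarrow> f \<in> tensor_ideal" if "f \<in> carrier pair_alg" for f
    using that by (rule mult_map_eq_zero_iff)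
qed

text \<open>The two centers coincide as sets. A central element commutes with \<open>B\<close> and
  hence lies in \<open>C\<close>; conversely an element of \<open>C\<close> commutes with
  \<open>B\<close>, so commuting with \<open>C\<close> as well it commutes with all products b
  c.\<close>

theorem center_decomposition:
  assumes "carrier A = ideal_prod A B C"
  shows "center A = center (restrict_alg A C)"
proof
  show "center A \<subseteq> center (restrict_alg A C)"
    unfolding center_def C_def using B_closed
    by (auto simp: mem_centralizer_iff subset_iff)
  show "center (restrict_alg A C) \<subseteq> center A"
  proof
    fix z assume z: "z \<in> center (restrict_alg A C)"
    then have zC: "z \<in> C" and comm: "\<And>c. c \<in> C \<Longrightarrow> z \<otimes> c = c \<otimes> z"
      by (auto simp: center_def)
    have "z \<otimes> x = x \<otimes> z" if "x \<in> ideal_prod A B C" for x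
      using that
    proof induct
      case (prod b c)
      then show ?case using zC comm BC_commute B_closed by (intro commute_mult) auto
    next
      case (sum x y)
      then show ?case using zC ideal_prod_BC_closed by (simp add: l_distr r_distr)
    qed
    then have "\<forall>x\<in>carrier A. z \<otimes> x = x \<otimes> z" using assms by blast
    with C_closed[OF zC] show "z \<in> center A" unfolding center_def by blast
  qed
qed

end

subsection \<open>The symplectic Lie algebra\<close>

text \<open>With indices from 0, \<open>J_mat n\<close> is a signed permutation matrix: row r has
  its only nonzero entry, \<open>sgn_half n r\<close>, in column \<open>swp n r\<close>.\<close>

definition swp :: "nat \<Rightarrow> nat \<Rightarrow> nat" where
  "swp n r = (if r < n then r + n else r - n)"

definition sgn_half :: "nat \<Rightarrow> nat \<Rightarrow> complex" where
  "sgn_half n r = (if r < n then 1 else - 1)"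

lemma swp_less [simp]: "r < 2 * n \<Longrightarrow> swp n r < 2 * n"
  and swp_swp [simp]: "r < 2 * n \<Longrightarrow> swp n (swp n r) = r"
  by (auto simp: swp_def)

lemma swp_eq_iff: "\<lbrakk>r < 2 * n; s < 2 * n\<rbrakk> \<Longrightarrow> s = swp n r \<longleftrightarrow> r = swp n s"
  by (auto simp: swp_def split: if_splits)

lemma sgn_half_swp [simp]: "r < 2 * n \<Longrightarrow> sgn_half n (swp n r) = - sgn_half n r"
  by (auto simp: swp_def sgn_half_def)

lemma J_mat_carrier [simp]: "J_mat n \<in> carrier_mat (2 * n) (2 * n)"
  unfolding J_mat_def mult_2 by (rule four_block_carrier_mat) auto

lemma dim_J_mat [simp]: "dim_row (J_mat n) = 2 * n" "dim_col (J_mat n) = 2 * n"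
  using carrier_matD[OF J_mat_carrier] by auto

lemma J_mat_index:
  "\<lbrakk>r < 2 * n; s < 2 * n\<rbrakk> \<Longrightarrow> J_mat n $$ (r, s) = (if s = swp n r then sgn_half n r else 0)"
  unfolding J_mat_def by (auto simp: swp_def sgn_half_def)

lemma mult_mat_index:
  "\<lbrakk>x \<in> carrier_mat m m; y \<in> carrier_mat m m; r < m; s < m\<rbrakk>
    \<Longrightarrow> (x * y) $$ (r, s) = (\<Sum>k<m. x $$ (r, k) * y $$ (k, s))"
  by (auto simp: scalar_prod_def lessThan_atLeast0)

lemma sum_single_term:
  assumes "finite I" "k \<in> I" "\<And>i. \<lbrakk>i \<in> I; i \<noteq> k\<rbrakk> \<Longrightarrow> f i = 0"
  shows "sum f I = (f k :: complex)"
  using assms by (subst sum.mono_neutral_right[of I "{k}"]) auto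

text \<open>Since J is skew-symmetric, the defining equation says that J x is a symmetric matrix;
  the right-hand side compares its entries.\<close>

lemma sp_iff:
  "x \<in> sp n \<longleftrightarrow> x \<in> carrier_mat (2 * n) (2 * n) \<and>
    (\<forall>r<2 * n. \<forall>s<2 * n. sgn_half n r * x $$ (swp n r, s) = sgn_half n s * x $$ (swp n s, r))"
proof (cases "x \<in> carrier_mat (2 * n) (2 * n)")
  case x: True
  have entry: "(transpose_mat x * J_mat n + J_mat n * x) $$ (r, s) =
      sgn_half n r * x $$ (swp n r, s) - sgn_half n s * x $$ (swp n s, r)"
    if r: "r < 2 * n" and s: "s < 2 * n" for r s
  proof -
    have xT: "transpose_mat x \<in> carrier_mat (2 * n) (2 * n)" using x by simp
    have "(transpose_mat x * J_mat n) $$ (r, s) = (\<Sum>k<2 * n. x $$ (k, r) * J_mat n $$ (k, s))"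
      using x r s by (subst mult_mat_index[OF xT]) auto
    also have "\<dots> = x $$ (swp n s, r) * J_mat n $$ (swp n s, s)"
      using s swp_eq_iff[OF _ s] by (intro sum_single_term) (auto simp: J_mat_index)
    also have "\<dots> = - sgn_half n s * x $$ (swp n s, r)"
      using s by (simp add: J_mat_index)
    finally have 1: "(transpose_mat x * J_mat n) $$ (r, s) = - sgn_half n s * x $$ (swp n s, r)" .
    have "(J_mat n * x) $$ (r, s) = (\<Sum>k<2 * n. J_mat n $$ (r, k) * x $$ (k, s))"
      using x r s by (intro mult_mat_index) auto
    also have "\<dots> = J_mat n $$ (r, swp n r) * x $$ (swp n r, s)"
      using r by (intro sum_single_term) (auto simp: J_mat_index)
    also have "\<dots> = sgn_half n r * x $$ (swp n r, s)"
      using r by (simp add: J_mat_index)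
    finally have 2: "(J_mat n * x) $$ (r, s) = sgn_half n r * x $$ (swp n r, s)" .
    have "(transpose_mat x * J_mat n + J_mat n * x) $$ (r, s) =
        (transpose_mat x * J_mat n) $$ (r, s) + (J_mat n * x) $$ (r, s)"
      using x r s J_mat_carrier[of n] by (intro index_add_mat) auto
    then show ?thesis using 1 2 by simp
  qed
  have c: "transpose_mat x * J_mat n + J_mat n * x \<in> carrier_mat (2 * n) (2 * n)"
    using x J_mat_carrier[of n] by (intro add_carrier_mat mult_carrier_mat) auto
  have "transpose_mat x * J_mat n + J_mat n * x = 0\<^sub>m (2 * n) (2 * n) \<longleftrightarrow>
      (\<forall>r<2 * n. \<forall>s<2 * n. (transpose_mat x * J_mat n + J_mat n * x) $$ (r, s) = 0)"
    using c by (auto intro!: eq_matI)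
  then show ?thesis using x entry by (auto simp: sp_def)
qed (simp add: sp_def)

lemma sp_carrier: "x \<in> sp n \<Longrightarrow> x \<in> carrier_mat (2 * n) (2 * n)"
  by (simp add: sp_def)

lemma sp_add: "\<lbrakk>x \<in> sp n; y \<in> sp n\<rbrakk> \<Longrightarrow> x + y \<in> sp n"
  by (auto simp: sp_iff ring_distribs)

lemma sp_diff: "\<lbrakk>x \<in> sp n; y \<in> sp n\<rbrakk> \<Longrightarrow> x - y \<in> sp n"
  by (auto simp: sp_iff ring_distribs intro!: minus_carrier_mat)

lemma sp_smult: "x \<in> sp n \<Longrightarrow> c \<cdot>\<^sub>m x \<in> sp n"
  by (auto simp: sp_iff mult.left_commute[of _ c])

lemma sp_zero: "0\<^sub>m (2 * n) (2 * n) \<in> sp n"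
  by (auto simp: sp_iff)

lemma sp_transpose:
  assumes "x \<in> sp n"
  shows "transpose_mat x * J_mat n = - (J_mat n * x)"
proof -
  have x: "x \<in> carrier_mat (2 * n) (2 * n)" "transpose_mat x * J_mat n + J_mat n * x = 0\<^sub>m (2 * n) (2 * n)"
    using assms by (auto simp: sp_def)
  have c: "transpose_mat x * J_mat n \<in> carrier_mat (2 * n) (2 * n)"
    "J_mat n * x \<in> carrier_mat (2 * n) (2 * n)"
    using x(1) J_mat_carrier[of n] by (auto intro!: mult_carrier_mat)
  show ?thesis
  proof (rule eq_matI)
    fix i j assume ij: "i < dim_row (- (J_mat n * x))" "j < dim_col (- (J_mat n * x))"
    then have "i < 2 * n" "j < 2 * n" using c by auto
    then have "(transpose_mat x * J_mat n) $$ (i, j) + (J_mat n * x) $$ (i, j) = 0"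
      using c arg_cong[OF x(2), of "\<lambda>m. m $$ (i, j)"] by (simp del: index_mult_mat)
    then show "(transpose_mat x * J_mat n) $$ (i, j) = (- (J_mat n * x)) $$ (i, j)"
      using \<open>i < 2 * n\<close> \<open>j < 2 * n\<close> c x(1) by (simp add: eq_neg_iff_add_eq_0 del: index_mult_mat(1))
  qed (use c x(1) in auto)
qed

text \<open>Moving J to the left past two transposed factors changes the sign twice and reverses
  their order, so the transpose of a b is turned into b a; subtracting the two orders restores the
  minus sign.\<close>

lemma sp_bracket:
  assumes "x \<in> sp n" "y \<in> sp n"
  shows "x * y - y * x \<in> sp n"
proof -
  let ?C = "carrier_mat (2 * n) (2 * n)" and ?J = "J_mat n"
  have c: "x \<in> ?C" "y \<in> ?C" "?J \<in> ?C" using assms by (auto simp: sp_def)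
  have T: "transpose_mat (a * b) * ?J = ?J * (b * a)" if "a \<in> sp n" "b \<in> sp n" for a b
  proof -
    have ab: "a \<in> ?C" "b \<in> ?C" using that by (auto simp: sp_def)
    have ta: "transpose_mat a \<in> ?C" "transpose_mat b \<in> ?C" using ab by simp_all
    have dims: "dim_col (transpose_mat b) = dim_row (?J * a)" "dim_col (?J * b) = dim_row a"
      using ab by auto
    have "transpose_mat (a * b) * ?J = transpose_mat b * (transpose_mat a * ?J)"
      unfolding transpose_mult[OF ab] by (rule assoc_mult_mat[OF ta(2,1) c(3)])
    also have "\<dots> = - (transpose_mat b * (?J * a))"
      unfolding sp_transpose[OF that(1)] by (rule uminus_mult_right_mat[OF dims(1)])
    also have "transpose_mat b * (?J * a) = transpose_mat b * ?J * a"
      by (rule assoc_mult_mat[OF ta(2) c(3) ab(1), symmetric])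
    also have "\<dots> = - (?J * b * a)"
      unfolding sp_transpose[OF that(2)] by (rule uminus_mult_left_mat[OF dims(2)])
    also have "?J * b * a = ?J * (b * a)"
      by (rule assoc_mult_mat[OF c(3) ab(2,1)])
    finally show ?thesis by (simp only: uminus_uminus_mat)
  qed
  have xy: "x * y \<in> ?C" "y * x \<in> ?C" using c by auto
  then have txy: "transpose_mat (x * y) \<in> ?C" "transpose_mat (y * x) \<in> ?C" by auto
  have 1: "transpose_mat (x * y - y * x) * ?J = ?J * (y * x) - ?J * (x * y)"
    unfolding transpose_minus[OF xy] minus_mult_distrib_mat[OF txy c(3)] T[OF assms] T[OF assms(2,1)] ..
  have 2: "?J * (x * y - y * x) = ?J * (x * y) - ?J * (y * x)"
    by (rule mult_minus_distrib_mat[OF c(3) xy])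
  have "?J * (y * x) \<in> ?C" "?J * (x * y) \<in> ?C" using mult_carrier_mat[OF c(3)] xy by auto
  moreover have "P - Q + (Q - P) = 0\<^sub>m (2 * n) (2 * n)" if "P \<in> ?C" "Q \<in> ?C" for P Q :: "complex mat"
    using that by (intro eq_matI) auto
  ultimately have "?J * (y * x) - ?J * (x * y) + (?J * (x * y) - ?J * (y * x)) = 0\<^sub>m (2 * n) (2 * n)"
    by blast
  then show ?thesis
    unfolding sp_def 1 2 using minus_carrier_mat[OF xy(2)] by (intro CollectI conjI) (simp_all only: 1 2)
qed

text \<open>The diagonal of the sum of the f(k) h_k. The function is indexed from 1 as the h_k are,
  the matrix positions from 0.\<close>

definition diag_val :: "nat \<Rightarrow> (nat \<Rightarrow> complex) \<Rightarrow> nat \<Rightarrow> complex" where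
  "diag_val n f r = (if r < n then f (Suc r) else - f (Suc (r - n)))"

definition diag_sp :: "nat \<Rightarrow> (nat \<Rightarrow> complex) \<Rightarrow> complex mat" where
  "diag_sp n f = mat (2 * n) (2 * n) (\<lambda>(r, s). if r = s then diag_val n f r else 0)"

lemma diag_sp_carrier [simp]: "diag_sp n f \<in> carrier_mat (2 * n) (2 * n)"
  by (simp add: diag_sp_def)

lemma diag_val_swp: "r < 2 * n \<Longrightarrow> diag_val n f (swp n r) = - diag_val n f r"
  by (auto simp: diag_val_def swp_def)

lemma diag_sp_index:
  "\<lbrakk>r < 2 * n; s < 2 * n\<rbrakk> \<Longrightarrow> diag_sp n f $$ (r, s) = (if r = s then diag_val n f r else 0)"
  by (simp add: diag_sp_def)

lemma diag_sp_in_sp: "diag_sp n f \<in> sp n"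
proof -
  have "sgn_half n r * diag_sp n f $$ (swp n r, s) = sgn_half n s * diag_sp n f $$ (swp n s, r)"
    if "r < 2 * n" "s < 2 * n" for r s
    using that swp_eq_iff[of r n s] by (cases "s = swp n r") (auto simp: diag_sp_index diag_val_swp)
  then show ?thesis by (simp add: sp_iff)
qed

lemma bracket_carrier:
  "\<lbrakk>x \<in> carrier_mat m m; y \<in> carrier_mat m m\<rbrakk> \<Longrightarrow> x * y - y * x \<in> carrier_mat m m"
  by (simp add: minus_carrier_mat)

lemma diag_sp_bracket_index:
  assumes x: "x \<in> carrier_mat (2 * n) (2 * n)" and r: "r < 2 * n" and s: "s < 2 * n"
  shows "(diag_sp n f * x - x * diag_sp n f) $$ (r, s) = (diag_val n f r - diag_val n f s) * x $$ (r, s)"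
proof -
  have "(diag_sp n f * x) $$ (r, s) = (\<Sum>k<2 * n. diag_sp n f $$ (r, k) * x $$ (k, s))"
    using x r s by (intro mult_mat_index) auto
  also have "\<dots> = diag_sp n f $$ (r, r) * x $$ (r, s)"
    using r by (intro sum_single_term) (auto simp: diag_sp_index)
  finally have 1: "(diag_sp n f * x) $$ (r, s) = diag_val n f r * x $$ (r, s)"
    using r by (simp add: diag_sp_index)
  have "(x * diag_sp n f) $$ (r, s) = (\<Sum>k<2 * n. x $$ (r, k) * diag_sp n f $$ (k, s))"
    using x r s by (intro mult_mat_index) auto
  also have "\<dots> = x $$ (r, s) * diag_sp n f $$ (s, s)"
    using s by (intro sum_single_term) (auto simp: diag_sp_index)
  finally have 2: "(x * diag_sp n f) $$ (r, s) = diag_val n f s * x $$ (r, s)"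
    using s by (simp add: diag_sp_index)
  have "x * diag_sp n f \<in> carrier_mat (2 * n) (2 * n)" using x by (intro mult_carrier_mat) auto
  then have "(diag_sp n f * x - x * diag_sp n f) $$ (r, s) =
      (diag_sp n f * x) $$ (r, s) - (x * diag_sp n f) $$ (r, s)"
    using r s by (intro index_minus_mat) auto
  then show ?thesis using 1 2 by (simp add: ring_distribs)
qed

lemma diag_sp_bracket_eqI:
  assumes "x \<in> carrier_mat (2 * n) (2 * n)"
    and "\<And>r s. \<lbrakk>r < 2 * n; s < 2 * n; x $$ (r, s) \<noteq> 0\<rbrakk> \<Longrightarrow> diag_val n f r - diag_val n f s = c"
  shows "diag_sp n f * x - x * diag_sp n f = c \<cdot>\<^sub>m x"
proof -
  have b: "diag_sp n f * x - x * diag_sp n f \<in> carrier_mat (2 * n) (2 * n)"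
    using assms(1) by (intro bracket_carrier) auto
  show ?thesis
  proof (rule eq_matI)
    fix i j assume "i < dim_row (c \<cdot>\<^sub>m x)" "j < dim_col (c \<cdot>\<^sub>m x)"
    then have ij: "i < 2 * n" "j < 2 * n" using assms(1) by auto
    then show "(diag_sp n f * x - x * diag_sp n f) $$ (i, j) = (c \<cdot>\<^sub>m x) $$ (i, j)"
      using assms by (cases "x $$ (i, j) = 0") (auto simp: diag_sp_bracket_index simp del: index_minus_mat)
  qed (use b assms(1) in auto)
qed

section \<open>The matrices behind the Weyl pairs\<close>

definition t_mat :: "nat \<Rightarrow> nat \<Rightarrow> complex mat" where
  "t_mat n i = (if i = 1 then X2_mat n else X_mat n 1 i)"

text \<open>Dual basis to the weights of \<open>t_mat\<close>: half the sum of all h_k gives 1 on 2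
  eps_1 and 0 on eps_1 - eps_j, while - h_i gives 0 on 2 eps_1 and the Kronecker delta on eps_1 -
  eps_j.\<close>

definition d_mat :: "nat \<Rightarrow> nat \<Rightarrow> complex mat" where
  "d_mat n i = diag_sp n (\<lambda>k. if i = 1 then 1 / 2 else if k = i then - 1 else 0)"

lemma t_mat_carrier [simp]: "t_mat n i \<in> carrier_mat (2 * n) (2 * n)"
  by (auto simp: t_mat_def X2_mat_def X_mat_def e_mat_def intro!: minus_carrier_mat)

lemma t_mat_index:
  assumes "i \<in> {1..n}" "r < 2 * n" "s < 2 * n"
  shows "t_mat n i $$ (r, s) = (if i = 1 then (if r = 0 \<and> s = n then 2 else 0)
    else (if r = 0 \<and> s = i - 1 then 1 else if r = n + i - 1 \<and> s = n then - 1 else 0))"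
  using assms by (auto simp: t_mat_def X2_mat_def X_mat_def e_mat_def)

lemma swp_eq_zero_iff: "\<lbrakk>r < 2 * n; 0 < n\<rbrakk> \<Longrightarrow> swp n r = 0 \<longleftrightarrow> r = n"
  by (auto simp: swp_def)

lemma swp_eq_iff_pred: "\<lbrakk>r < 2 * n; i \<in> {1..n}\<rbrakk> \<Longrightarrow> swp n r = n + i - 1 \<longleftrightarrow> r = i - 1"
  by (auto simp: swp_def)

lemma t_mat_in_sp:
  assumes i: "i \<in> {1..n}"
  shows "t_mat n i \<in> sp n"
proof -
  have n: "0 < n" using i by auto
  have sg: "sgn_half n n = - 1" "sgn_half n (i - 1) = 1" using i by (auto simp: sgn_half_def)
  have "sgn_half n r * t_mat n i $$ (swp n r, s) = sgn_half n s * t_mat n i $$ (swp n s, r)"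
    if r: "r < 2 * n" and s: "s < 2 * n" for r s
    unfolding t_mat_index[OF i swp_less[OF r] s] t_mat_index[OF i swp_less[OF s] r]
      swp_eq_zero_iff[OF r n] swp_eq_zero_iff[OF s n] swp_eq_iff_pred[OF r i] swp_eq_iff_pred[OF s i]
    by (cases "i = 1"; cases "r = n"; cases "s = n"; cases "r = i - 1"; cases "s = i - 1")
       (simp_all only: sg, simp_all)
  then show ?thesis by (simp add: sp_iff)
qed

lemma t_mat_nonzero:
  assumes "i \<in> {1..n}" "r < 2 * n" "s < 2 * n" "t_mat n i $$ (r, s) \<noteq> 0"
  shows "i = 1 \<and> r = 0 \<and> s = n \<or> i \<noteq> 1 \<and> r = 0 \<and> s = i - 1 \<or> i \<noteq> 1 \<and> r = n + i - 1 \<and> s = n"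
  using assms(4) unfolding t_mat_index[OF assms(1-3)] by (auto split: if_splits)

lemma diag_val_simps:
  assumes "i \<in> {1..n}"
  shows "diag_val n f 0 = f 1" "diag_val n f n = - f 1"
    "diag_val n f (i - 1) = f i" "diag_val n f (n + i - 1) = - f i"
proof -
  obtain j where "i = Suc j" "j < n" using assms by (cases i) auto
  then show "diag_val n f 0 = f 1" "diag_val n f n = - f 1"
    "diag_val n f (i - 1) = f i" "diag_val n f (n + i - 1) = - f i"
    by (simp_all add: diag_val_def)
qed

lemma d_mat_in_sp: "d_mat n i \<in> sp n"
  by (simp add: d_mat_def diag_sp_in_sp)

lemma d_t_bracket:
  assumes i: "i \<in> {1..n}" and j: "j \<in> {1..n}"
  shows "d_mat n i * t_mat n j - t_mat n j * d_mat n i = (if i = j then 1 else 0) \<cdot>\<^sub>m t_mat n j"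
  unfolding d_mat_def
proof (rule diag_sp_bracket_eqI)
  let ?f = "\<lambda>k. if i = 1 then 1 / 2 else if k = i then - 1 else 0 :: complex"
  fix r s assume "r < 2 * n" "s < 2 * n" "t_mat n j $$ (r, s) \<noteq> 0"
  from t_mat_nonzero[OF j this]
  have "diag_val n ?f r - diag_val n ?f s = (if j = 1 then ?f 1 + ?f 1 else ?f 1 - ?f j)"
    by (elim disjE conjE) (simp_all only: diag_val_simps[OF j], simp_all)
  also have "\<dots> = (if i = j then 1 else 0)" by simp
  finally show "diag_val n ?f r - diag_val n ?f s = (if i = j then 1 else 0)" .
qed simp

lemma d_d_bracket: "d_mat n i * d_mat n j - d_mat n j * d_mat n i = 0 \<cdot>\<^sub>m d_mat n j"
  unfolding d_mat_def
  by (intro diag_sp_bracket_eqI) (auto simp: diag_sp_index split: if_splits)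

text \<open>Counted from 0, the nonzero columns of these matrices lie among 1 to n, whereas the
  nonzero rows are row 0 and rows beyond n, so no entry of one factor meets an entry of the
  other.\<close>

lemma t_t_mult:
  assumes "i \<in> {1..n}" "j \<in> {1..n}"
  shows "t_mat n i * t_mat n j = 0\<^sub>m (2 * n) (2 * n)"
proof (rule eq_matI)
  fix r s assume "r < dim_row (0\<^sub>m (2 * n) (2 * n))" "s < dim_col (0\<^sub>m (2 * n) (2 * n))"
  then have rs: "r < 2 * n" "s < 2 * n" by auto
  have "t_mat n i $$ (r, k) * t_mat n j $$ (k, s) = 0" if "k < 2 * n" for k
    using t_mat_nonzero[OF assms(1) rs(1) that] t_mat_nonzero[OF assms(2) that rs(2)] assms
    by fastforce
  then show "(t_mat n i * t_mat n j) $$ (r, s) = 0\<^sub>m (2 * n) (2 * n) $$ (r, s)"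
    using rs by (subst mult_mat_index) (auto intro!: sum.neutral)
qed (auto simp: carrier_matD[OF t_mat_carrier])

lemma h_mat_eq: "i \<in> {1..n} \<Longrightarrow> h_mat n i = diag_sp n (\<lambda>k. if k = i then 1 else 0)"
  by (rule eq_matI) (auto simp: h_mat_def e_mat_def diag_sp_def diag_val_def)

text \<open>Induction on a set \<open>P\<close> carrying the support of \<open>f\<close>: the h_i
  with i in \<open>P\<close> span these matrices, and \<open>V\<close> is any condition stable under
  linear combinations.\<close>

lemma diag_sp_subspace:
  assumes zero: "V (0\<^sub>m (2 * n) (2 * n))"
    and add: "\<And>x y. \<lbrakk>x \<in> sp n; y \<in> sp n; V x; V y\<rbrakk> \<Longrightarrow> V (x + y)"
    and smult: "\<And>c x. \<lbrakk>x \<in> sp n; V x\<rbrakk> \<Longrightarrow> V (c \<cdot>\<^sub>m x)"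
    and unit: "\<And>i. i \<in> P \<Longrightarrow> V (diag_sp n (\<lambda>k. if k = i then 1 else 0))"
    and "finite P" "\<And>k. \<lbrakk>k \<in> {1..n}; k \<notin> P\<rbrakk> \<Longrightarrow> f k = 0"
  shows "V (diag_sp n f)"
  using assms(5,4,6)
proof (induct P arbitrary: f rule: finite_induct)
  case empty
  have "f k = 0" if "k \<in> {1..n}" for k using empty.prems(2)[OF that] by simp
  then have "diag_val n f r = 0" if "r < 2 * n" for r
    using that by (auto simp: diag_val_def)
  then have "diag_sp n f = 0\<^sub>m (2 * n) (2 * n)"
    by (intro eq_matI) (auto simp: diag_sp_def)
  then show ?case using zero by simp
next
  case (insert i P)
  let ?u = "\<lambda>k. if k = i then 1 else 0 :: complex"
  have "diag_val n f r = diag_val n (f(i := 0)) r + f i * diag_val n ?u r" for r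
    by (simp add: diag_val_def)
  then have "diag_sp n f = diag_sp n (f(i := 0)) + f i \<cdot>\<^sub>m diag_sp n ?u"
    by (intro eq_matI) (simp_all add: diag_sp_def)
  moreover have "V (diag_sp n (f(i := 0)))"
  proof (rule insert.hyps(3))
    show "(f(i := 0)) k = 0" if "k \<in> {1..n}" "k \<notin> P" for k
      using insert.prems(2)[OF that(1)] that(2) by simp
  qed (rule insert.prems(1), rule insertI2)
  moreover have "V (f i \<cdot>\<^sub>m diag_sp n ?u)"
    by (rule smult[OF diag_sp_in_sp insert.prems(1)[OF insertI1]])
  ultimately show ?case
    using add diag_sp_in_sp sp_smult by simp
qed

text \<open>The entries of \<open>x\<close> at \<open>(r, s)\<close> and at its mirror position form a weight vector.\<close>

lemma sp_weight_induct [consumes 1, case_names zero add weight]: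
  assumes x: "x \<in> sp n"
    and zero: "V (0\<^sub>m (2 * n) (2 * n))"
    and add: "\<And>x y. \<lbrakk>x \<in> sp n; y \<in> sp n; V x; V y\<rbrakk> \<Longrightarrow> V (x + y)"
    and weight: "\<And>y w. \<lbrakk>y \<in> sp n;
      \<And>i. i \<in> {1..n} \<Longrightarrow> d_mat n i * y - y * d_mat n i = of_int (w i) \<cdot>\<^sub>m y\<rbrakk> \<Longrightarrow> V y"
  shows "V x"
  using x
proof (induct "card {(r, s). r < 2 * n \<and> s < 2 * n \<and> x $$ (r, s) \<noteq> 0}" arbitrary: x rule: less_induct)
  case less
  let ?N = "\<lambda>x::complex mat. {(r, s). r < 2 * n \<and> s < 2 * n \<and> x $$ (r, s) \<noteq> 0}"
  have fin: "finite (?N x)" for x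
    by (rule finite_subset[of _ "{..<2 * n} \<times> {..<2 * n}"]) auto
  have xc: "x \<in> carrier_mat (2 * n) (2 * n)"
    and xs: "\<And>r s. \<lbrakk>r < 2 * n; s < 2 * n\<rbrakk> \<Longrightarrow>
      sgn_half n r * x $$ (swp n r, s) = sgn_half n s * x $$ (swp n s, r)"
    using less.prems by (auto simp: sp_iff)
  show ?case
  proof (cases "?N x = {}")
    case True
    then have "x = 0\<^sub>m (2 * n) (2 * n)"
      using xc by (intro eq_matI) auto
    then show ?thesis using zero by simp
  next
    case False
    then obtain r s where rs: "r < 2 * n" "s < 2 * n" "x $$ (r, s) \<noteq> 0" by auto
    \<comment> \<open>By \<open>sp_iff\<close> the entries at these two positions determine each
      other up to sign, so restricting \<open>x\<close> to them stays in \<open>sp n\<close>. For a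
      long root the two positions coincide.\<close>
    define Z where "Z = {(r, s), (swp n s, swp n r)}"
    define y where "y = mat (2 * n) (2 * n) (\<lambda>p. if p \<in> Z then x $$ p else 0)"
    have yc: "y \<in> carrier_mat (2 * n) (2 * n)" by (simp add: y_def)
    have yi: "y $$ (a, b) = (if (a, b) \<in> Z then x $$ (a, b) else 0)" if "a < 2 * n" "b < 2 * n" for a b
      using that by (simp add: y_def)
    have Zsym: "(swp n a, b) \<in> Z \<longleftrightarrow> (swp n b, a) \<in> Z" if "a < 2 * n" "b < 2 * n" for a b
    proof -
      have "swp n c = r \<longleftrightarrow> c = swp n r" "swp n c = swp n s \<longleftrightarrow> c = s" if "c < 2 * n" for c
        using that rs(1,2) swp_swp by metis+
      then show ?thesis using that unfolding Z_def by auto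
    qed
    have y: "y \<in> sp n"
      unfolding sp_iff using yc xs by (auto simp: yi Zsym)
    have "V y"
    proof (rule weight[OF y])
      fix i assume i: "i \<in> {1..n}"
      \<comment> \<open>For \<open>i = 1\<close> the diagonal of \<open>d_mat\<close> consists of
        1/2 and -1/2; \<open>?g\<close> adds 1/2 to it, which keeps all differences and exhibits the
        weights as integers.\<close>
      let ?g = "\<lambda>i r. if i = 1 then (if r < n then 1 else 0)
        else if r < n then (if Suc r = i then - 1 else 0) else (if Suc (r - n) = i then 1 else 0) :: int"
      let ?f = "\<lambda>k. if i = 1 then 1 / 2 else if k = i then - 1 else 0 :: complex"
      have g: "diag_val n ?f a - diag_val n ?f b = of_int (?g i a - ?g i b)" for a b
        by (auto simp: diag_val_def)
      have "diag_val n ?f a - diag_val n ?f b = of_int (?g i r - ?g i s)"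
        if "a < 2 * n" "b < 2 * n" "y $$ (a, b) \<noteq> 0" for a b
      proof -
        have "(a, b) \<in> Z" using that by (auto simp: yi split: if_splits)
        then have "diag_val n ?f a - diag_val n ?f b = diag_val n ?f r - diag_val n ?f s"
          using rs by (auto simp: Z_def diag_val_swp)
        then show ?thesis by (simp only: g)
      qed
      then show "d_mat n i * y - y * d_mat n i = of_int (?g i r - ?g i s) \<cdot>\<^sub>m y"
        unfolding d_mat_def using yc by (intro diag_sp_bracket_eqI) auto
    qed
    moreover have "V (x - y)"
    proof (rule less.hyps)
      have xy: "(x - y) $$ (a, b) = (if (a, b) \<in> Z then 0 else x $$ (a, b))" if "a < 2 * n" "b < 2 * n" for a b
        using that yc by (auto simp: yi)
      have "?N (x - y) \<subseteq> ?N x - {(r, s)}"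
        by (auto simp: xy Z_def simp del: index_minus_mat split: if_splits)
      then have "?N (x - y) \<subset> ?N x" using rs by auto
      then show "card (?N (x - y)) < card (?N x)" by (rule psubset_card_mono[OF fin])
      show "x - y \<in> sp n" by (rule sp_diff[OF less.prems y])
    qed
    ultimately have "V ((x - y) + y)"
      using add y sp_diff[OF less.prems y] by blast
    moreover have "(x - y) + y = x"
      using xc yc by (intro eq_matI) auto
    ultimately show ?thesis by simp
  qed
qed

subsection \<open>Homomorphisms out of enveloping algebras\<close>

lemma monoid_alg_minus:
  assumes "Group.monoid M" "f \<in> carrier (monoid_alg M)" "g \<in> carrier (monoid_alg M)"
  shows "f \<ominus>\<^bsub>monoid_alg M\<^esub> g = f - g"
proof -
  have "(-1) \<odot>\<^bsub>monoid_alg M\<^esub> g = \<ominus>\<^bsub>monoid_alg M\<^esub> g"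
    by (rule complex_algebra.minus_one_smult[OF monoid_alg_complex_algebra[OF assms(1)] assms(3)])
  moreover have "(-1) \<odot>\<^bsub>monoid_alg M\<^esub> g = - g"
    by (auto intro!: poly_mapping_eqI)
  ultimately show ?thesis by (simp add: a_minus_def)
qed

lemma free_monoid_monoid: "Group.monoid (free_monoid X)"
  by (rule monoidI) (auto simp: free_monoid_def)

lemma carrier_free_monoid [simp]: "carrier (free_monoid X) = lists X"
  by (simp add: free_monoid_def)

lemma free_alg_carrier: "f \<in> carrier (free_alg X) \<longleftrightarrow> Poly_Mapping.keys f \<subseteq> lists X"
  by simp

lemma free_alg: "complex_algebra (free_alg X)"
  by (rule monoid_alg_complex_algebra[OF free_monoid_monoid])

lemma free_alg_mult_single:
  "Poly_Mapping.single u a \<otimes>\<^bsub>free_alg X\<^esub> Poly_Mapping.single v b = Poly_Mapping.single (u @ v) (a * b)"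
  by (simp add: monoid_alg_mult_single free_monoid_def)

text \<open>Only a homomorphism out of the enveloping algebra is fixed; relations and generation are
  then available directly in its target \<open>A\<close>.\<close>

locale enveloping_hom = complex_algebra A for A :: "(complex, 'a) module" (structure) +
  fixes g :: "complex mat set" and \<phi> :: "(complex mat list \<Rightarrow>\<^sub>0 complex) set \<Rightarrow> 'a"
  assumes g_add: "\<lbrakk>x \<in> g; y \<in> g\<rbrakk> \<Longrightarrow> x + y \<in> g"
    and g_smult: "x \<in> g \<Longrightarrow> c \<cdot>\<^sub>m x \<in> g"
    and g_bracket: "\<lbrakk>x \<in> g; y \<in> g\<rbrakk> \<Longrightarrow> x * y - y * x \<in> g"
    and \<phi>_hom: "\<phi> \<in> alg_hom (enveloping_alg g) A"
begin

definition incl :: "complex mat \<Rightarrow> 'a"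
  where "incl x = \<phi> (enveloping_incl g x)"

definition lift :: "(complex mat list \<Rightarrow>\<^sub>0 complex) \<Rightarrow> 'a"
  where "lift f = \<phi> (enveloping_ideal g +>\<^bsub>free_alg g\<^esub> f)"

lemma enveloping_ideal: "ideal (enveloping_ideal g) (free_alg g)"
  unfolding enveloping_ideal_def
proof (rule ring.genideal_ideal)
  show "ring (free_alg g)" using free_alg[of g] unfolding complex_algebra_def by blast
  show "enveloping_relations g \<subseteq> carrier (free_alg g)"
    unfolding enveloping_relations_def
    by (auto simp: g_add g_smult g_bracket dest!: subsetD[OF keys_diff] split: if_splits)
qed

lemma enveloping_ring: "ring (enveloping_alg g)"
  unfolding enveloping_alg_def by (rule complex_algebra.quotient_alg_ring[OF free_alg enveloping_ideal])

lemma lift_hom: "lift \<in> alg_hom (free_alg g) A"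
  using alg_hom_comp[OF complex_algebra.quotient_alg_proj[OF free_alg enveloping_ideal]
      \<phi>_hom[unfolded enveloping_alg_def]]
  by (simp add: lift_def[abs_def] comp_def)

lemma lift_single: "lift (Poly_Mapping.single [x] 1) = incl x"
  by (simp add: lift_def incl_def enveloping_incl_def)

lemma enveloping_incl_closed: "x \<in> g \<Longrightarrow> enveloping_incl g x \<in> carrier (enveloping_alg g)"
  unfolding enveloping_incl_def enveloping_alg_def complex_algebra.quotient_alg_carrier[OF free_alg]
  by (rule imageI) simp

lemma incl_closed [simp]: "x \<in> g \<Longrightarrow> incl x \<in> carrier A"
  unfolding incl_def by (rule alg_hom_closed[OF \<phi>_hom enveloping_incl_closed])

lemma lift_eqI:
  assumes "f \<in> carrier (free_alg g)" "h \<in> carrier (free_alg g)" "f - h \<in> enveloping_relations g"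
  shows "lift f = lift h"
proof -
  have rel: "enveloping_relations g \<subseteq> enveloping_ideal g"
    unfolding enveloping_ideal_def genideal_def by blast
  have "f \<ominus>\<^bsub>free_alg g\<^esub> h \<in> enveloping_ideal g"
    using rel assms(3) unfolding monoid_alg_minus[OF free_monoid_monoid assms(1,2)] by blast
  then show ?thesis
    unfolding lift_def
    using complex_algebra.coset_eq_iff[OF free_alg enveloping_ideal assms(1,2)] by simp
qed

lemma incl_add:
  assumes "x \<in> g" "y \<in> g"
  shows "incl (x + y) = incl x \<oplus> incl y"
proof -
  let ?s = "\<lambda>x. Poly_Mapping.single [x] 1"
  have c: "?s (x + y) \<in> carrier (free_alg g)" "?s x \<in> carrier (free_alg g)" "?s y \<in> carrier (free_alg g)"
    using assms g_add by simp_all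
  have "?s (x + y) - (?s x + ?s y) \<in> enveloping_relations g"
    unfolding enveloping_relations_def diff_diff_eq[symmetric] using assms by blast
  moreover have "?s x + ?s y \<in> carrier (free_alg g)"
    using c keys_add[of "?s x" "?s y"] unfolding free_alg_carrier by blast
  ultimately have "lift (?s (x + y)) = lift (?s x + ?s y)"
    using c by (intro lift_eqI)
  also have "\<dots> = lift (?s x) \<oplus> lift (?s y)"
    using alg_hom_add[OF lift_hom c(2,3)] by simp
  finally show ?thesis by (simp only: lift_single)
qed

lemma incl_smult:
  assumes "x \<in> g"
  shows "incl (c \<cdot>\<^sub>m x) = c \<odot> incl x"
proof -
  let ?s = "\<lambda>x. Poly_Mapping.single [x] 1"
  have car: "?s (c \<cdot>\<^sub>m x) \<in> carrier (free_alg g)" "?s x \<in> carrier (free_alg g)"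
    "Poly_Mapping.single [x] c \<in> carrier (free_alg g)"
    using assms g_smult by simp_all
  have "?s (c \<cdot>\<^sub>m x) - Poly_Mapping.single [x] c \<in> enveloping_relations g"
    unfolding enveloping_relations_def using assms by blast
  then have "lift (?s (c \<cdot>\<^sub>m x)) = lift (Poly_Mapping.single [x] c)"
    using car by (intro lift_eqI)
  also have "Poly_Mapping.single [x] c = c \<odot>\<^bsub>free_alg g\<^esub> ?s x"
    by (simp add: map_times_single)
  also have "lift \<dots> = c \<odot> lift (?s x)"
    by (rule alg_hom_smult[OF lift_hom car(2)])
  finally show ?thesis by (simp only: lift_single)
qed

lemma br_incl:
  assumes "x \<in> g" "y \<in> g"
  shows "br (incl x) (incl y) = incl (x * y - y * x)"
proof -
  let ?s = "\<lambda>x. Poly_Mapping.single [x] 1" and ?b = "x * y - y * x"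
  have c: "?s x \<in> carrier (free_alg g)" "?s y \<in> carrier (free_alg g)" "?s ?b \<in> carrier (free_alg g)"
    "Poly_Mapping.single [x, y] (1::complex) \<in> carrier (free_alg g)"
    "Poly_Mapping.single [y, x] (1::complex) \<in> carrier (free_alg g)"
    using assms g_bracket by simp_all
  have m: "?s x \<otimes>\<^bsub>free_alg g\<^esub> ?s y = Poly_Mapping.single [x, y] 1"
    "?s y \<otimes>\<^bsub>free_alg g\<^esub> ?s x = Poly_Mapping.single [y, x] 1"
    by (simp_all add: free_alg_mult_single)
  have "Poly_Mapping.single [x, y] 1 - (Poly_Mapping.single [y, x] 1 + ?s ?b) \<in> enveloping_relations g"
    unfolding enveloping_relations_def diff_diff_eq[symmetric] using assms by blast
  moreover have "Poly_Mapping.single [y, x] 1 + ?s ?b \<in> carrier (free_alg g)"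
    using c(3,5) keys_add[of "Poly_Mapping.single [y, x] 1" "?s ?b"] unfolding free_alg_carrier by blast
  ultimately have "lift (Poly_Mapping.single [x, y] 1) = lift (Poly_Mapping.single [y, x] 1 + ?s ?b)"
    using c(4) by (intro lift_eqI)
  also have "\<dots> = lift (Poly_Mapping.single [y, x] 1) \<oplus> lift (?s ?b)"
    using alg_hom_add[OF lift_hom c(5,3)] by simp
  finally have "incl x \<otimes> incl y = incl y \<otimes> incl x \<oplus> incl ?b"
    unfolding m[symmetric] alg_hom_mult[OF lift_hom c(1,2)] alg_hom_mult[OF lift_hom c(2,1)] lift_single .
  moreover have "incl x \<in> carrier A" "incl y \<in> carrier A" "incl ?b \<in> carrier A"
    using assms g_bracket by simp_all
  ultimately show ?thesis
    unfolding br_def by (simp add: minus_eq a_comm[of _ "incl ?b"] a_assoc r_neg)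
qed

text \<open>Every element of the enveloping algebra is a linear combination of words in
  \<open>g\<close>, so a subalgebra containing the images of the letters contains the whole
  image.\<close>

lemma range_in_subalgebra:
  assumes H: "complex_subalgebra H A" and gen: "\<And>x. x \<in> g \<Longrightarrow> incl x \<in> H"
    and u: "u \<in> carrier (enveloping_alg g)"
  shows "\<phi> u \<in> H"
proof -
  have sr: "subring H A" and sm: "\<And>c x. x \<in> H \<Longrightarrow> c \<odot> x \<in> H"
    using H by (auto simp: complex_subalgebra_def)
  obtain f where f: "f \<in> carrier (free_alg g)" "u = enveloping_ideal g +>\<^bsub>free_alg g\<^esub> f"
    using u unfolding enveloping_alg_def complex_algebra.quotient_alg_carrier[OF free_alg] by blast
  have word: "lift (Poly_Mapping.single w 1) \<in> H" if "w \<in> lists g" for w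
    using that
  proof (induct w)
    case Nil
    have "lift (Poly_Mapping.single [] 1) = \<one>"
      using alg_hom_one[OF lift_hom] by (simp add: free_monoid_def)
    then show ?case using subringE(3)[OF sr] by simp
  next
    case (Cons x w)
    have "Poly_Mapping.single (x # w) 1 = Poly_Mapping.single [x] 1 \<otimes>\<^bsub>free_alg g\<^esub> Poly_Mapping.single w 1"
      by (simp add: free_alg_mult_single)
    also have "lift \<dots> = incl x \<otimes> lift (Poly_Mapping.single w 1)"
      using Cons(1,2) by (subst alg_hom_mult[OF lift_hom]) (simp_all add: lift_single)
    finally show ?case using subringE(6)[OF sr gen[OF Cons(1)] Cons(3)] by simp
  qed
  have "Poly_Mapping.keys f \<subseteq> lists g" using f(1) by simp
  then have "lift f \<in> H"
  proof (induct rule: poly_mapping_induct_keys)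
    case zero
    have "lift 0 = 0 \<odot> lift 0"
      using alg_hom_smult[OF lift_hom, of 0 0] by simp
    also have "\<dots> = \<zero>" using alg_hom_closed[OF lift_hom, of 0] by simp
    finally show ?case using subringE(2)[OF sr] by simp
  next
    case (single w c)
    have "Poly_Mapping.single w c = c \<odot>\<^bsub>free_alg g\<^esub> Poly_Mapping.single w 1"
      by (simp add: map_times_single)
    also have "lift \<dots> = c \<odot> lift (Poly_Mapping.single w 1)"
      using single by (intro alg_hom_smult[OF lift_hom]) simp
    finally show ?case using sm[OF word[OF single]] by simp
  next
    case (add f f')
    then have "lift (f + f') = lift f \<oplus> lift f'"
      using alg_hom_add[OF lift_hom, of f f'] by simp
    then show ?case using add subringE(7)[OF sr] by simp
  qed
  then show ?thesis by (simp add: f(2) lift_def)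
qed

end

text \<open>In each of the eight products of the expansion two of \<open>a\<close>,
  \<open>c\<close>, \<open>e\<close> stand on the same side of \<open>x\<close> and next to each
  other, and their product is zero.\<close>

lemma (in ring) triple_br_zero:
  assumes "a \<in> carrier R" "c \<in> carrier R" "e \<in> carrier R" "x \<in> carrier R"
    and "a \<otimes> c = \<zero>" "a \<otimes> e = \<zero>" "c \<otimes> e = \<zero>" "e \<otimes> c = \<zero>" "c \<otimes> a = \<zero>" "e \<otimes> a = \<zero>"
  shows "br a (br c (br e x)) = \<zero>"
proof -
  have "br a (br c (br e x)) =
      (a \<otimes> c) \<otimes> (e \<otimes> x) \<ominus> (a \<otimes> c) \<otimes> (x \<otimes> e) \<ominus> (a \<otimes> e) \<otimes> (x \<otimes> c) \<oplus> (a \<otimes> x) \<otimes> (e \<otimes> c) \<ominus>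
      ((c \<otimes> e) \<otimes> (x \<otimes> a) \<ominus> (c \<otimes> x) \<otimes> (e \<otimes> a) \<ominus> (e \<otimes> x) \<otimes> (c \<otimes> a) \<oplus> (x \<otimes> e) \<otimes> (c \<otimes> a))"
    unfolding br_def using assms(1-4) by algebra
  then show ?thesis using assms by (simp add: minus_eq)
qed

text \<open>The type of matrices contains all sizes, so the computation takes place in the ring of
  \<open>m\<close> by \<open>m\<close> matrices.\<close>

lemma mat_triple_bracket_zero:
  fixes a c e x :: "complex mat"
  assumes "a \<in> carrier_mat m m" "c \<in> carrier_mat m m" "e \<in> carrier_mat m m" "x \<in> carrier_mat m m"
    and "a * c = 0\<^sub>m m m" "a * e = 0\<^sub>m m m" "c * e = 0\<^sub>m m m"
    and "e * c = 0\<^sub>m m m" "c * a = 0\<^sub>m m m" "e * a = 0\<^sub>m m m"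
  shows "a * (c * (e * x - x * e) - (e * x - x * e) * c) -
    (c * (e * x - x * e) - (e * x - x * e) * c) * a = 0\<^sub>m m m"
proof -
  let ?R = "ring_mat TYPE(complex) m ()"
  have R: "ring ?R" by (rule ring_mat)
  have car: "carrier ?R = carrier_mat m m" by (simp add: ring_mat_def)
  have br: "ring.br ?R u v = u * v - v * u" if "u \<in> carrier_mat m m" "v \<in> carrier_mat m m" for u v
  proof -
    have uv: "u * v \<in> carrier_mat m m" "v * u \<in> carrier_mat m m" using that by auto
    have "\<ominus>\<^bsub>?R\<^esub> (v * u) = - (v * u)"
      using uv by (intro abelian_group.minus_equality[OF ring.is_abelian_group[OF R]])
        (simp_all add: ring_mat_simps car uminus_l_inv_mat)
    then show ?thesis
      unfolding ring.br_def[OF R] a_minus_def ring_mat_simps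
      using minus_add_uminus_mat[OF uv] by simp
  qed
  have "ring.br ?R a (ring.br ?R c (ring.br ?R e x)) = \<zero>\<^bsub>?R\<^esub>"
    using assms by (intro ring.triple_br_zero[OF R]) (simp_all only: car ring_mat_simps)
  moreover have c1: "e * x - x * e \<in> carrier_mat m m"
    by (rule bracket_carrier[OF assms(3,4)])
  moreover have "c * (e * x - x * e) - (e * x - x * e) * c \<in> carrier_mat m m"
    by (rule bracket_carrier[OF assms(2) c1])
  ultimately show ?thesis
    using assms(1-4) by (simp only: br ring_mat_simps)
qed

subsection \<open>The localized enveloping algebra\<close>

lemma (in ring) inv_mult_Units:
  assumes "x \<in> Units R" "y \<in> Units R"
  shows "inv (x \<otimes> y) = inv y \<otimes> inv x"
proof -
  have c: "x \<in> carrier R" "y \<in> carrier R" "inv x \<in> carrier R" "inv y \<in> carrier R"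
    using assms by auto
  have "(x \<otimes> y) \<otimes> (inv y \<otimes> inv x) = x \<otimes> (y \<otimes> inv y) \<otimes> inv x"
    using c by (simp add: m_assoc del: Units_r_inv)
  moreover have "(inv y \<otimes> inv x) \<otimes> (x \<otimes> y) = inv y \<otimes> (inv x \<otimes> x) \<otimes> y"
    using c by (simp add: m_assoc del: Units_l_inv)
  ultimately show ?thesis
    using assms c by (intro inv_char) simp_all
qed

lemma (in ring) cprod_single_factor:
  assumes "distinct L" "i \<in> set L" "x \<in> carrier R"
  shows "cprod (\<lambda>j. if j = i then x else \<one>) L = x"
proof -
  have "x = x \<otimes> cprod (\<lambda>_. \<one>) L" using assms(3) by (simp add: cprod_one)
  also have "\<dots> = cprod ((\<lambda>_. \<one>)(i := x \<otimes> \<one>)) L"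
    using assms by (intro mult_cprod) auto
  also have "\<dots> = cprod (\<lambda>j. if j = i then x else \<one>) L"
    using assms(3) by (intro cprod_cong) auto
  finally show ?thesis by simp
qed

locale sp_localization = complex_algebra A for A :: "(complex, 'a) module" (structure) +
  fixes n :: nat and \<phi> :: "(complex mat list \<Rightarrow>\<^sub>0 complex) set \<Rightarrow> 'a"
  assumes n: "n \<ge> 2" and loc: "ore_localization (U_sp n) (S_set n) A \<phi>"

sublocale sp_localization \<subseteq> enveloping_hom A "sp n" \<phi>
  using loc by unfold_locales (auto simp: sp_add sp_smult sp_bracket ore_localization_def)

context sp_localization
begin

abbreviation tt :: "nat \<Rightarrow> 'a" where "tt i \<equiv> incl (t_mat n i)"
abbreviation dd :: "nat \<Rightarrow> 'a" where "dd i \<equiv> incl (d_mat n i)"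

lemma t_mat_in_S:
  assumes i: "i \<in> {1..n}"
  shows "U_incl n (t_mat n i) \<in> S_set n"
proof -
  \<comment> \<open>The exponent vector with a single 1, at position \<open>i\<close>.\<close>
  let ?U = "U_sp n" and ?e = "\<lambda>j. if j = i then 1 else 0 :: nat" and ?X = "\<lambda>j. U_incl n (X_mat n 1 j)"
  note R = enveloping_ring
  note Umon = ring.is_monoid[OF R]
  have X: "?X j \<in> carrier ?U" if "j \<in> {2..n}" for j
    using enveloping_incl_closed[OF t_mat_in_sp[of j n]] that by (simp add: t_mat_def)
  have X2: "U_incl n (X2_mat n) \<in> carrier ?U"
    using enveloping_incl_closed[OF t_mat_in_sp[of 1 n]] n by (simp add: t_mat_def)
  have "foldr (\<lambda>j u. ?X j [^]\<^bsub>?U\<^esub> ?e j \<otimes>\<^bsub>?U\<^esub> u) [2..<Suc n] \<one>\<^bsub>?U\<^esub> =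
      ring.cprod ?U (\<lambda>j. ?X j [^]\<^bsub>?U\<^esub> ?e j) [2..<Suc n]"
    by (simp only: ring.cprod_def[OF R])
  also have "\<dots> = ring.cprod ?U (\<lambda>j. if j = i then ?X i else \<one>\<^bsub>?U\<^esub>) [2..<Suc n]"
    using X i by (intro ring.cprod_cong[OF R]) (auto simp: monoid.nat_pow_0[OF Umon] monoid.nat_pow_eone[OF Umon] monoid.l_one[OF Umon])
  also have "\<dots> = (if i = 1 then \<one>\<^bsub>?U\<^esub> else ?X i)"
  proof (cases "i = 1")
    case True
    then show ?thesis by (auto intro!: ring.cprod_one[OF R])
  next
    case False
    then have i2: "i \<in> {2..n}" using i by auto
    then have "i \<in> set [2..<Suc n]" by auto
    from ring.cprod_single_factor[OF R distinct_upt this X[OF i2]]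
    show ?thesis by (simp only: False if_False)
  qed
  finally have f: "foldr (\<lambda>j u. ?X j [^]\<^bsub>?U\<^esub> ?e j \<otimes>\<^bsub>?U\<^esub> u) [2..<Suc n] \<one>\<^bsub>?U\<^esub> =
      (if i = 1 then \<one>\<^bsub>?U\<^esub> else ?X i)" .
  have "U_incl n (X2_mat n) [^]\<^bsub>?U\<^esub> ?e 1 \<otimes>\<^bsub>?U\<^esub>
      foldr (\<lambda>j u. ?X j [^]\<^bsub>?U\<^esub> ?e j \<otimes>\<^bsub>?U\<^esub> u) [2..<Suc n] \<one>\<^bsub>?U\<^esub> = U_incl n (t_mat n i)"
  proof (cases "i = 1")
    case True
    then show ?thesis unfolding f
      using X2 by (simp add: t_mat_def monoid.nat_pow_eone[OF Umon] monoid.r_one[OF Umon] monoid.l_one[OF Umon])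
  next
    case False
    then show ?thesis unfolding f
      using X[of i] i by (simp add: t_mat_def monoid.nat_pow_0[OF Umon] monoid.l_one[OF Umon])
  qed
  then show ?thesis unfolding S_set_def by (intro CollectI exI[of _ ?e]) simp
qed

lemma tt_Units: "i \<in> {1..n} \<Longrightarrow> tt i \<in> Units A"
  using loc t_mat_in_S unfolding ore_localization_def incl_def by blast

lemma incl_zero: "incl (0\<^sub>m (2 * n) (2 * n)) = \<zero>"
proof -
  have "0\<^sub>m (2 * n) (2 * n) = 0 \<cdot>\<^sub>m (0\<^sub>m (2 * n) (2 * n) :: complex mat)"
    by (intro eq_matI) auto
  then show ?thesis
    using incl_smult[OF sp_zero, of 0] incl_closed[OF sp_zero[of n]] by simp
qed

lemma br_tt_tt:
  assumes "i \<in> {1..n}" "j \<in> {1..n}"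
  shows "br (tt i) (tt j) = \<zero>"
proof -
  have "t_mat n i * t_mat n j - t_mat n j * t_mat n i = 0\<^sub>m (2 * n) (2 * n)"
    using t_t_mult[OF assms] t_t_mult[OF assms(2,1)] by (auto intro!: eq_matI)
  then show ?thesis using assms by (simp add: br_incl t_mat_in_sp incl_zero)
qed

lemma weyl: "weyl_pairs A n tt dd"
proof unfold_locales
  fix i j assume ij: "i \<in> {1..n}" "j \<in> {1..n}"
  show "tt i \<in> Units A" using ij by (simp add: tt_Units)
  show "dd i \<in> carrier A" by (simp add: d_mat_in_sp)
  show "br (tt i) (tt j) = \<zero>" by (rule br_tt_tt[OF ij])
  show "br (dd i) (dd j) = \<zero>"
    by (simp add: br_incl d_mat_in_sp d_d_bracket incl_smult)
  show "br (dd i) (tt j) = (if i = j then tt j else \<zero>)"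
    using ij by (simp add: br_incl d_mat_in_sp t_mat_in_sp d_t_bracket incl_smult)
qed

end

sublocale sp_localization \<subseteq> weyl_pairs A n tt dd
  by (rule weyl)

context sp_localization
begin

text \<open>The \<open>tt i\<close> are units of \<open>A\<close>, so the vanishing of their
  products is available only for matrices: the triple bracket is evaluated in \<open>sp n\<close>
  and carried over by \<open>br_incl\<close>.\<close>

lemma nilp_incl:
  assumes x: "x \<in> sp n"
  shows "nilp 3 (incl x)"
proof -
  let ?b = "\<lambda>a x :: complex mat. a * x - x * a"
  have "br (tt i) (br (tt j) (br (tt k) (incl x))) = \<zero>"
    if "i \<in> {1..n}" "j \<in> {1..n}" "k \<in> {1..n}" for i j k
  proof -
    let ?a = "t_mat n i" and ?c = "t_mat n j" and ?e = "t_mat n k"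
    have "?b ?a (?b ?c (?b ?e x)) = 0\<^sub>m (2 * n) (2 * n)"
      using x that by (intro mat_triple_bracket_zero) (simp_all only: t_t_mult t_mat_carrier sp_carrier)
    moreover have "?b ?e x \<in> sp n" "?b ?c (?b ?e x) \<in> sp n"
      using x that by (simp_all only: sp_bracket t_mat_in_sp)
    ultimately show ?thesis
      using x that by (simp add: br_incl t_mat_in_sp incl_zero)
  qed
  then show ?thesis by (simp add: numeral_3_eq_3)
qed

lemma incl_in_ideal_prod: "x \<in> sp n \<Longrightarrow> incl x \<in> ideal_prod A B C"
proof (induct x rule: sp_weight_induct)
  case zero
  then show ?case
    using subringE(2) ideal_prod_BC_subalgebra by (auto simp: incl_zero complex_subalgebra_def)
next
  case (add x y)
  then show ?case by (simp add: incl_add ideal_prod.sum)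
next
  case (weight y w)
  show ?case
  proof (rule weight_in_ideal_prod)
    show "incl y \<in> carrier A" "nilp 3 (incl y)" using weight(1) by (simp_all add: nilp_incl)
    show "weyl_pairs.weight A n dd w (incl y)"
      unfolding weight_def
      using weight by (simp add: br_incl d_mat_in_sp incl_smult)
  qed
qed

section \<open>Comparison of \<open>B\<close> with \<open>B_alg\<close>, and the
  denominators\<close>

lemma B_alg_gens_eq:
  "i \<in> {1..n} \<Longrightarrow> \<phi> (U_incl n (h_mat n i)) = incl (diag_sp n (\<lambda>k. if k = i then 1 else 0))"
  "j \<in> {2..n} \<Longrightarrow> \<phi> (U_incl n (X_mat n 1 j)) = tt j"
  "\<phi> (U_incl n (X2_mat n)) = tt 1"
  by (simp_all add: incl_def h_mat_eq t_mat_def)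

lemma incl_subspace:
  assumes "complex_subalgebra H A" "finite P"
    and "\<And>i. i \<in> P \<Longrightarrow> incl (diag_sp n (\<lambda>k. if k = i then 1 else 0)) \<in> H"
    and "\<And>k. \<lbrakk>k \<in> {1..n}; k \<notin> P\<rbrakk> \<Longrightarrow> f k = 0"
  shows "incl (diag_sp n f) \<in> H"
proof (rule diag_sp_subspace[where V = "\<lambda>x. incl x \<in> H" and P = P])
  have sr: "subring H A" and sm: "\<And>c x. x \<in> H \<Longrightarrow> c \<odot> x \<in> H"
    using assms(1) by (auto simp: complex_subalgebra_def)
  show "incl (0\<^sub>m (2 * n) (2 * n)) \<in> H" using subringE(2)[OF sr] by (simp add: incl_zero)
  show "incl (x + y) \<in> H" if "x \<in> sp n" "y \<in> sp n" "incl x \<in> H" "incl y \<in> H" for x y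
    using that subringE(7)[OF sr] by (simp add: incl_add)
  show "incl (c \<cdot>\<^sub>m x) \<in> H" if "x \<in> sp n" "incl x \<in> H" for c x
    using that sm by (simp add: incl_smult)
qed (use assms in auto)

lemma h_in_B:
  assumes i: "i \<in> {1..n}"
  shows "incl (diag_sp n (\<lambda>k. if k = i then 1 else 0)) \<in> B"
proof -
  let ?u = "\<lambda>i k :: nat. if k = i then 1 else 0 :: complex"
  have ge2: "incl (diag_sp n (?u j)) \<in> B" if j: "j \<in> {2..n}" for j
  proof -
    have "diag_sp n (?u j) = (-1) \<cdot>\<^sub>m d_mat n j"
      using j by (intro eq_matI) (auto simp: d_mat_def diag_sp_def diag_val_def)
    then have "incl (diag_sp n (?u j)) = (-1) \<odot> dd j"
      by (simp add: incl_smult d_mat_in_sp)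
    then show ?thesis using j gens_B(3)[of j] by (simp add: B_smult)
  qed
  show ?thesis
  proof (cases "i = 1")
    case False
    then show ?thesis using i ge2[of i] by simp
  next
    case True
    \<comment> \<open>As \<open>d_mat n 1\<close> is half the sum of all h_k, h_1 is twice it minus
      the h_k with k > 1; \<open>?f\<close> describes that second part, sign included.\<close>
    let ?f = "\<lambda>k. if k = 1 then 0 else - 1 :: complex"
    have "incl (diag_sp n ?f) \<in> B"
      by (rule incl_subspace[OF B_subalgebra, of "{2..n}"]) (use ge2 in auto)
    moreover have "diag_sp n (?u 1) = 2 \<cdot>\<^sub>m d_mat n 1 + diag_sp n ?f"
      by (intro eq_matI) (auto simp: d_mat_def diag_sp_def diag_val_def)
    then have "incl (diag_sp n (?u 1)) = 2 \<odot> dd 1 \<oplus> incl (diag_sp n ?f)"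
      by (simp add: incl_add incl_smult d_mat_in_sp diag_sp_in_sp sp_smult)
    ultimately show ?thesis
      using True i gens_B(3)[of 1] by (simp add: B_smult BC_add_closed)
  qed
qed

lemma B_alg_eq: "B_alg n A \<phi> = B"
proof
  let ?X = "{\<phi> (U_incl n (h_mat n i)) | i. i \<in> {1..n}} \<union>
      {\<phi> (U_incl n (X_mat n 1 j)) | j. j \<in> {2..n}} \<union>
      {inv (\<phi> (U_incl n (X_mat n 1 j))) | j. j \<in> {2..n}} \<union>
      {\<phi> (U_incl n (X2_mat n)), inv (\<phi> (U_incl n (X2_mat n)))}"
  let ?H = "generated_subalgebra A ?X"
  have n1: "1 \<in> {1..n}" using n by simp
  have h: "\<phi> (U_incl n (h_mat n i)) \<in> B" if "i \<in> {1..n}" for i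
    unfolding B_alg_gens_eq(1)[OF that] by (rule h_in_B[OF that])
  have t: "\<phi> (U_incl n (X_mat n 1 j)) \<in> B" "inv (\<phi> (U_incl n (X_mat n 1 j))) \<in> B"
    if "j \<in> {2..n}" for j
  proof -
    have j: "j \<in> {1..n}" using that by simp
    show "\<phi> (U_incl n (X_mat n 1 j)) \<in> B" "inv (\<phi> (U_incl n (X_mat n 1 j))) \<in> B"
      unfolding B_alg_gens_eq(2)[OF that] by (rule gens_B(1)[OF j], rule gens_B(2)[OF j])
  qed
  have t1: "\<phi> (U_incl n (X2_mat n)) \<in> B" "inv (\<phi> (U_incl n (X2_mat n))) \<in> B"
    unfolding B_alg_gens_eq(3) by (rule gens_B(1)[OF n1], rule gens_B(2)[OF n1])
  have sub: "?X \<subseteq> B"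
    by (intro Un_least subsetI; elim CollectE exE conjE insertE emptyE; simp only: h t t1)
  then show "B_alg n A \<phi> \<subseteq> B"
    unfolding B_alg_def by (rule generated_subalgebra_least[OF B_subalgebra])
  have "?X \<subseteq> carrier A" using sub B_closed by (rule subset_trans[OF _ subsetI])
  then have H: "complex_subalgebra ?H A" by (rule generated_subalgebra)
  note X = subsetD[OF subset_generated_subalgebra[of ?X]]
  have hX: "\<phi> (U_incl n (h_mat n i)) \<in> ?H" if "i \<in> {1..n}" for i
    by (rule X, rule UnI1, rule UnI1, rule UnI1, rule CollectI, rule exI, rule conjI[OF refl that])
  have tX: "\<phi> (U_incl n (X_mat n 1 j)) \<in> ?H" if "j \<in> {2..n}" for j
    by (rule X, rule UnI1, rule UnI1, rule UnI2, rule CollectI, rule exI, rule conjI[OF refl that])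
  have iX: "inv (\<phi> (U_incl n (X_mat n 1 j))) \<in> ?H" if "j \<in> {2..n}" for j
    by (rule X, rule UnI1, rule UnI2, rule CollectI, rule exI, rule conjI[OF refl that])
  have t1X: "\<phi> (U_incl n (X2_mat n)) \<in> ?H" "inv (\<phi> (U_incl n (X2_mat n))) \<in> ?H"
    by (rule X, rule UnI2, rule insertI1, rule X, rule UnI2, rule insertI2, rule insertI1)
  have tt: "tt i \<in> ?H" "inv tt i \<in> ?H" if "i \<in> {1..n}" for i
  proof -
    show "tt i \<in> ?H"
    proof (cases "i = 1")
      case True
      show ?thesis unfolding True using t1X(1) unfolding B_alg_gens_eq(3) .
    next
      case False
      then have i2: "i \<in> {2..n}" using that by simp
      show ?thesis using tX[OF i2] B_alg_gens_eq(2)[OF i2] by argo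
    qed
    show "inv tt i \<in> ?H"
    proof (cases "i = 1")
      case True
      show ?thesis unfolding True using t1X(2) unfolding B_alg_gens_eq(3) .
    next
      case False
      then have i2: "i \<in> {2..n}" using that by simp
      show ?thesis using iX[OF i2] arg_cong[OF B_alg_gens_eq(2)[OF i2], of "\<lambda>x. inv x"] by argo
    qed
  qed
  have dd: "dd i \<in> ?H" for i
    unfolding d_mat_def
  proof (rule incl_subspace[OF H, of "{1..n}"])
    fix k assume k: "k \<in> {1..n}"
    show "incl (diag_sp n (\<lambda>m. if m = k then 1 else 0)) \<in> ?H"
      using hX[OF k] unfolding B_alg_gens_eq(1)[OF k] .
  qed (rule finite_atLeastAtMost, erule notE, assumption)
  have "gens \<subseteq> ?H"
    unfolding gens_def
    by (intro Un_least image_subsetI tt dd)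
  then show "B \<subseteq> B_alg n A \<phi>"
    unfolding B_alg_def B_def by (rule generated_subalgebra_least[OF H])
qed

text \<open>A denominator is a product of powers of the chosen root vectors, so its inverse is a
  product of the \<open>inv tt i\<close> in reverse order. \<open>P\<close> records invertibility
  too, since the inverse of a product is formed from units.\<close>

lemma inv_S_in_B:
  assumes "s \<in> S_set n"
  shows "inv (\<phi> s) \<in> B"
proof -
  let ?U = "U_sp n"
  define P where "P u \<longleftrightarrow> u \<in> carrier ?U \<and> \<phi> u \<in> Units A \<and> inv (\<phi> u) \<in> B" for u
  have Umon: "Group.monoid ?U" by (rule ring.is_monoid[OF enveloping_ring])
  have one: "P \<one>\<^bsub>?U\<^esub>"
    using alg_hom_one[OF \<phi>_hom] monoid.one_closed[OF Umon] subringE(3)[OF B_subring]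
    by (simp add: P_def)
  have mult: "P (u \<otimes>\<^bsub>?U\<^esub> v)" if "P u" "P v" for u v
  proof -
    have uv: "u \<in> carrier ?U" "v \<in> carrier ?U" "\<phi> u \<in> Units A" "\<phi> v \<in> Units A"
      "inv (\<phi> u) \<in> B" "inv (\<phi> v) \<in> B"
      using that by (auto simp: P_def)
    then show ?thesis
      using monoid.m_closed[OF Umon uv(1,2)] subringE(6)[OF B_subring uv(6,5)]
      by (simp add: P_def alg_hom_mult[OF \<phi>_hom] inv_mult_Units)
  qed
  have pow: "P (u [^]\<^bsub>?U\<^esub> (m::nat))" if "P u" for u m
    by (induct m) (simp_all add: monoid.nat_pow_0[OF Umon] monoid.nat_pow_Suc[OF Umon] one mult that)
  have gen: "P (U_incl n (t_mat n i))" if "i \<in> {1..n}" for i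
    using that tt_Units[OF that] gens_B(2)[OF that] enveloping_incl_closed[OF t_mat_in_sp[OF that]]
    by (simp add: P_def incl_def)
  have X: "P (U_incl n (X_mat n 1 j))" if "j \<in> {2..n}" for j
    using gen[of j] that by (simp add: t_mat_def)
  have X2: "P (U_incl n (X2_mat n))"
    using gen[of 1] n by (simp add: t_mat_def)
  have fold: "P (foldr (\<lambda>j u. U_incl n (X_mat n 1 j) [^]\<^bsub>?U\<^esub> (e j :: nat) \<otimes>\<^bsub>?U\<^esub> u) L \<one>\<^bsub>?U\<^esub>)"
    if "set L \<subseteq> {2..n}" for e L
    using that
  proof (induct L)
    case Nil
    show ?case using one by simp
  next
    case (Cons j L)
    then have "j \<in> {2..n}" "set L \<subseteq> {2..n}" by auto
    with Cons(1) show ?case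
      unfolding foldr.simps comp_apply by (intro mult pow X)
  qed
  obtain e where s: "s = U_incl n (X2_mat n) [^]\<^bsub>?U\<^esub> e 1 \<otimes>\<^bsub>?U\<^esub>
      foldr (\<lambda>j u. U_incl n (X_mat n 1 j) [^]\<^bsub>?U\<^esub> (e j :: nat) \<otimes>\<^bsub>?U\<^esub> u) [2..<Suc n] \<one>\<^bsub>?U\<^esub>"
    using assms unfolding S_set_def by (elim CollectE exE conjE)
  have "P s"
    unfolding s by (rule mult[OF pow[OF X2] fold]) auto
  then show ?thesis unfolding P_def by (elim conjE)
qed

lemma carrier_eq_ideal_prod: "carrier A = ideal_prod A B C"
proof
  show "ideal_prod A B C \<subseteq> carrier A" using ideal_prod_BC_closed by blast
  show "carrier A \<subseteq> ideal_prod A B C"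
  proof
    fix q assume "q \<in> carrier A"
    then obtain s a where sa: "s \<in> S_set n" "a \<in> carrier (U_sp n)" "q = inv (\<phi> s) \<otimes> \<phi> a"
      using loc unfolding ore_localization_def by blast
    have ideal_prod_BC_subring: "subring (ideal_prod A B C) A"
      using ideal_prod_BC_subalgebra by (simp add: complex_subalgebra_def)
    \<comment> \<open>The numerator lies in the subalgebra B C because the images of all matrices in
      \<open>sp n\<close> do; the inverted denominator adds a factor from \<open>B\<close>.\<close>
    have "\<phi> a \<in> ideal_prod A B C"
      using ideal_prod_BC_subalgebra incl_in_ideal_prod sa(2) by (rule range_in_subalgebra)
    then show "q \<in> ideal_prod A B C"
      unfolding sa(3)
      by (rule subringE(6)[OF ideal_prod_BC_subring B_in_ideal_prod[OF inv_S_in_B[OF sa(1)]]])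
  qed
qed

end

theorem theorem3p2:
  fixes n :: nat
    and US :: "(complex, 'q) module"
    and \<phi> :: "(complex mat list \<Rightarrow>\<^sub>0 complex) set \<Rightarrow> 'q"
  assumes "n \<ge> 2"
    and "ore_localization (U_sp n) (S_set n) US \<phi>"
  shows "let B = B_alg n US \<phi>; C = centralizer US B in
      carrier US = ideal_prod US B C \<and>
      alg_isomorphic US (tensor_alg (restrict_alg US B) (restrict_alg US C)) \<and>
      alg_isomorphic (restrict_alg US (center US))
        (restrict_alg (restrict_alg US C) (center (restrict_alg US C)))"
proof -
  interpret sp_localization US n \<phi>
    using assms by (simp add: sp_localization_def sp_localization_axioms_def ore_localization_def)
  have eq: "carrier US = ideal_prod US B C" by (rule carrier_eq_ideal_prod)
  show ?thesis
    unfolding Let_def B_alg_eq C_def[symmetric]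
    using eq tensor_decomposition[OF eq] center_decomposition[OF eq] alg_isomorphic_refl
    by simp
qed

end
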